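(* Let $n\geq5$, let $\delta,\tau\in(0,1)$, and let $p$ be a prime with $p>64n/(\tau\delta)^2$. Let $L\subset\mathbb{R}^n$ be a lattice, written $L=g\mathbb{Z}^n$ for an invertible $n\times n$ matrix $g$, and let $\mathcal{K}\subset\mathbb{R}^n$ be a bounded convex set with nonempty interior. Assume there is a real number $1<c<\frac{p}{2n}$ such that $(L,(1+\frac cp)\mathcal{K})$ is a packing and $(L,c\mathcal{K})$ is a covering. Let $4\leq r\leq n$ be an integer with $$r>3+\log_p\frac{\mathrm{covol}(L)}{\mathrm{vol}(\mathcal{K})}+3c\,\frac{n}{p\log p},$$ and let $S$ be uniformly distributed on $\mathrm{Gr}_{n,r}(\mathbb{F}_p)$. Then $$\Pr\left(\eta(\mathcal{K},L(S))\geq\tau+8c\,\frac np\right)<2\delta.$$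
   Context: $\mathrm{Gr}_{n,r}(\mathbb{F}_p)$ is the set of $r$-dimensional subspaces of $\mathbb{F}_p^n$. With $\pi_p:\mathbb{Z}^n\to\mathbb{F}_p^n$ coordinatewise reduction mod $p$, for $S\in\mathrm{Gr}_{n,r}(\mathbb{F}_p)$ define $L(S)=\frac1p\,g\,\pi_p^{-1}(S)$. For a lattice $L$, a bounded convex $\mathcal{K}$ with nonempty interior and $x\in\mathbb{R}^n$, $N(L,\mathcal{K},x)=|L\cap(\mathcal{K}+x)|$ and $\eta(\mathcal{K},L)=\sup_{x\in\mathbb{R}^n}\left|\frac{N(L,\mathcal{K},x)}{\mathrm{vol}(\mathcal{K})/\mathrm{covol}(L)}-1\right|$. $(L,\mathcal{K})$ is a covering if $L+\mathcal{K}=\mathbb{R}^n$ and a packing if the translates $\ell+\mathcal{K}$, $\ell\in L$, are pairwise disjoint. $\log$ is the natural logarithm. *)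

theory Defs
  imports
    "HOL-Probability.Probability"
    "Berlekamp_Zassenhaus.Finite_Field"
begin

text \<open>
  The field with \<open>p\<close> elements is \<open>'p mod_ring\<close>, where \<open>'p\<close> is of class \<^class>\<open>prime_card\<close> and
  \<open>p = CARD('p)\<close>; the prefix \<open>vec\<close> refers to coordinate spaces over an arbitrary field, with
  scalar multiplication \<open>*s\<close>.
\<close>

definition Gr :: "nat \<Rightarrow> (('p::prime_card mod_ring) ^ 'n) set set" where
  "Gr r = {S. vec.subspace S \<and> vec.dim S = r}"

text \<open>
  With target \<^typ>\<open>real\<close> this is the inclusion of \<open>\<int>\<^sup>n\<close> into \<open>\<real>\<^sup>n\<close>; with target
  \<open>'p mod_ring\<close> it is the coordinatewise reduction \<open>\<pi>\<^sub>p\<close>.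
\<close>

definition of_int_vec :: "int ^ 'n \<Rightarrow> ('a::ring_1) ^ 'n" where
  "of_int_vec z = (\<chi> i. of_int (z $ i))"

definition lattice_of :: "real ^ 'n ^ 'n \<Rightarrow> (real ^ 'n) set" where
  "lattice_of g = range (\<lambda>z. g *v of_int_vec z)"

definition covol :: "(real ^ 'n) set \<Rightarrow> real" where
  "covol L = (THE v. \<exists>g. invertible g \<and> L = lattice_of g \<and> v = \<bar>det g\<bar>)"

text \<open>
  \<open>L(S) = (1/p) g \<pi>\<^sub>p\<^sup>-\<^sup>1(S)\<close>. As in this formula, the lattice depends on the chosen
  basis \<open>g\<close> and not only on \<open>g\<int>\<^sup>n\<close>.
\<close>

definition lattice_lift ::
    "real ^ 'n ^ 'n \<Rightarrow> (('p::prime_card mod_ring) ^ 'n) set \<Rightarrow> (real ^ 'n) set" where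
  "lattice_lift g S = (\<lambda>z. (1 / real CARD('p)) *\<^sub>R (g *v of_int_vec z)) ` (of_int_vec -` S)"

definition lattice_count :: "(real ^ 'n) set \<Rightarrow> (real ^ 'n) set \<Rightarrow> real ^ 'n \<Rightarrow> nat" where
  "lattice_count L K x = card (L \<inter> (\<lambda>k. k + x) ` K)"

text \<open>
  For a lattice \<open>L\<close> and a bounded \<open>K\<close>, the counts are finite and bounded uniformly in \<open>x\<close>, so the
  real-valued supremum is the usual one. Bounded convex sets need not be Borel, hence
  \<^const>\<open>lebesgue\<close>.
\<close>

definition eta :: "(real ^ 'n) set \<Rightarrow> (real ^ 'n) set \<Rightarrow> real" where
  "eta K L =
     (SUP x. \<bar>real (lattice_count L K x) / (measure lebesgue K / covol L) - 1\<bar>)"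

definition is_covering :: "(real ^ 'n) set \<Rightarrow> (real ^ 'n) set \<Rightarrow> bool" where
  "is_covering L K \<longleftrightarrow> {l + k | l k. l \<in> L \<and> k \<in> K} = UNIV"

definition is_packing :: "(real ^ 'n) set \<Rightarrow> (real ^ 'n) set \<Rightarrow> bool" where
  "is_packing L K \<longleftrightarrow> disjoint_family_on (\<lambda>l. (\<lambda>k. l + k) ` K) L"

definition of_int_mat :: "int ^ 'n ^ 'n \<Rightarrow> real ^ 'n ^ 'n" where
  "of_int_mat U = (\<chi> i j. of_int (U $ i $ j))"

lemma det_of_int_mat: "det (of_int_mat U) = of_int (det U)"
  by (simp add: det_def of_int_mat_def)

lemma lattice_of_subset_imp_factor:
  fixes B g :: "real ^ 'n ^ 'n"
  assumes "lattice_of B \<subseteq> lattice_of g"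
  obtains U where "B = g ** of_int_mat U"
proof -
  have "\<exists>z::int^'n. column j B = g *v of_int_vec z" for j
  proof -
    have "of_int_vec (axis j 1 :: int ^ 'n) = (axis j 1 :: real ^ 'n)"
      by (simp add: of_int_vec_def axis_def vec_eq_iff)
    then have "column j B \<in> lattice_of B"
      unfolding lattice_of_def
      by (intro image_eqI[of _ _ "axis j 1"]) (simp_all add: matrix_vector_mult_basis)
    with assms show ?thesis
      by (auto simp: lattice_of_def)
  qed
  then obtain Z :: "'n \<Rightarrow> int ^ 'n" where Z: "column j B = g *v of_int_vec (Z j)" for j
    by metis
  have "B = g ** of_int_mat (\<chi> i j. Z j $ i)"
    using Z by (simp add: vec_eq_iff column_def matrix_matrix_mult_def matrix_vector_mult_def
        of_int_mat_def of_int_vec_def)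
  then show ?thesis by (rule that)
qed

lemma covol_lattice_of:
  fixes g :: "real ^ 'n ^ 'n"
  assumes g: "invertible g"
  shows "covol (lattice_of g) = \<bar>det g\<bar>"
proof -
  have *: "\<bar>det g\<bar> \<le> \<bar>det B\<bar>"
    if B: "invertible B" and sub: "lattice_of B \<subseteq> lattice_of g" for g B :: "real ^ 'n ^ 'n"
  proof -
    obtain U where U: "B = g ** of_int_mat U"
      using sub by (rule lattice_of_subset_imp_factor)
    have d: "det B = det g * of_int (det U)"
      by (simp add: U det_mul det_of_int_mat)
    with B have "det U \<noteq> 0"
      by (auto simp: invertible_det_nz)
    then have "1 \<le> \<bar>real_of_int (det U)\<bar>"
      by linarith
    then show ?thesis
      by (simp add: d abs_mult mult_le_cancel_left1)
  qed
  show ?thesis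
    unfolding covol_def
  proof (rule the_equality)
    show "\<exists>h. invertible h \<and> lattice_of g = lattice_of h \<and> \<bar>det g\<bar> = \<bar>det h\<bar>"
      using g by blast
  next
    fix v assume "\<exists>h. invertible h \<and> lattice_of g = lattice_of h \<and> v = \<bar>det h\<bar>"
    then show "v = \<bar>det g\<bar>"
      using *[of g] *[of _ g] g by (metis order_antisym order_refl)
  qed
qed

end

theory Submission
  imports Defs
begin

text \<open>
  Write \<open>q = p\<close>. By convexity and the covering property every translate \<open>K + x\<close> is squeezed
  between translates of \<open>(1 \<mp> c/p) K\<close> by points of \<open>(1/p) L\<close>, and by the packing property the
  points of \<open>(1/p) L\<close> in such a dilate reduce injectively to a set \<open>A\<close> in \<open>\<bbbF>\<^sub>q\<^sup>n\<close>, whose size is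
  compared with the volume of \<open>K\<close> by averaging over translates. So it suffices that, with
  probability above \<open>1 - \<delta>\<close>, all translates of \<open>S\<close> meet \<open>A\<close> in about
  \<open>M = |A| q\<^sup>r\<^sup>-\<^sup>n \<ge> q\<^sup>3\<close> points.

  Split \<open>S\<close> as \<open>U + span {u, v}\<close> with \<open>U\<close> of dimension \<open>r - 2\<close>. Counting pairs of points of \<open>A\<close>
  that differ by an element of \<open>U\<close> shows that the fibre counts \<open>|A \<inter> (z + U)|\<close> have variance at
  most their mean \<open>M/q\<^sup>2 \<ge> q\<close>, both over \<open>z\<close> in the whole space and over \<open>z\<close> in an unbalanced
  translate of \<open>S\<close>. Hence the set \<open>E\<close> of \<open>z\<close> with an atypical fibre has density \<open>O(1/q)\<close>, while it
  fills all but an \<open>O(1/q)\<close> part of an unbalanced translate. If unbalanced translates were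
  frequent, \<open>E\<close> would almost contain planes in a positive proportion of all directions \<open>(u, v)\<close>.

  This contradicts a Kakeya theorem for planes, proved by the polynomial method: a nonzero
  polynomial \<open>P\<close> vanishing to high order on a small set \<open>E\<close> vanishes, together with its low order
  derivatives, on these planes, so that its leading form vanishes to high order at the points
  \<open>u + t v\<close> of \<open>\<bbbF>\<^sub>q[t]\<^sup>n\<close>; these are too many points of a grid with \<open>q\<^sup>2\<close> elements per coordinate
  for the Schwartz--Zippel lemma with multiplicities.
\<close>

section \<open>Polynomials as coefficient families: Hasse derivatives and multiplicities\<close>

text \<open>The obstacle is that all translates of S must be balanced at once: a second moment
  controls one translate, but there are q^(n-r) of them, too many for a union bound. The set E
  removes the translate from the problem, because it depends on U alone and has to absorb the
  unbalanced translates of all S containing U. Splitting off a plane rather than a line keeps the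
  requirement on p linear in n. A set with a line in every direction may have density about 2^(-n).
  For planes the grid at infinity has q^2 elements per coordinate while the degree is only about q
  times the vanishing order on E, so a much smaller order suffices at infinity, and the density
  bound 1/4 is uniform in n. The exponent 3 in M \<ge> q^3 is 2 + 1: two powers of q pay for the
  plane, and one makes the mean fibre at least q, so that Chebyshev leaves a proportion O(1/q). The
  number 64 n serves three needs: 16/(\<tau>^2 q \<delta>) < 1/4, 16/(\<tau>^2 q) \<le> 1/(4n) and
  8n \<le> q \<delta>/8.\<close>

text \<open>
  A polynomial is a family \<open>c\<close> of coefficients together with a finite set \<open>X\<close> of exponents; \<open>hasse X c i a\<close>
  is the value at \<open>a\<close> of its \<open>i\<close>-th Hasse derivative, so the multiplicity at \<open>a\<close> is at least \<open>m\<close>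
  when these values vanish for all \<open>i\<close> of weight less than \<open>m\<close>.
\<close>

definition hasse ::
    "('v::finite \<Rightarrow> nat) set \<Rightarrow> (('v \<Rightarrow> nat) \<Rightarrow> 'a::comm_ring_1) \<Rightarrow> ('v \<Rightarrow> nat) \<Rightarrow> ('v \<Rightarrow> 'a) \<Rightarrow> 'a" where
  "hasse X c i a = (\<Sum>e\<in>X. c e * (\<Prod>v\<in>UNIV. of_nat (e v choose i v) * a v ^ (e v - i v)))"

definition exps :: "nat \<Rightarrow> ('v::finite \<Rightarrow> nat) set" where
  "exps d = {e. sum e UNIV \<le> d}"

lemma le_sum_UNIV: "e v \<le> sum e UNIV" for e :: "'v::finite \<Rightarrow> nat"
  by (rule member_le_sum) auto

lemma finite_box: "finite {e::'v::finite \<Rightarrow> nat. \<forall>v. e v \<le> d}"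
proof -
  have "{e::'v \<Rightarrow> nat. \<forall>v. e v \<le> d} = PiE UNIV (\<lambda>_. {..d})"
    by (auto simp: PiE_def extensional_def)
  then show ?thesis by (simp add: finite_PiE)
qed

lemma finite_exps [simp]: "finite (exps d :: ('v::finite \<Rightarrow> nat) set)"
  by (rule finite_subset[OF _ finite_box[of d]])
     (use le_sum_UNIV order_trans in \<open>fastforce simp: exps_def\<close>)

section \<open>Zeros counted with multiplicity, on a line and on a grid\<close>

lemma sum_mult_roots_le:
  fixes q :: "'a::idom poly"
  assumes "q \<noteq> 0" "finite G" and N: "\<And>b. b \<in> G \<Longrightarrow> [:-b, 1:] ^ N b dvd q"
  shows "(\<Sum>b\<in>G. N b) \<le> Polynomial.degree q"
proof -
  have "(\<Sum>b\<in>G. N b) \<le> (\<Sum>b\<in>G. count (proots q) b)"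
    using assms by (intro sum_mono) (auto simp: order_max order_divides)
  also have "\<dots> = (\<Sum>b\<in>G \<inter> set_mset (proots q). count (proots q) b)"
    using assms by (intro sum.mono_neutral_right) (auto simp del: count_proots simp: count_eq_zero_iff)
  also have "\<dots> \<le> (\<Sum>b\<in>set_mset (proots q). count (proots q) b)"
    by (intro sum_mono2) auto
  also have "\<dots> = size (proots q)"
    by (simp add: size_multiset_overloaded_eq)
  also have "\<dots> \<le> Polynomial.degree q" by (rule size_proots_le)
  finally show ?thesis .
qed

lemma linear_power_dvd_if_shift_coeffs_zero:
  fixes q :: "'a::idom poly"
  assumes "\<And>k. k < N \<Longrightarrow> poly.coeff (pcompose q [:b, 1:]) k = 0"
  shows "[:-b, 1:] ^ N dvd q"
proof -
  have "Polynomial.monom 1 N dvd pcompose q [:b, 1:]"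
    using assms by (simp add: monom_1_dvd_iff')
  then obtain h where h: "pcompose q [:b, 1:] = Polynomial.monom 1 N * h" by (elim dvdE)
  have "q = pcompose (pcompose q [:b, 1:]) [:-b, 1:]"
    by (simp add: pcompose_assoc [symmetric] pcompose_pCons pcompose_idR)
  also have "\<dots> = [:-b, 1:] ^ N * pcompose h [:-b, 1:]"
    by (simp add: h pcompose_mult monom_altdef pcompose_hom.hom_power pcompose_pCons pcompose_smult)
  finally show ?thesis by (metis dvd_triv_left)
qed

text \<open>Reads the polynomial as one in x_k whose coefficients P_j are polynomials in the other
  variables; P_j is encoded by the exponents with entry j at k, that entry reset to 0. The right
  side is the \<kappa>-th Hasse derivative at b of the univariate polynomial with coefficients D^i
  P_j(a).\<close>

lemma hasse_split:
  fixes c :: "('v::finite \<Rightarrow> nat) \<Rightarrow> 'a::comm_ring_1"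
  assumes "finite X" and t: "\<And>e. e \<in> X \<Longrightarrow> e k \<le> t" and i: "i k = 0"
  shows "hasse X c (i(k := \<kappa>)) (a(k := b)) =
    (\<Sum>j\<le>t. of_nat (j choose \<kappa>) * b ^ (j - \<kappa>) *
       hasse ((\<lambda>e. e(k := 0)) ` {e\<in>X. e k = j}) (\<lambda>e. c (e(k := j))) i a)"
proof -
  have *: "(\<Sum>e\<in>{e\<in>X. e k = j}. c e * (\<Prod>v\<in>UNIV. of_nat (e v choose (i(k := \<kappa>)) v) * (a(k := b)) v ^ (e v - (i(k := \<kappa>)) v))) =
     of_nat (j choose \<kappa>) * b ^ (j - \<kappa>) *
       hasse ((\<lambda>e. e(k := 0)) ` {e\<in>X. e k = j}) (\<lambda>e. c (e(k := j))) i a" for j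
  proof -
    have inj: "inj_on (\<lambda>e. e(k := 0)) {e\<in>X. e k = j}"
    proof (rule inj_onI)
      fix x y assume xy: "x \<in> {e \<in> X. e k = j}" "y \<in> {e \<in> X. e k = j}" and eq: "x(k := 0) = y(k := 0)"
      have "x v = y v" for v using fun_cong[OF eq, of v] xy by (cases "v = k") auto
      then show "x = y" by blast
    qed
    have "c e * (\<Prod>v\<in>UNIV. of_nat (e v choose (i(k := \<kappa>)) v) * (a(k := b)) v ^ (e v - (i(k := \<kappa>)) v)) =
       of_nat (j choose \<kappa>) * b ^ (j - \<kappa>) * (c ((e(k := 0))(k := j)) *
         (\<Prod>v\<in>UNIV. of_nat ((e(k := 0)) v choose i v) * a v ^ ((e(k := 0)) v - i v)))" 
      if "e k = j" for e
    proof -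
      have c: "(e(k := 0))(k := j) = e" using that by auto
      have "(\<Prod>v\<in>UNIV. of_nat (e v choose (i(k := \<kappa>)) v) * (a(k := b)) v ^ (e v - (i(k := \<kappa>)) v)) =
        of_nat (j choose \<kappa>) * b ^ (j - \<kappa>) * (\<Prod>v\<in>UNIV-{k}. of_nat (e v choose i v) * a v ^ (e v - i v))"
        using that by (subst prod.remove[of _ k]) (auto intro!: prod.cong)
      moreover have "(\<Prod>v\<in>UNIV. of_nat ((e(k := 0)) v choose i v) * a v ^ ((e(k := 0)) v - i v)) =
        (\<Prod>v\<in>UNIV-{k}. of_nat (e v choose i v) * a v ^ (e v - i v))"
        using i by (subst prod.remove[of _ k]) (auto intro!: prod.cong)
      ultimately show ?thesis unfolding c by (simp add: algebra_simps)
    qed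
    then show ?thesis
      unfolding hasse_def by (subst sum.reindex[OF inj]) (simp add: sum_distrib_left o_def)
  qed
  have "hasse X c (i(k := \<kappa>)) (a(k := b)) = 
     (\<Sum>j\<le>t. \<Sum>e\<in>{e\<in>X. e k = j}. c e * (\<Prod>v\<in>UNIV. of_nat (e v choose (i(k := \<kappa>)) v) * (a(k := b)) v ^ (e v - (i(k := \<kappa>)) v)))"
    unfolding hasse_def by (rule sum.group[symmetric]) (use assms in auto)
  then show ?thesis by (simp only: *)
qed

text \<open>The i-th derivative kills every monomial that x^i does not divide, and a proper multiple
  of x^i would exceed the maximal degree. Only the constant \<open>c i\<close> survives, whatever
  the point a.\<close>

lemma hasse_top:
  fixes c :: "('v::finite \<Rightarrow> nat) \<Rightarrow> 'a::comm_ring_1"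
  assumes "finite X" "i \<in> X" and max: "\<And>e. e \<in> X \<Longrightarrow> c e \<noteq> 0 \<Longrightarrow> sum e UNIV \<le> sum i UNIV"
  shows "hasse X c i a = c i"
proof -
  have "hasse X c i a = (\<Sum>e\<in>{i}. c e * (\<Prod>v\<in>UNIV. of_nat (e v choose i v) * a v ^ (e v - i v)))"
    unfolding hasse_def
  proof (rule sum.mono_neutral_right)
    show "\<forall>e\<in>X - {i}. c e * (\<Prod>v\<in>UNIV. of_nat (e v choose i v) * a v ^ (e v - i v)) = 0"
    proof
      fix e assume e: "e \<in> X - {i}"
      show "c e * (\<Prod>v\<in>UNIV. of_nat (e v choose i v) * a v ^ (e v - i v)) = 0"
      proof (cases "\<exists>v. e v < i v")
        case True
        then obtain v where "e v < i v" ..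
        then have "(\<Prod>v\<in>UNIV. of_nat (e v choose i v) * a v ^ (e v - i v)) = 0"
          by (subst prod.remove[of _ v]) (auto simp: binomial_eq_0)
        then show ?thesis by simp
      next
        case False
        then have le: "\<And>v. i v \<le> e v" by (auto simp: not_less)
        obtain v where "e v \<noteq> i v" using e by auto
        then have "i v < e v" using le[of v] by simp
        with le have "sum i UNIV < sum e UNIV"
          by (intro sum_strict_mono_ex1) (simp, blast, blast)
        then show ?thesis using max e by force
      qed
    qed
  qed (use assms in auto)
  then show ?thesis by simp
qed

lemma exists_hasse_nonzero:
  fixes c :: "('v::finite \<Rightarrow> nat) \<Rightarrow> 'a::comm_ring_1"
  assumes "finite X" "\<exists>e\<in>X. c e \<noteq> 0"
  shows "\<exists>i\<in>X. hasse X c i a \<noteq> 0"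
proof -
  have fin: "finite {e\<in>X. c e \<noteq> 0}" "{e\<in>X. c e \<noteq> 0} \<noteq> {}" using assms by auto
  define m where "m = Max ((\<lambda>e. sum e UNIV) ` {e\<in>X. c e \<noteq> 0})"
  have "m \<in> (\<lambda>e. sum e UNIV) ` {e\<in>X. c e \<noteq> 0}"
    unfolding m_def using fin by (intro Max_in) auto
  then obtain i where i: "i \<in> X" "c i \<noteq> 0" "sum i UNIV = m" by auto
  moreover have "sum e UNIV \<le> m" if "e \<in> X" "c e \<noteq> 0" for e
    unfolding m_def using fin that by (intro Max_ge) auto
  ultimately have "hasse X c i a = c i" using assms by (intro hasse_top) auto
  then show ?thesis using i by (intro bexI[of _ i]) simp_all
qed

text \<open>The sums in \<open>van\<close> are the coefficients of the polynomial sum_j h_j x^j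
  recentred at b, so their vanishing below \<open>N b\<close> says that (x - b)^(N b) divides
  it.\<close>

lemma fiber_multiplicity_bound:
  fixes h :: "nat \<Rightarrow> 'a::idom"
  assumes "h t \<noteq> 0" "finite G"
    and van: "\<And>b \<kappa>. b \<in> G \<Longrightarrow> \<kappa> < N b \<Longrightarrow> (\<Sum>j\<le>t. of_nat (j choose \<kappa>) * b ^ (j - \<kappa>) * h j) = 0"
  shows "(\<Sum>b\<in>G. N b) \<le> t"
proof -
  define q where "q = (\<Sum>j\<le>t. Polynomial.monom (h j) j)"
  have cq: "poly.coeff q j = (if j \<le> t then h j else 0)" for j
    by (simp add: q_def coeff_sum)
  have "q \<noteq> 0" using cq[of t] assms by auto
  have "Polynomial.degree q \<le> t" by (rule degree_le) (simp add: cq)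
  have "poly.coeff (pcompose q [:b, 1:]) \<kappa> = (\<Sum>j\<le>t. of_nat (j choose \<kappa>) * b ^ (j - \<kappa>) * h j)" for b \<kappa>
  proof -
    have "pcompose q [:b, 1:] = (\<Sum>j\<le>t. Polynomial.smult (h j) ([:b, 1:] ^ j))"
      by (simp add: q_def pcompose_sum monom_altdef pcompose_smult pcompose_hom.hom_power pcompose_pCons)
    moreover have "poly.coeff ([:b, 1:] ^ j) \<kappa> = of_nat (j choose \<kappa>) * b ^ (j - \<kappa>)" for j
    proof (cases "\<kappa> \<le> j")
      case False
      have "Polynomial.degree ([:b, 1:] ^ j) \<le> j" by (metis degree_linear_power order_refl)
      then show ?thesis using False by (simp add: binomial_eq_0 coeff_eq_0)
    qed (simp add: coeff_linear_poly_power)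
    ultimately show ?thesis by (simp add: coeff_sum mult_ac)
  qed
  with van have "(\<Sum>b\<in>G. N b) \<le> Polynomial.degree q"
    using \<open>q \<noteq> 0\<close> \<open>finite G\<close> by (intro sum_mult_roots_le linear_power_dvd_if_shift_coeffs_zero) auto
  with \<open>Polynomial.degree q \<le> t\<close> show ?thesis by simp
qed

text \<open>Induction on the set I of active variables. Let t be the degree in the new variable x_k
  and P_t the leading coefficient. At a point a of the smaller grid take a derivative i in the other
  variables of least order M'(a) with D^i P_t(a) nonzero. On the line over a, D^i P is then a
  univariate polynomial of exact degree t that vanishes at b to order at least M(a,b) - M'(a). So M
  sums to at most |G| M'(a) + t on this line, and the induction hypothesis, applied to P_t of degree
  at most d - t, bounds the sum of the M'(a).\<close>

theorem schwartz_zippel_multiplicity: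
  fixes c :: "('v::finite \<Rightarrow> nat) \<Rightarrow> 'a::idom"
  assumes "finite G" "finite X"
    and "\<And>e. e \<in> X \<Longrightarrow> sum e UNIV \<le> d" "\<And>e v. e \<in> X \<Longrightarrow> v \<notin> I \<Longrightarrow> e v = 0"
    and "\<exists>e\<in>X. c e \<noteq> 0"
    and "\<And>a i. a \<in> PiE I (\<lambda>_. G) \<Longrightarrow> (\<And>v. v \<notin> I \<Longrightarrow> i v = 0) \<Longrightarrow> sum i UNIV < M a \<Longrightarrow> hasse X c i a = 0"
  shows "card G * (\<Sum>a\<in>PiE I (\<lambda>_. G). M a) \<le> d * card G ^ card I"
proof -
  have "finite I" by simp
  then show ?thesis using assms
  proof (induction I arbitrary: X c d M rule: finite_induct)
    case empty
    then have z: "e = (\<lambda>_. 0)" if "e \<in> X" for e using that by auto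
    with empty obtain e where e: "e \<in> X" "c e \<noteq> 0" by blast
    then have X: "X = {\<lambda>_. 0}" using z by auto
    \<comment> \<open>Without active variables the grid is the single function
      \<open>\<lambda>_. undefined\<close>, and the polynomial is a nonzero constant.\<close>
    have "M (\<lambda>_. undefined) = 0"
    proof (rule ccontr)
      assume "M (\<lambda>_. undefined) \<noteq> 0"
      then have "hasse X c (\<lambda>_. 0) (\<lambda>_. undefined) = 0" by (intro empty.prems(6)) auto
      then show False using e by (simp add: hasse_def X)
    qed
    then show ?case by simp
  next
    case (insert k I)
    \<comment> \<open>Zero coefficients are discarded so that t is the true degree in x_k and the
      leading coefficient \<open>C t\<close> is a nonzero polynomial.\<close>
    define X' where "X' = {e\<in>X. c e \<noteq> 0}"
    have X': "finite X'" "X' \<noteq> {}" using insert.prems by (auto simp: X'_def)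
    have hX': "hasse X c i a = hasse X' c i a" for i a
      unfolding hasse_def X'_def by (rule sum.mono_neutral_right) (use insert.prems in auto)
    define t where "t = Max ((\<lambda>e. e k) ` X')"
    have t: "e k \<le> t" if "e \<in> X'" for e
      using that X' by (auto simp: t_def)
    have "t \<in> (\<lambda>e. e k) ` X'" unfolding t_def using X' by (intro Max_in) auto
    then obtain e0 where e0: "e0 \<in> X'" "e0 k = t" by auto
    define Y where "Y j = (\<lambda>e. e(k := 0)) ` {e\<in>X'. e k = j}" for j
    define C where "C j = (\<lambda>e. c (e(k := j)))" for j
    have finY: "finite (Y j)" for j using X' by (auto simp: Y_def)
    have dY: "sum e UNIV + j \<le> d" if ej: "e \<in> Y j" for e j
    proof -
      obtain e' where e': "e' \<in> X'" "e' k = j" "e = e'(k := 0)" using ej unfolding Y_def by blast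
      have "sum e UNIV = sum e' (UNIV - {k})"
        unfolding e' by (subst sum.remove[of _ k]) (auto intro!: sum.cong)
      moreover have "sum e' UNIV = e' k + sum e' (UNIV - {k})" by (rule sum.remove) auto
      ultimately show ?thesis using insert.prems(3)[of e'] e' by (auto simp: X'_def)
    qed
    have neY: "\<exists>e\<in>Y t. C t e \<noteq> 0"
      using e0 by (intro bexI[of _ "e0(k := 0)"]) (auto simp: Y_def C_def X'_def fun_upd_idem)
    have zY: "e v = 0" if "e \<in> Y j" "v \<notin> I" for e v j
      using that insert.prems(4) by (auto simp: Y_def X'_def)
    define P where "P a m \<longleftrightarrow> (\<exists>i. (\<forall>v. v \<notin> I \<longrightarrow> i v = 0) \<and> sum i UNIV = m \<and> hasse (Y t) (C t) i a \<noteq> 0)" for a m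
    have Pex: "\<exists>m. P a m" for a
      using exists_hasse_nonzero[OF finY neY, of a] zY unfolding P_def by blast
    define M' where "M' a = (LEAST m. P a m)" for a
    have PM': "P a (M' a)" for a unfolding M'_def using Pex LeastI_ex by metis
    have nM': "\<not> P a m" if "m < M' a" for a m
      using that unfolding M'_def by (rule not_less_Least)
    have IH: "card G * (\<Sum>a\<in>PiE I (\<lambda>_. G). M' a) \<le> (d - t) * card G ^ card I"
    proof (rule insert.IH[of "Y t" "d - t" "C t"])
      fix a i assume "\<And>v. v \<notin> I \<Longrightarrow> i v = 0" "sum i UNIV < M' a"
      then show "hasse (Y t) (C t) i a = 0" using nM'[of "sum i UNIV" a] by (auto simp: P_def)
    next
      fix e assume "e \<in> Y t"
      then show "sum e UNIV \<le> d - t" using dY[of e t] by simp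
    qed (use insert.prems finY neY zY in auto)
    have td: "t \<le> d" using dY[of "e0(k := 0)" t] e0 by (auto simp: Y_def)
    have fib: "(\<Sum>b\<in>G. M (a(k := b))) \<le> M' a * card G + t" if a: "a \<in> PiE I (\<lambda>_. G)" for a
    proof -
      obtain i where i: "\<And>v. v \<notin> I \<Longrightarrow> i v = 0" "sum i UNIV = M' a" "hasse (Y t) (C t) i a \<noteq> 0"
        using PM'[of a] by (auto simp: P_def)
      have ik: "i k = 0" using i insert.hyps by auto
      have "(\<Sum>b\<in>G. M (a(k := b)) - M' a) \<le> t"
      proof (rule fiber_multiplicity_bound[of "\<lambda>j. hasse (Y j) (C j) i a"])
        fix b \<kappa> assume b: "b \<in> G" and \<kappa>: "\<kappa> < M (a(k := b)) - M' a"
        have "sum (i(k := \<kappa>)) UNIV = \<kappa> + sum i (UNIV - {k})"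
          by (subst sum.remove[of _ k]) (auto intro!: sum.cong)
        moreover have "sum i UNIV = i k + sum i (UNIV - {k})" by (rule sum.remove) auto
        ultimately have "sum (i(k := \<kappa>)) UNIV = \<kappa> + M' a" using ik i by simp
        then have lt: "sum (i(k := \<kappa>)) UNIV < M (a(k := b))" using \<kappa> by simp
        have "hasse X c (i(k := \<kappa>)) (a(k := b)) = 0"
          by (rule insert.prems(6)[OF _ _ lt]) (use b a i(1) in \<open>auto simp: PiE_iff extensional_def\<close>)
        then show "(\<Sum>j\<le>t. of_nat (j choose \<kappa>) * b ^ (j - \<kappa>) * hasse (Y j) (C j) i a) = 0"
          unfolding hX' by (subst (asm) hasse_split[where t = t]) (use X' t ik in \<open>auto simp: Y_def C_def\<close>)
      qed (use i insert.prems in auto)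
      moreover have "(\<Sum>b\<in>G. M (a(k := b))) \<le> (\<Sum>b\<in>G. (M (a(k := b)) - M' a) + M' a)"
        by (intro sum_mono) simp
      ultimately show ?thesis by (simp add: sum.distrib mult.commute)
    qed
    have "(\<Sum>a\<in>PiE (insert k I) (\<lambda>_. G). M a) = (\<Sum>(b, a)\<in>G \<times> PiE I (\<lambda>_. G). M (a(k := b)))"
      unfolding PiE_insert_eq using insert.hyps
      by (subst sum.reindex[OF inj_combinator]) (auto simp: case_prod_unfold o_def)
    also have "\<dots> = (\<Sum>b\<in>G. \<Sum>a\<in>PiE I (\<lambda>_. G). M (a(k := b)))"
      by (rule sum.cartesian_product[symmetric])
    also have "\<dots> = (\<Sum>a\<in>PiE I (\<lambda>_. G). \<Sum>b\<in>G. M (a(k := b)))" by (rule sum.swap)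
    also have "\<dots> \<le> (\<Sum>a\<in>PiE I (\<lambda>_. G). M' a * card G + t)" by (intro sum_mono fib)
    also have "\<dots> = card G * (\<Sum>a\<in>PiE I (\<lambda>_. G). M' a) + t * card G ^ card I"
      by (simp add: sum.distrib sum_distrib_left mult.commute card_PiE)
    also have "\<dots> \<le> (d - t) * card G ^ card I + t * card G ^ card I" using IH by simp
    also have "\<dots> = d * card G ^ card I" using td by (simp add: add_mult_distrib[symmetric])
    finally have "(\<Sum>a\<in>PiE (insert k I) (\<lambda>_. G). M a) \<le> d * card G ^ card I" .
    then show ?case using insert.hyps by simp
  qed
qed

section \<open>Taylor expansion and functions of bounded degree\<close>

lemma in_exps: "e \<in> exps d \<longleftrightarrow> sum e UNIV \<le> d"
  by (simp add: exps_def)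

definition meval :: "('v::finite \<Rightarrow> nat) set \<Rightarrow> (('v \<Rightarrow> nat) \<Rightarrow> 'a::comm_ring_1) \<Rightarrow> ('v \<Rightarrow> 'a) \<Rightarrow> 'a" where
  "meval X c x = (\<Sum>e\<in>X. c e * (\<Prod>v\<in>UNIV. x v ^ e v))"

lemma binomial_expand_upto:
  fixes a z :: "'a::comm_ring_1"
  assumes "e \<le> d"
  shows "(a + z) ^ e = (\<Sum>\<kappa>\<le>d. of_nat (e choose \<kappa>) * a ^ (e - \<kappa>) * z ^ \<kappa>)"
proof -
  have "(a + z) ^ e = (\<Sum>\<kappa>\<le>e. of_nat (e choose \<kappa>) * a ^ (e - \<kappa>) * z ^ \<kappa>)"
    using binomial_ring[of z a e] by (simp add: mult_ac add.commute)
  also have "\<dots> = (\<Sum>\<kappa>\<le>d. of_nat (e choose \<kappa>) * a ^ (e - \<kappa>) * z ^ \<kappa>)"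
    using assms by (intro sum.mono_neutral_left) (auto simp: binomial_eq_0)
  finally show ?thesis .
qed

lemma meval_taylor:
  fixes c :: "('v::finite \<Rightarrow> nat) \<Rightarrow> 'a::comm_ring_1"
  assumes "finite X" and d: "\<And>e v. e \<in> X \<Longrightarrow> e v \<le> d"
  shows "meval X c (\<lambda>v. a v + z v) = (\<Sum>i\<in>{i. \<forall>v. i v \<le> d}. hasse X c i a * (\<Prod>v\<in>UNIV. z v ^ i v))"
proof -
  have box: "PiE UNIV (\<lambda>_. {..d}) = {i::'v \<Rightarrow> nat. \<forall>v. i v \<le> d}"
    by (auto simp: PiE_def extensional_def)
  have "c e * (\<Prod>v\<in>UNIV. (a v + z v) ^ e v) = 
      (\<Sum>i\<in>{i. \<forall>v. i v \<le> d}. c e * (\<Prod>v\<in>UNIV. of_nat (e v choose i v) * a v ^ (e v - i v)) * (\<Prod>v\<in>UNIV. z v ^ i v))"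
    if "e \<in> X" for e
  proof -
    have "(\<Prod>v\<in>UNIV. (a v + z v) ^ e v) = (\<Prod>v\<in>UNIV. \<Sum>\<kappa>\<le>d. of_nat (e v choose \<kappa>) * a v ^ (e v - \<kappa>) * z v ^ \<kappa>)"
      using d[OF that] by (intro prod.cong binomial_expand_upto) auto
    also have "\<dots> = (\<Sum>i\<in>{i. \<forall>v. i v \<le> d}. \<Prod>v\<in>UNIV. of_nat (e v choose i v) * a v ^ (e v - i v) * z v ^ i v)"
      by (subst prod_sum_PiE) (auto simp: box)
    finally show ?thesis by (simp add: prod.distrib sum_distrib_left mult.assoc)
  qed
  then have "meval X c (\<lambda>v. a v + z v) = (\<Sum>e\<in>X. \<Sum>i\<in>{i. \<forall>v. i v \<le> d}. 
      c e * (\<Prod>v\<in>UNIV. of_nat (e v choose i v) * a v ^ (e v - i v)) * (\<Prod>v\<in>UNIV. z v ^ i v))"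
    unfolding meval_def by (intro sum.cong) auto
  also have "\<dots> = (\<Sum>i\<in>{i. \<forall>v. i v \<le> d}. \<Sum>e\<in>X. 
      c e * (\<Prod>v\<in>UNIV. of_nat (e v choose i v) * a v ^ (e v - i v)) * (\<Prod>v\<in>UNIV. z v ^ i v))"
    by (rule sum.swap)
  finally show ?thesis by (simp add: hasse_def sum_distrib_right)
qed

lemma meval_taylor_line:
  fixes c :: "('v::finite \<Rightarrow> nat) \<Rightarrow> 'a::comm_ring_1"
  assumes "finite X" and d: "\<And>e v. e \<in> X \<Longrightarrow> e v \<le> d"
  shows "meval X c (\<lambda>v. a v + s * w v) =
    (\<Sum>i\<in>{i. \<forall>v. i v \<le> d}. hasse X c i a * (\<Prod>v\<in>UNIV. w v ^ i v) * s ^ sum i UNIV)"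
  by (subst meval_taylor[OF assms(1), where d = d], erule d)
     (auto simp: power_mult_distrib prod.distrib power_sum mult_ac intro!: sum.cong)

lemma exps_le: "e \<in> exps d \<Longrightarrow> e v \<le> d"
  using le_sum_UNIV[of e v] by (simp add: in_exps)

lemma meval_exps_taylor_line:
  "meval (exps d) c (\<lambda>v. a v + s * w v) =
    (\<Sum>i\<in>{i. \<forall>v. i v \<le> d}. hasse (exps d) c i a * (\<Prod>v\<in>UNIV. w v ^ i v) * s ^ sum i UNIV)"
  by (rule meval_taylor_line) (auto intro: exps_le)

text \<open>Polynomials in s with equal values on an infinite domain have equal coefficients;
  several indices may contribute to the same power, hence the sums over the level sets of f and g.
  The need for infinitely many values of s is met by F_q[t].\<close>

lemma poly_expansion_unique:
  fixes \<alpha> :: "'i \<Rightarrow> 'a::idom" and \<beta> :: "'j \<Rightarrow> 'a"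
  assumes inf: "infinite (UNIV :: 'a set)" and "finite A" "finite B"
    and eq: "\<And>s. (\<Sum>i\<in>A. \<alpha> i * s ^ f i) = (\<Sum>j\<in>B. \<beta> j * s ^ g j)"
  shows "(\<Sum>i\<in>{i\<in>A. f i = k}. \<alpha> i) = (\<Sum>j\<in>{j\<in>B. g j = k}. \<beta> j)"
proof -
  define p where "p = (\<Sum>i\<in>A. Polynomial.monom (\<alpha> i) (f i))"
  define q where "q = (\<Sum>j\<in>B. Polynomial.monom (\<beta> j) (g j))"
  have "poly (p - q) s = 0" for s
    using eq[of s] by (simp add: p_def q_def poly_sum poly_monom)
  then have "{s. poly (p - q) s = 0} = UNIV" by auto
  then have "p - q = 0" using inf poly_roots_finite[of "p - q"] by metis
  then have "poly.coeff p k = poly.coeff q k" by simp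
  moreover have "poly.coeff p k = (\<Sum>i\<in>{i\<in>A. f i = k}. \<alpha> i)"
    unfolding p_def coeff_sum coeff_monom
    using assms by (subst sum.inter_filter) auto
  moreover have "poly.coeff q k = (\<Sum>j\<in>{j\<in>B. g j = k}. \<beta> j)"
    unfolding q_def coeff_sum coeff_monom
    using assms by (subst sum.inter_filter) auto
  ultimately show ?thesis by simp
qed

text \<open>Otherwise Schwartz--Zippel with all multiplicities 1 on a grid of side d + 1 would give
  (d + 1)^(k+1) \<le> d (d + 1)^k, where k is the number of variables.\<close>

lemma meval_zero_imp_coeffs_zero:
  fixes c :: "('v::finite \<Rightarrow> nat) \<Rightarrow> 'a::idom"
  assumes inf: "infinite (UNIV :: 'a set)" and "finite X" and z: "\<And>x. meval X c x = 0" and "e \<in> X"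
  shows "c e = 0"
proof (rule ccontr)
  assume ne: "c e \<noteq> 0"
  define d where "d = Max ((\<lambda>e. sum e UNIV) ` X)"
  obtain G :: "'a set" where G: "finite G" "card G = Suc d"
    using inf infinite_arbitrarily_large by blast
  have "card G * (\<Sum>a\<in>PiE (UNIV::'v set) (\<lambda>_. G). 1) \<le> d * card G ^ card (UNIV :: 'v set)"
  proof (rule schwartz_zippel_multiplicity[where X = X and c = c])
    fix e assume "e \<in> X" then show "sum e UNIV \<le> d" using \<open>finite X\<close> by (auto simp: d_def)
  next
    fix a :: "'v \<Rightarrow> 'a" and i :: "'v \<Rightarrow> nat" assume "sum i UNIV < 1"
    then have i: "i v = 0" for v using le_sum_UNIV[of i v] by simp
    show "hasse X c i a = 0" using z[of a] by (simp add: hasse_def meval_def i)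
  qed (use G assms ne in auto)
  then have "Suc d * Suc d ^ card (UNIV :: 'v set) \<le> d * Suc d ^ card (UNIV :: 'v set)"
    by (simp add: card_PiE G)
  then show False by simp
qed

text \<open>Substitution of affine forms is handled on the level of functions: the new coefficients
  are only asserted to exist within the degree bound, and comparing values over an infinite domain
  recovers what is needed about them.\<close>

definition polyfun :: "nat \<Rightarrow> (('v::finite \<Rightarrow> 'a::comm_ring_1) \<Rightarrow> 'a) \<Rightarrow> bool" where
  "polyfun d f \<longleftrightarrow> (\<exists>c. f = meval (exps d) c)"

lemma polyfun_const: "polyfun 0 (\<lambda>_ :: 'v::finite \<Rightarrow> 'a::comm_ring_1. k)"
proof -
  have "exps 0 = {\<lambda>_::'v. 0::nat}" by (auto simp: in_exps)
  then show ?thesis unfolding polyfun_def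
    by (intro exI[of _ "\<lambda>_. k"]) (simp add: meval_def fun_eq_iff)
qed

lemma polyfun_mono: assumes "polyfun d f" "d \<le> d'" shows "polyfun d' f"
proof -
  obtain c where c: "f = meval (exps d) c" using assms by (auto simp: polyfun_def)
  have "f = meval (exps d') (\<lambda>e. if e \<in> exps d then c e else 0)"
    unfolding meval_def c
    using assms(2) by (intro ext sum.mono_neutral_cong_left) (auto simp: in_exps)
  then show ?thesis unfolding polyfun_def by blast
qed

lemma polyfun_add: assumes "polyfun d f" "polyfun d g" shows "polyfun d (\<lambda>x. f x + g x)"
proof -
  obtain c c' where "f = meval (exps d) c" "g = meval (exps d) c'" using assms by (auto simp: polyfun_def)
  then have "(\<lambda>x. f x + g x) = meval (exps d) (\<lambda>e. c e + c' e)"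
    by (auto simp: meval_def fun_eq_iff distrib_right sum.distrib)
  then show ?thesis unfolding polyfun_def by blast
qed

lemma polyfun_sum: "finite A \<Longrightarrow> (\<And>i. i \<in> A \<Longrightarrow> polyfun d (f i)) \<Longrightarrow> polyfun d (\<lambda>x. \<Sum>i\<in>A. f i x)"
proof (induction A rule: finite_induct)
  case empty
  show ?case using polyfun_mono[OF polyfun_const[of 0], of d] by simp
next
  case (insert i A)
  then have "polyfun d (\<lambda>x. f i x + (\<Sum>j\<in>A. f j x))" by (intro polyfun_add) auto
  then show ?case using insert by simp
qed

lemma polyfun_mult: assumes "polyfun d f" "polyfun d' g" shows "polyfun (d + d') (\<lambda>x. f x * g x)"
proof -
  obtain c c' where cc: "f = meval (exps d) c" "g = meval (exps d') c'" using assms by (auto simp: polyfun_def)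
  let ?P = "\<lambda>x e. \<Prod>v\<in>UNIV. x v ^ e v"
  define C where "C e = (\<Sum>p\<in>{p\<in>exps d \<times> exps d'. (\<lambda>v. fst p v + snd p v) = e}. c (fst p) * c' (snd p))" for e
  have "f x * g x = meval (exps (d + d')) C x" for x
  proof -
    have "f x * g x = (\<Sum>p\<in>exps d \<times> exps d'. c (fst p) * c' (snd p) * ?P x (\<lambda>v. fst p v + snd p v))"
      unfolding cc meval_def sum_product sum.cartesian_product
      by (auto simp: power_add prod.distrib mult_ac intro!: sum.cong)
    also have "\<dots> = (\<Sum>e\<in>exps (d + d'). \<Sum>p\<in>{p\<in>exps d \<times> exps d'. (\<lambda>v. fst p v + snd p v) = e}.
        c (fst p) * c' (snd p) * ?P x (\<lambda>v. fst p v + snd p v))"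
      by (rule sum.group[symmetric]) (auto simp: in_exps sum.distrib)
    also have "\<dots> = meval (exps (d + d')) C x"
      unfolding meval_def C_def sum_distrib_right by (intro sum.cong) auto
    finally show ?thesis .
  qed
  then show ?thesis unfolding polyfun_def by blast
qed

lemma polyfun_power: "polyfun d f \<Longrightarrow> polyfun (d * k) (\<lambda>x. f x ^ k)"
  by (induction k) (auto simp: polyfun_const intro: polyfun_mult)

lemma polyfun_prod:
  "finite A \<Longrightarrow> (\<And>i. i \<in> A \<Longrightarrow> polyfun (d i) (f i)) \<Longrightarrow> polyfun (\<Sum>i\<in>A. d i) (\<lambda>x. \<Prod>i\<in>A. f i x)"
  by (induction A rule: finite_induct) (auto simp: polyfun_const intro: polyfun_mult)

lemma polyfun_coord: "polyfun 1 (\<lambda>x :: 'a::finite \<Rightarrow> 'b::comm_ring_1. x v)"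
proof -
  let ?e = "(\<lambda>_. 0)(v := 1) :: 'a \<Rightarrow> nat"
  have "meval (exps 1) (\<lambda>e. if e = ?e then 1 else 0) x = x v" for x :: "'a \<Rightarrow> 'b"
  proof -
    have "sum ?e UNIV = 1" by (subst sum.remove[of _ v]) auto
    then have "?e \<in> exps 1" by (simp add: exps_def)
    then have "meval (exps 1) (\<lambda>e. if e = ?e then 1 else 0) x = (\<Prod>w\<in>UNIV. x w ^ ?e w)"
      unfolding meval_def by (subst sum.remove[of _ ?e]) (auto intro!: sum.neutral)
    also have "\<dots> = x v" by (subst prod.remove[of _ v]) auto
    finally show ?thesis .
  qed
  then have "(\<lambda>x. x v) = meval (exps 1) (\<lambda>e. if e = ?e then 1 else 0 :: 'b)" by auto
  then show ?thesis unfolding polyfun_def by blast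
qed

lemma polyfun_meval_affine:
  fixes L :: "'v::finite \<Rightarrow> ('w::finite \<Rightarrow> 'a::comm_ring_1) \<Rightarrow> 'a"
  assumes L: "\<And>v. polyfun 1 (L v)"
  shows "polyfun d (\<lambda>x. meval (exps d) c (\<lambda>v. L v x))"
  unfolding meval_def
proof (rule polyfun_sum)
  fix e :: "'v \<Rightarrow> nat" assume e: "e \<in> exps d"
  have "polyfun (\<Sum>v\<in>UNIV. 1 * e v) (\<lambda>x. \<Prod>v\<in>UNIV. L v x ^ e v)"
    by (intro polyfun_prod polyfun_power L) auto
  then have "polyfun (0 + (\<Sum>v\<in>UNIV. 1 * e v)) (\<lambda>x. c e * (\<Prod>v\<in>UNIV. L v x ^ e v))"
    by (intro polyfun_mult polyfun_const)
  then show "polyfun d (\<lambda>x. c e * (\<Prod>v\<in>UNIV. L v x ^ e v))"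
    by (rule polyfun_mono) (use e in \<open>auto simp: in_exps\<close>)
qed simp


text \<open>The coefficient of s^k in P(b + s \<zeta>) is a form in \<zeta> whose coefficients are
  the Hasse derivatives at b of weight k; if it vanishes for every \<zeta>, so do they. This carries
  vanishing orders through substitutions without a chain rule for Hasse derivatives.\<close>

lemma hasse_eq_0_if_lines:
  fixes c :: "('v::finite \<Rightarrow> nat) \<Rightarrow> 'a::idom"
  assumes inf: "infinite (UNIV :: 'a set)" and X: "finite X"
    and line: "\<And>\<zeta>. \<exists>B \<beta> (g :: 'j \<Rightarrow> nat). finite B \<and>
        (\<forall>s. meval X c (\<lambda>v. b v + s * \<zeta> v) = (\<Sum>j\<in>B. \<beta> j * s ^ g j)) \<and>
        (\<forall>j\<in>B. g j < m \<longrightarrow> \<beta> j = 0)"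
    and i: "sum i UNIV < m"
  shows "hasse X c i b = 0"
proof -
  define d where "d = Max ((\<lambda>e. sum e UNIV) ` X)"
  have d: "e v \<le> d" if "e \<in> X" for e v
  proof -
    have "sum e UNIV \<le> d" unfolding d_def using X that by (intro Max_ge) auto
    then show ?thesis using le_sum_UNIV[of e v] by simp
  qed
  show ?thesis
  proof (cases "\<forall>v. i v \<le> d")
    case True
    define k where "k = sum i UNIV"
    have "meval {j\<in>{j. \<forall>v. j v \<le> d}. sum j UNIV = k} (\<lambda>j. hasse X c j b) \<zeta> = 0" for \<zeta>
    proof -
      obtain B \<beta> and g :: "'j \<Rightarrow> nat" where B: "finite B"
        "\<And>s. meval X c (\<lambda>v. b v + s * \<zeta> v) = (\<Sum>j\<in>B. \<beta> j * s ^ g j)" "\<And>j. j \<in> B \<Longrightarrow> g j < m \<Longrightarrow> \<beta> j = 0"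
        using line[of \<zeta>] by blast
      have "(\<Sum>j\<in>{j\<in>{j. \<forall>v. j v \<le> d}. sum j UNIV = k}. hasse X c j b * (\<Prod>v\<in>UNIV. \<zeta> v ^ j v)) =
          (\<Sum>j\<in>{j\<in>B. g j = k}. \<beta> j)"
      proof (rule poly_expansion_unique[OF inf finite_box B(1)])
        fix s
        show "(\<Sum>i\<in>{i. \<forall>v. i v \<le> d}. hasse X c i b * (\<Prod>v\<in>UNIV. \<zeta> v ^ i v) * s ^ sum i UNIV) = (\<Sum>j\<in>B. \<beta> j * s ^ g j)"
          unfolding B(2)[symmetric] by (rule meval_taylor_line[OF X, symmetric]) (rule d)
      qed
      also have "\<dots> = 0" using B(3) i by (intro sum.neutral) (auto simp: k_def)
      finally show ?thesis by (simp add: meval_def)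
    qed
    note zero = this
    show ?thesis
      by (rule meval_zero_imp_coeffs_zero[OF inf _ zero, where e = i])
         (use True finite_box[of d] in \<open>auto simp: k_def\<close>)
  next
    case False
    then obtain v where v: "d < i v" by (auto simp: not_le)
    have "(\<Prod>v\<in>UNIV. of_nat (e v choose i v) * b v ^ (e v - i v)) = 0" if "e \<in> X" for e
      using d[OF that, of v] v by (subst prod.remove[of _ v]) (auto simp: binomial_eq_0)
    then show ?thesis unfolding hasse_def by (intro sum.neutral) auto
  qed
qed

section \<open>Leading forms and vanishing at infinity\<close>

lemma finite_homog: "finite {e :: 'v::finite \<Rightarrow> nat. sum e UNIV = d}"
  by (rule finite_subset[OF _ finite_exps[of d]]) (auto simp: in_exps)

lemma meval_top_unique:
  fixes c :: "('v::finite \<Rightarrow> nat) \<Rightarrow> 'a::idom" and c' :: "('w::finite \<Rightarrow> nat) \<Rightarrow> 'a"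
  assumes inf: "infinite (UNIV :: 'a set)"
    and eq: "\<And>s. meval (exps d) c (\<lambda>v. a v + s * y v) = meval (exps d) c' (\<lambda>w. b w + s * x w)"
  shows "meval {e. sum e UNIV = d} c y = meval {e. sum e UNIV = d} c' x"
proof -
  have top: "(\<Sum>i\<in>{i\<in>{i. \<forall>v. i v \<le> d}. sum i UNIV = d}. hasse (exps d) C i p * (\<Prod>v\<in>UNIV. z v ^ i v)) =
      meval {e. sum e UNIV = d} C z" for C :: "('u::finite \<Rightarrow> nat) \<Rightarrow> 'a" and p z
    unfolding meval_def
  proof (intro sum.cong)
    show "{i\<in>{i. \<forall>v. i v \<le> d}. sum i UNIV = d} = {e :: 'u \<Rightarrow> nat. sum e UNIV = d}"
      using le_sum_UNIV by fastforce
  next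
    fix i :: "'u \<Rightarrow> nat" assume "i \<in> {e. sum e UNIV = d}"
    then have "hasse (exps d) C i p = C i" by (intro hasse_top) (auto simp: in_exps)
    then show "hasse (exps d) C i p * (\<Prod>v\<in>UNIV. z v ^ i v) = C i * (\<Prod>v\<in>UNIV. z v ^ i v)" by simp
  qed
  have "(\<Sum>i\<in>{i\<in>{i. \<forall>v. i v \<le> d}. sum i UNIV = d}. hasse (exps d) c i a * (\<Prod>v\<in>UNIV. y v ^ i v)) =
    (\<Sum>i\<in>{i\<in>{i. \<forall>v. i v \<le> d}. sum i UNIV = d}. hasse (exps d) c' i b * (\<Prod>v\<in>UNIV. x v ^ i v))"
  proof (rule poly_expansion_unique[OF inf finite_box finite_box])
    fix s
    show "(\<Sum>i\<in>{i. \<forall>v. i v \<le> d}. hasse (exps d) c i a * (\<Prod>v\<in>UNIV. y v ^ i v) * s ^ sum i UNIV) =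
       (\<Sum>i\<in>{i. \<forall>v. i v \<le> d}. hasse (exps d) c' i b * (\<Prod>v\<in>UNIV. x v ^ i v) * s ^ sum i UNIV)"
      using eq[of s] by (simp only: meval_exps_taylor_line)
  qed
  then show ?thesis by (simp only: top)
qed

text \<open>
  For any \<open>z\<close>, expand \<open>P(a + x u + y v + s z)\<close> in powers of \<open>s\<close>. The coefficients of \<open>s\<^sup>w\<close> with
  \<open>w < l\<close> are polynomials in \<open>x, y\<close> with too many zeros on \<open>T\<close>, so \<open>s\<^sup>l\<close> divides the expansion; the
  leading form of \<open>P\<close> at \<open>x u + y v + s z\<close> inherits this, and \<open>x = 1, y = t\<close> gives the claim.
\<close>

lemma hasse_at_infinity_eq_0:
  fixes c :: "('v::finite \<Rightarrow> nat) \<Rightarrow> 'a::idom" and a u v :: "'v \<Rightarrow> 'a"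
  assumes inf: "infinite (UNIV :: 'a set)" and Z: "finite Z" and T: "T \<subseteq> Z \<times> Z" "T \<noteq> {}"
    and van: "\<And>x y i. (x, y) \<in> T \<Longrightarrow> sum i UNIV < m \<Longrightarrow>
        hasse (exps d) c i (\<lambda>w. a w + x * u w + y * v w) = 0"
    and l: "l \<le> m" "d * card Z \<le> card T * (m - l)"
    and i: "sum i UNIV < l"
  shows "hasse {e. sum e UNIV = d} c i (\<lambda>w. u w + t * v w) = 0"
proof (rule hasse_eq_0_if_lines[OF inf finite_homog _ i, where ?'j = "3 \<Rightarrow> nat"])
  fix z :: "'v \<Rightarrow> 'a"
  define L where "L x = (\<lambda>w. x 1 * u w + x 2 * v w + x 3 * z w)" for x :: "3 \<Rightarrow> 'a"
  have L_lin: "L (\<lambda>k. x k + s * y k) w = L x w + s * L y w" for x y s w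
    by (simp add: L_def algebra_simps)
  have "polyfun d (\<lambda>x. meval (exps d) c (\<lambda>w. a w + L x w))"
  proof (rule polyfun_meval_affine)
    fix w
    have "polyfun (0 + 1) (\<lambda>x :: 3 \<Rightarrow> 'a. k * x j)" for k j
      by (intro polyfun_mult polyfun_const polyfun_coord)
    then have lin: "polyfun 1 (\<lambda>x :: 3 \<Rightarrow> 'a. x j * k)" for k j by (simp add: mult.commute)
    show "polyfun 1 (\<lambda>x. a w + L x w)"
      unfolding L_def by (intro polyfun_add lin polyfun_mono[OF polyfun_const]) simp
  qed
  then obtain c3 where c3: "\<And>x. meval (exps d) c (\<lambda>w. a w + L x w) = meval (exps d) c3 x"
    by (auto simp: polyfun_def fun_eq_iff)
  \<comment> \<open>L sends (x, y, 0) to x u + y v. Along a direction \<zeta> the pullback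
    \<open>c3\<close> at b therefore expands like P along L \<zeta> at a point of the plane where P
    vanishes to order m.\<close>
  have van3: "hasse (exps d) c3 j b = 0" if bT: "(b 1, b 2) \<in> T" "b 3 = 0" and j: "sum j UNIV < m" for b j
  proof (rule hasse_eq_0_if_lines[OF inf finite_exps _ j, where ?'j = "'v \<Rightarrow> nat"])
    fix \<zeta> :: "3 \<Rightarrow> 'a"
    have "meval (exps d) c3 (\<lambda>k. b k + s * \<zeta> k) =
      (\<Sum>i\<in>{i. \<forall>v. i v \<le> d}. (hasse (exps d) c i (\<lambda>w. a w + L b w) * (\<Prod>w\<in>UNIV. L \<zeta> w ^ i w)) * s ^ sum i UNIV)" for s
      unfolding c3[symmetric] L_lin add.assoc[symmetric]
      by (rule meval_exps_taylor_line)
    moreover have "hasse (exps d) c i (\<lambda>w. a w + L b w) = 0" if "sum i UNIV < m" for i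
      using van[OF bT(1) that] bT(2) by (simp add: L_def add.assoc)
    ultimately show "\<exists>B \<beta> (g :: ('v \<Rightarrow> nat) \<Rightarrow> nat). finite B \<and>
        (\<forall>s. meval (exps d) c3 (\<lambda>v. b v + s * \<zeta> v) = (\<Sum>j\<in>B. \<beta> j * s ^ g j)) \<and>
        (\<forall>j\<in>B. g j < m \<longrightarrow> \<beta> j = 0)"
      using finite_box[of d]
      by (intro exI[of _ "{i. \<forall>v. i v \<le> d}"] exI[of _ "\<lambda>i. sum i UNIV"]
          exI[of _ "\<lambda>i. hasse (exps d) c i (\<lambda>w. a w + L b w) * (\<Prod>w\<in>UNIV. L \<zeta> w ^ i w)"] conjI ballI allI impI) auto
  qed
  have c3_zero: "c3 e = 0" if e: "e \<in> exps d" "e 3 < l" for e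
  proof (rule ccontr)
    assume ne: "c3 e \<noteq> 0"
    define w where "w = e 3"
    have wd: "w \<le> d" using e le_sum_UNIV[of e 3] by (simp add: w_def in_exps)
    define X :: "(3 \<Rightarrow> nat) set" where "X = (\<lambda>e. e(3 := 0)) ` {e\<in>exps d. e 3 = w}"
    define C where "C = (\<lambda>e. c3 (e(3 := w)))"
    \<comment> \<open>The coefficient of s^w has degree at most d - w and vanishes to order m - w on
      T. Schwartz--Zippel on Z \<times> Z then gives |T| (m - w) \<le> (d - w) |Z|, which
      contradicts d |Z| \<le> |T| (m - l) because w < l.\<close>
    define M where "M a = (if (a 1, a 2) \<in> T then m - w else 0)" for a :: "3 \<Rightarrow> 'a"
    have "card Z * (\<Sum>a\<in>PiE {1, 2::3} (\<lambda>_. Z). M a) \<le> (d - w) * card Z ^ card {1, 2::3}"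
    proof (rule schwartz_zippel_multiplicity[where X = X and c = C])
      fix f assume "f \<in> X"
      then obtain e where e: "sum e UNIV \<le> d" "e 3 = w" "f = e(3 := 0)" by (auto simp: X_def in_exps)
      have "sum e UNIV = e 3 + sum e (UNIV - {3})" by (rule sum.remove) auto
      moreover have "sum f UNIV = sum e (UNIV - {3})"
        unfolding e by (subst sum.remove[of _ 3]) (auto intro!: sum.cong)
      ultimately show "sum f UNIV \<le> d - w" using e by simp
    next
      fix f and k :: 3 assume "f \<in> X" "k \<notin> {1, 2}"
      then show "f k = 0" using exhaust_3[of k] by (auto simp: X_def)
    next
      show "\<exists>f\<in>X. C f \<noteq> 0"
        using e ne by (intro bexI[of _ "e(3 := 0)"]) (auto simp: X_def C_def w_def fun_upd_idem)
    next
      fix b :: "3 \<Rightarrow> 'a" and j :: "3 \<Rightarrow> nat" assume b: "b \<in> PiE {1, 2::3} (\<lambda>_. Z)" and j: "\<And>k. k \<notin> {1, 2} \<Longrightarrow> j k = 0" "sum j UNIV < M b"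
      have j3: "j 3 = 0" by (rule j) simp
      have bT: "(b 1, b 2) \<in> T" "sum j UNIV < m - w" using j(2) by (auto simp: M_def split: if_splits)
      have "sum (j(3 := w)) UNIV = w + sum j (UNIV - {3})"
        by (subst sum.remove[of _ 3]) (auto intro!: sum.cong)
      moreover have "sum j UNIV = j 3 + sum j (UNIV - {3})" by (rule sum.remove) auto
      ultimately have "sum (j(3 := w)) UNIV < m" using bT j3 by simp
      then have "hasse (exps d) c3 (j(3 := w)) (b(3 := 0)) = 0"
        by (intro van3) (use bT in auto)
      moreover have "hasse (exps d) c3 (j(3 := w)) (b(3 := 0)) =
          (\<Sum>k\<le>d. of_nat (k choose w) * 0 ^ (k - w) *
            hasse ((\<lambda>e. e(3 := 0)) ` {e\<in>exps d. e 3 = k}) (\<lambda>e. c3 (e(3 := k))) j b)"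
        by (rule hasse_split) (use le_sum_UNIV order_trans in \<open>fastforce simp: in_exps j3\<close>)+
      \<comment> \<open>At third coordinate 0 the w-th derivative isolates the coefficient of s^w:
        smaller k die by the binomial, larger k by the power of 0.\<close>
      moreover have "\<dots> = (\<Sum>k\<in>{w}. of_nat (k choose w) * 0 ^ (k - w) *
            hasse ((\<lambda>e. e(3 := 0)) ` {e\<in>exps d. e 3 = k}) (\<lambda>e. c3 (e(3 := k))) j b)"
      proof (intro sum.mono_neutral_right ballI)
        fix k assume "k \<in> {..d} - {w}"
        then consider "k < w" | "w < k" by force
        then show "of_nat (k choose w) * 0 ^ (k - w) *
            hasse ((\<lambda>e. e(3 := 0)) ` {e\<in>exps d. e 3 = k}) (\<lambda>e. c3 (e(3 := k))) j b = 0"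
          by cases (auto simp: binomial_eq_0)
      qed (use wd in auto)
      ultimately show "hasse X C j b = 0" by (simp add: X_def C_def)
    qed (use Z in \<open>auto simp: X_def\<close>)
    moreover have "card T * (m - w) \<le> (\<Sum>a\<in>PiE {1, 2::3} (\<lambda>_. Z). M a)"
    proof -
      define F where "F p = (\<lambda>k\<in>{1, 2::3}. if k = 1 then fst p else snd p)" for p :: "'a \<times> 'a"
      have F: "F p 1 = fst p" "F p 2 = snd p" for p by (auto simp: F_def)
      have "inj_on F T" by (rule inj_onI) (metis F prod_eqI)
      have "card T * (m - w) = (\<Sum>a\<in>F ` T. M a)"
        by (subst sum.reindex[OF \<open>inj_on F T\<close>]) (auto simp: M_def F)
      also have "\<dots> \<le> (\<Sum>a\<in>PiE {1, 2::3} (\<lambda>_. Z). M a)"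
        by (intro sum_mono2) (use T Z in \<open>auto simp: F_def intro!: finite_PiE\<close>)
      finally show ?thesis .
    qed
    moreover have "card {1, 2::3} = 2" by simp
    ultimately have "card Z * (card T * (m - w)) \<le> (d - w) * card Z ^ 2"
      by (metis (no_types, lifting) mult_le_mono2 order_trans)
    moreover have "card Z > 0" using T Z by (auto simp: card_gt_0_iff)
    ultimately have "card T * (m - w) \<le> (d - w) * card Z"
      by (simp add: power2_eq_square mult.left_commute)
    also have "\<dots> \<le> d * card Z" by simp
    also have "\<dots> \<le> card T * (m - l)" by (rule l)
    finally have "card T * (m - w) \<le> card T * (m - l)" .
    moreover have "card T > 0" using T Z by (simp add: card_gt_0_iff finite_subset)
    moreover have "m - l < m - w" using e l by (simp add: w_def)
    ultimately show False by simp
  qed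
  have top: "meval {e. sum e UNIV = d} c (L x) = meval {e. sum e UNIV = d} c3 x" for x
  proof (rule meval_top_unique[OF inf, where a = a and b = "\<lambda>_. 0"])
    fix s
    have "L (\<lambda>k. 0 + s * x k) w = s * L x w" for w by (simp add: L_def algebra_simps)
    then show "meval (exps d) c (\<lambda>w. a w + s * L x w) = meval (exps d) c3 (\<lambda>k. 0 + s * x k)"
      using c3[of "\<lambda>k. 0 + s * x k"] by simp
  qed
  have "meval {e. sum e UNIV = d} c (\<lambda>w. u w + t * v w + s * z w) =
      (\<Sum>e\<in>{e. sum e UNIV = d}. (c3 e * t ^ e 2) * s ^ e 3)" for s
  proof -
    define x where "x = (\<lambda>k::3. if k = 1 then 1 else if k = 2 then t else s)"
    have "(\<lambda>w. u w + t * v w + s * z w) = L x" by (auto simp: L_def x_def)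
    moreover have "(\<Prod>k\<in>UNIV. x k ^ e k) = t ^ e 2 * s ^ e 3" for e
      unfolding UNIV_3 by (simp add: x_def)
    ultimately show ?thesis
      using top[of x] by (simp add: meval_def mult.assoc)
  qed
  then show "\<exists>B \<beta> (g :: (3 \<Rightarrow> nat) \<Rightarrow> nat). finite B \<and>
        (\<forall>s. meval {e. sum e UNIV = d} c (\<lambda>w. u w + t * v w + s * z w) = (\<Sum>j\<in>B. \<beta> j * s ^ g j)) \<and>
        (\<forall>j\<in>B. g j < l \<longrightarrow> \<beta> j = 0)"
    by (intro exI[of _ "{e. sum e UNIV = d}"] exI[of _ "\<lambda>e. c3 e * t ^ e 2"] exI[of _ "\<lambda>e. e 3"])
       (use c3_zero finite_homog in \<open>auto simp: in_exps\<close>)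
qed

section \<open>A robust Kakeya theorem for planes over finite fields\<close>

lemma finite_low_order: "finite {i :: 'v::finite \<Rightarrow> nat. sum i UNIV < m}"
  by (rule finite_subset[OF _ finite_exps[of m]]) (auto simp: in_exps)

text \<open>Division with remainder: the exponents q i + \<rho> with 0 \<le> \<rho> < q and i of
  weight below m are distinct and have degree at most q (m + n). This replaces a comparison of
  binomial coefficients when conditions are weighed against coefficients.\<close>

lemma card_exps_ge:
  assumes "0 < q"
  shows "q ^ CARD('v::finite) * card {i :: 'v \<Rightarrow> nat. sum i UNIV < m} \<le>
    card (exps (q * (m + CARD('v))) :: ('v \<Rightarrow> nat) set)"
proof -
  define f where "f = (\<lambda>(i, \<rho>) v :: 'v. q * i v + \<rho> v :: nat)"
  let ?A = "{i :: 'v \<Rightarrow> nat. sum i UNIV < m} \<times> PiE UNIV (\<lambda>_ :: 'v. {..<q})"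
  have "inj_on f ?A"
  proof (rule inj_onI; clarsimp)
    fix i j :: "'v \<Rightarrow> nat" and \<rho> \<sigma> assume "\<rho> \<in> PiE UNIV (\<lambda>_. {..<q})" "\<sigma> \<in> PiE UNIV (\<lambda>_. {..<q})"
      and eq: "f (i, \<rho>) = f (j, \<sigma>)"
    then have lt: "\<rho> v < q" "\<sigma> v < q" for v by (auto simp: PiE_iff)
    have eqv: "q * i v + \<rho> v = q * j v + \<sigma> v" for v using fun_cong[OF eq, of v] by (simp add: f_def)
    have "i v = j v" for v
    proof -
      have "(q * i v + \<rho> v) div q = (q * j v + \<sigma> v) div q" by (simp only: eqv)
      then show ?thesis using lt[of v] assms by simp
    qed
    moreover from this have "\<rho> v = \<sigma> v" for v using eqv[of v] by simp
    ultimately show "i = j \<and> \<rho> = \<sigma>" by auto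
  qed
  moreover have "f ` ?A \<subseteq> exps (q * (m + CARD('v)))"
  proof clarsimp
    fix i :: "'v \<Rightarrow> nat" and \<rho> assume i: "sum i UNIV < m" and \<rho>: "\<rho> \<in> PiE UNIV (\<lambda>_ :: 'v. {..<q})"
    have "sum \<rho> UNIV \<le> (\<Sum>v\<in>(UNIV :: 'v set). q)"
      using \<rho> by (intro sum_mono) (auto simp: PiE_iff less_imp_le)
    then have "sum \<rho> UNIV \<le> q * CARD('v)" by (simp add: mult.commute)
    moreover have "q * sum i UNIV \<le> q * m" using i by (intro mult_le_mono2) simp
    moreover have "sum (f (i, \<rho>)) UNIV = q * sum i UNIV + sum \<rho> UNIV"
      by (simp add: f_def sum.distrib sum_distrib_left)
    ultimately show "f (i, \<rho>) \<in> exps (q * (m + CARD('v)))"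
      unfolding in_exps distrib_left by linarith
  qed
  ultimately have "card ?A \<le> card (exps (q * (m + CARD('v))) :: ('v \<Rightarrow> nat) set)"
    by (rule card_inj_on_le) simp
  then show ?thesis by (simp add: card_cartesian_product card_PiE mult.commute)
qed

lemma hasse_diff:
  "hasse X (\<lambda>e. c e - c' e) i a = hasse X c i a - hasse X c' i a"
  by (simp add: hasse_def left_diff_distrib sum_subtractf)

text \<open>Pigeonhole instead of linear algebra: there are more coefficient families than tables of
  derivative values, so two families share a table, and their difference works.\<close>

lemma exists_vanishing_polynomial:
  fixes E :: "('v::finite \<Rightarrow> 'f::{finite,comm_ring_1}) set"
  assumes card: "card E * card {i :: 'v \<Rightarrow> nat. sum i UNIV < m} < card (exps D :: ('v \<Rightarrow> nat) set)"
  shows "\<exists>c. (\<exists>e\<in>exps D. c e \<noteq> 0) \<and> (\<forall>a\<in>E. \<forall>i. sum i UNIV < m \<longrightarrow> hasse (exps D) c i a = 0)"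
proof -
  define I where "I = {i :: 'v \<Rightarrow> nat. sum i UNIV < m}"
  have finI: "finite I" using finite_low_order by (simp add: I_def)
  define \<Phi> where "\<Phi> c = (\<lambda>p\<in>E \<times> I. hasse (exps D) c (snd p) (fst p))" for c :: "('v \<Rightarrow> nat) \<Rightarrow> 'f"
  let ?C = "PiE (exps D :: ('v \<Rightarrow> nat) set) (\<lambda>_. UNIV :: 'f set)"
  let ?V = "PiE (E \<times> I) (\<lambda>_. UNIV :: 'f set)"
  have "card {0, 1 :: 'f} \<le> CARD('f)" by (intro card_mono) auto
  then have two: "1 < CARD('f)" by simp
  have "CARD('f) ^ (card E * card I) < CARD('f) ^ card (exps D :: ('v \<Rightarrow> nat) set)"
    using card two by (intro power_strict_increasing) (auto simp: I_def)
  then have "card ?V < card ?C"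
    using finI by (simp add: card_PiE card_cartesian_product)
  moreover have "finite ?V" using finI by (intro finite_PiE) auto
  moreover have "\<Phi> ` ?C \<subseteq> ?V" by (auto simp: \<Phi>_def intro!: restrict_PiE_iff[THEN iffD2])
  ultimately have "\<not> inj_on \<Phi> ?C" using card_inj_on_le[of \<Phi> ?C ?V] by auto
  then obtain c c' where c: "c \<in> ?C" "c' \<in> ?C" "\<Phi> c = \<Phi> c'" "c \<noteq> c'" by (auto simp: inj_on_def)
  then obtain e where "e \<in> exps D" "c e \<noteq> c' e" by (metis PiE_ext)
  moreover have "hasse (exps D) (\<lambda>e. c e - c' e) i a = 0" if "a \<in> E" "sum i UNIV < m" for a i
    using fun_cong[OF c(3), of "(a, i)"] that by (simp add: hasse_diff \<Phi>_def I_def)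
  ultimately show ?thesis by (intro exI[of _ "\<lambda>e. c e - c' e"]) auto
qed

section \<open>Extension of scalars to F_q[t] and the Kakeya bound\<close>

lemma const_poly_sum: "(\<Sum>x\<in>A. [:f x:]) = [:sum f A:]"
  by (induction A rule: infinite_finite_induct) auto

lemma const_poly_prod: "(\<Prod>x\<in>A. [:f x :: 'a::comm_semiring_1:]) = [:prod f A:]"
  by (induction A rule: infinite_finite_induct) (auto simp: one_pCons mult.commute)

lemma hasse_const_poly:
  "hasse X (\<lambda>e. [:c e:]) i (\<lambda>v. [:a v:]) = [:hasse X c i a:]"
  by (simp add: hasse_def const_poly_sum const_poly_prod of_nat_poly poly_const_pow mult.commute)

lemma infinite_UNIV_poly: "infinite (UNIV :: 'a::comm_semiring_1 poly set)"
proof -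
  have "inj (\<lambda>k. Polynomial.monom (1 :: 'a) k)" by (auto simp: inj_on_def monom_eq_iff')
  then show ?thesis using infinite_UNIV_nat finite_imageD finite_subset[OF subset_UNIV] by metis
qed

text \<open>A pair (u, v) is the point u + t v of the grid of linear polynomials, so D gives |D|
  grid points where the leading form vanishes to order n. Its degree d is below 8 n^2 q, and
  Schwartz--Zippel yields q^2 n |D| \<le> d q^(2n), which would force \<alpha> q < 8 n. Incomplete
  planes suffice because the passage to infinity uses only the number of zeros on a plane.\<close>

theorem robust_kakeya_planes:
  fixes E :: "('f::{finite,field} ^ 'n) set" and \<alpha> \<gamma> :: real
  defines "q \<equiv> CARD('f)" and "n \<equiv> CARD('n)"
  assumes q: "64 * n \<le> q" and \<gamma>: "\<gamma> \<le> 1 / (4 * n)"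
    and D: "\<alpha> * real q ^ (2 * n) \<le> card D" and \<alpha>: "8 * n \<le> \<alpha> * q"
    and planes: "\<And>u v. (u, v) \<in> D \<Longrightarrow>
      \<exists>a. (1 - \<gamma>) * real q ^ 2 \<le> card {(x, y). a + x *s u + y *s v \<in> E}"
  shows "real q ^ n / 4 \<le> card E"
proof (rule ccontr)
  assume "\<not> real q ^ n / 4 \<le> card E"
  then have small: "card E < real q ^ n / 4" by simp
  have n: "0 < n" by (simp add: n_def)
  then have q0: "0 < q" using q by simp
  have n1: "1 \<le> real n" using n by simp
  have q64: "64 * real n \<le> q" using q by (metis of_nat_le_iff of_nat_mult of_nat_numeral)
  \<comment> \<open>A polynomial of degree at most \<open>q' (m + n)\<close> that vanishes to order \<open>m\<close> on \<open>E\<close> exists because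
    \<open>q'\<^sup>n > card E\<close>; its leading form vanishes to order \<open>n\<close> at infinity because
    \<open>(1 - 1/(2n)) (m + n) \<le> (1 - \<gamma>) (m - n)\<close>.\<close>
  define m where "m = n * (8 * n - 1)"
  define b where "b = 1 - 1 / (2 * real n)"
  define q' where "q' = nat \<lfloor>b * real q\<rfloor>"
  define Dg where "Dg = q' * (m + n)"
  have mn: "m + n = 8 * n^2"
  proof -
    have "n * (8 * n - 1) + n = n * (8 * n)" using n by (cases n) (auto simp: algebra_simps)
    then show ?thesis by (simp add: m_def power2_eq_square)
  qed
  have b: "1/2 \<le> b" "b < 1" using n1 by (auto simp: b_def field_simps)
  have q'_le: "real q' \<le> b * q" using b by (simp add: q'_def)
  have q'_ge: "b * q - 1 \<le> real q'" using b unfolding q'_def by linarith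
  have "b * q \<ge> 32 * n" using mult_mono[OF b(1) q64] b by simp
  then have q'0: "0 < q'" using q'_ge n1 by linarith
  have "real q ^ n / 4 \<le> real q' ^ n"
  proof -
    \<comment> \<open>This is 1/(2n) + 1/(64n): the first term is 1 - b, the second absorbs the
      rounding in \<open>q'\<close>, since q \<ge> 64 n. Bernoulli gives (1 - x)^n \<ge>
      31/64.\<close>
    define x where "x = 33 / (64 * real n)"
    have x: "0 \<le> x" "x \<le> 1" using n1 by (auto simp: x_def field_simps)
    have "1 \<le> q / (64 * real n)" using q64 n1 by (simp add: field_simps)
    then have "(1 - x) * q \<le> b * q - 1"
      by (simp add: x_def b_def algebra_simps add_divide_distrib diff_divide_distrib)
    then have "(1 - x) * q \<le> q'" using q'_ge by simp
    then have "((1 - x) * q) ^ n \<le> real q' ^ n" using x by (intro power_mono) auto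
    moreover have "1/4 \<le> (1 - x) ^ n"
      using Bernoulli_inequality[of "-x" n] x n1 by (simp add: x_def)
    then have "1/4 * real q ^ n \<le> (1 - x) ^ n * real q ^ n" by (intro mult_right_mono) auto
    ultimately show ?thesis by (simp add: power_mult_distrib)
  qed
  then have "card E < q' ^ n"
    using small by (simp flip: of_nat_power)
  define E' where "E' = vec_nth ` E"
  have "card E' = card E" unfolding E'_def by (intro card_image inj_onI) (simp add: vec_nth_inject)
  have m0: "0 < m" using n by (simp add: m_def)
  then have "(\<lambda>_. 0) \<in> {i :: 'n \<Rightarrow> nat. sum i UNIV < m}" by simp
  then have "card {i :: 'n \<Rightarrow> nat. sum i UNIV < m} > 0"
    using finite_low_order by (metis card_gt_0_iff empty_iff)
  then have "card E' * card {i :: 'n \<Rightarrow> nat. sum i UNIV < m} < q' ^ n * card {i :: 'n \<Rightarrow> nat. sum i UNIV < m}"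
    using \<open>card E < q' ^ n\<close> \<open>card E' = card E\<close> by simp
  also have "\<dots> \<le> card (exps Dg :: ('n \<Rightarrow> nat) set)"
    unfolding Dg_def n_def by (rule card_exps_ge[OF q'0])
  finally obtain c :: "('n \<Rightarrow> nat) \<Rightarrow> 'f" where c: "\<exists>e\<in>exps Dg. c e \<noteq> 0"
    and cE: "\<And>a i. a \<in> E' \<Longrightarrow> sum i UNIV < m \<Longrightarrow> hasse (exps Dg) c i a = 0"
    using exists_vanishing_polynomial[of E' m Dg] by blast
  \<comment> \<open>The polynomial found may have degree below \<open>Dg\<close>; its exact degree d
    is needed for the form of degree d to be nonzero.\<close>
  define S where "S = {e\<in>exps Dg. c e \<noteq> 0}"
  have S: "finite S" "S \<noteq> {}" using c by (auto simp: S_def)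
  define d where "d = Max ((\<lambda>e. sum e UNIV) ` S)"
  have "d \<in> (\<lambda>e. sum e UNIV) ` S" unfolding d_def using S by (intro Max_in) auto
  then obtain e0 where e0: "e0 \<in> S" "sum e0 UNIV = d" by auto
  have dD: "d \<le> Dg" using e0 by (auto simp: S_def in_exps)
  have "sum e UNIV \<le> d" if "e \<in> S" for e
    unfolding d_def using S that by (intro Max_ge) auto
  then have hd: "hasse (exps Dg) c i a = hasse (exps d) c i a" for i a
    unfolding hasse_def using dD
    by (intro sum.mono_neutral_right) (auto simp: S_def in_exps)
  have "real d \<le> real (q' * (8 * n ^ 2))"
    using dD by (simp only: of_nat_le_iff Dg_def mn)
  then have "real d \<le> real q' * (8 * real n ^ 2)" by simp
  also have "\<dots> \<le> (b * q) * (8 * real n ^ 2)" by (intro mult_right_mono q'_le) auto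
  also have "\<dots> = q * (b * (8 * real n ^ 2))" by simp
  also have "b * (8 * real n ^ 2) = 8 * real n ^ 2 - 4 * real n"
    using n1 by (simp add: b_def field_simps power2_eq_square)
  finally have d_le: "real d \<le> q * (8 * real n ^ 2 - 4 * real n)" .
  define C where "C e = [:c e:]" for e
  have inf: "infinite (UNIV :: 'f poly set)" by (rule infinite_UNIV_poly)
  define Z where "Z = range (\<lambda>x :: 'f. [:x:])"
  have cardZ: "card Z = q" unfolding Z_def q_def by (intro card_image inj_onI) auto
  have van: "hasse {e. sum e UNIV = d} C i (\<lambda>w. [:u $ w, v $ w:]) = 0"
    if uv: "(u, v) \<in> D" and i: "sum i UNIV < n" for u v i
  proof -
    obtain a where a: "(1 - \<gamma>) * real q ^ 2 \<le> card {(x, y). a + x *s u + y *s v \<in> E}"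
      using planes[OF uv] by blast
    define T where "T = (\<lambda>(x, y). ([:x:], [:y:])) ` {(x, y). a + x *s u + y *s v \<in> E}"
    have cardT: "card T = card {(x, y). a + x *s u + y *s v \<in> E}"
      unfolding T_def by (intro card_image inj_onI) auto
    have "\<gamma> \<le> 1/4" using \<gamma> n1 by (smt (verit) divide_le_cancel frac_le)
    then have "0 < (1 - \<gamma>) * real q ^ 2" using q0 by (intro mult_pos_pos) auto
    then have "0 < real (card T)" using a cardT by linarith
    then have T0: "T \<noteq> {}" by auto
    have "hasse {e. sum e UNIV = d} C i (\<lambda>w. [:u $ w:] + [:0, 1:] * [:v $ w:]) = 0"
    proof (rule hasse_at_infinity_eq_0[OF inf, where Z = Z and T = T and m = m and l = n and a = "\<lambda>w. [:a $ w:]"])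
      fix x y :: "'f poly" and i :: "'n \<Rightarrow> nat" assume "(x, y) \<in> T" "sum i UNIV < m"
      then obtain x' y' where xy: "x = [:x':]" "y = [:y':]" "a + x' *s u + y' *s v \<in> E" by (auto simp: T_def)
      have eq: "(\<lambda>w. [:a $ w:] + x * [:u $ w:] + y * [:v $ w:]) = (\<lambda>w. [:(a + x' *s u + y' *s v) $ w:])"
        by (simp add: xy mult.commute)
      have zero: "hasse (exps Dg) c i (vec_nth (a + x' *s u + y' *s v)) = 0"
        using xy \<open>sum i UNIV < m\<close> by (intro cE) (auto simp: E'_def)
      show "hasse (exps d) C i (\<lambda>w. [:a $ w:] + x * [:u $ w:] + y * [:v $ w:]) = 0"
        unfolding eq C_def hasse_const_poly hd[symmetric] by (simp only: zero pCons_0_0)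
    next
      \<comment> \<open>With |T| \<ge> (1 - 1/(4n)) q^2 and m - n = 8n^2 - 2n the right side is at
        least (8n^2 - 4n + 1/2) q^2, while d \<le> (8n^2 - 4n) q.\<close>
      show "d * card Z \<le> card T * (m - n)"
      proof -
        have "real (m - n) = 8 * real n ^ 2 - 2 * n"
        proof -
          have "m - n = 8 * n ^ 2 - 2 * n" using mn by simp
          moreover have "2 * n \<le> 8 * n^2" by (simp add: power2_eq_square)
          ultimately show ?thesis by (simp add: of_nat_diff)
        qed
        moreover have "(1 - 1 / (4 * real n)) * real q^2 \<le> card T"
          using a cardT mult_right_mono[of "1 - 1 / (4 * real n)" "1 - \<gamma>" "(real q)^2"] \<gamma> by simp
        ultimately have "(1 - 1 / (4 * real n)) * real q^2 * (8 * real n ^ 2 - 2 * n) \<le> real (card T * (m - n))"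
          using n1 by (auto intro!: mult_right_mono simp: power2_eq_square)
        moreover have "(8 * real n ^ 2 - 4 * n) * real q^2 \<le> (1 - 1 / (4 * real n)) * real q^2 * (8 * real n ^ 2 - 2 * n)"
        proof -
          have le: "8 * real n ^ 2 - 4 * n \<le> (1 - 1 / (4 * real n)) * (8 * real n ^ 2 - 2 * n)"
            using n1 by (simp add: field_simps power2_eq_square)
          show ?thesis using mult_right_mono[OF le, of "real q ^ 2"] by (simp add: mult_ac)
        qed
        moreover have "real d * q \<le> (8 * real n ^ 2 - 4 * n) * real q^2"
          using mult_right_mono[OF d_le, of "real q"] by (simp add: power2_eq_square mult_ac)
        ultimately have "real (d * q) \<le> real (card T * (m - n))" by simp
        then show ?thesis by (simp only: of_nat_le_iff cardZ)
      qed
    next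
      show "n \<le> m" using n by (simp add: m_def)
    qed (use i T0 in \<open>auto simp: Z_def T_def\<close>)
    then show ?thesis by simp
  qed
  define G where "G = range (\<lambda>(x :: 'f, y :: 'f). [:x, y:])"
  have cardG: "card G = q ^ 2"
    unfolding G_def by (subst card_image) (auto simp: inj_on_def q_def power2_eq_square)
  define pt where "pt = (\<lambda>(u :: 'f ^ 'n, v :: 'f ^ 'n) w. [:u $ w, v $ w:])"
  have "inj_on pt D" by (auto simp: inj_on_def pt_def fun_eq_iff vec_eq_iff)
  define M where "M a = (if a \<in> pt ` D then n else 0)" for a
  have "card G * (\<Sum>a\<in>PiE (UNIV :: 'n set) (\<lambda>_. G). M a) \<le> d * card G ^ card (UNIV :: 'n set)"
  proof (rule schwartz_zippel_multiplicity[where X = "{e. sum e UNIV = d}" and c = C])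
    show "\<exists>e\<in>{e. sum e UNIV = d}. C e \<noteq> 0" using e0 by (auto simp: S_def C_def)
  next
    fix a :: "'n \<Rightarrow> 'f poly" and i :: "'n \<Rightarrow> nat" assume "sum i UNIV < M a"
    then show "hasse {e. sum e UNIV = d} C i a = 0" using van by (auto simp: M_def pt_def split: if_splits)
  qed (auto simp: finite_homog G_def)
  moreover have "card D * n \<le> (\<Sum>a\<in>PiE (UNIV :: 'n set) (\<lambda>_. G). M a)"
  proof -
    have "card D * n = (\<Sum>a\<in>pt ` D. M a)"
      by (subst sum.reindex[OF \<open>inj_on pt D\<close>]) (auto simp: M_def)
    also have "\<dots> \<le> (\<Sum>a\<in>PiE (UNIV :: 'n set) (\<lambda>_. G). M a)"
      by (intro sum_mono2) (auto simp: pt_def G_def intro!: finite_PiE)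
    finally show ?thesis .
  qed
  ultimately have "q ^ 2 * (card D * n) \<le> d * q ^ (2 * n)"
    unfolding cardG n_def[symmetric] power_mult by (meson mult_le_mono2 order_trans)
  then have "real q ^ 2 * (card D * n) \<le> d * real q ^ (2 * n)"
    by (metis of_nat_le_iff of_nat_mult of_nat_power)
  moreover have "real q ^ 2 * (\<alpha> * real q ^ (2 * n) * n) \<le> real q ^ 2 * (card D * n)"
    using mult_left_mono[OF mult_right_mono[OF D, of "real n"], of "real q ^ 2"] by simp
  ultimately have "(real q ^ 2 * \<alpha> * n) * real q ^ (2 * n) \<le> d * real q ^ (2 * n)"
    by (simp add: mult_ac)
  then have "real q ^ 2 * \<alpha> * n \<le> d" using q0 by simp
  also have "\<dots> \<le> q * (8 * real n ^ 2 - 4 * real n)" by (rule d_le)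
  also have "\<dots> < q * (8 * real n ^ 2)" using q0 n by simp
  finally have "(real q * n) * (q * \<alpha>) < (real q * n) * (8 * n)" by (simp add: power2_eq_square mult_ac)
  then have "q * \<alpha> < 8 * n" using q0 n by (simp add: mult_less_cancel_left)
  then show False using \<alpha> by (simp add: mult.commute)
qed

section \<open>Random subspaces meet translates of a set evenly\<close>

definition ind_list :: "('f::field ^ 'n) list \<Rightarrow> bool" where
  "ind_list xs \<longleftrightarrow> distinct xs \<and> vec.independent (set xs)"

text \<open>Random subspaces are realised by ordered bases. The number of ways to extend an
  independent list inside S depends only on the lengths and on dim S, so uniform lists induce
  uniform subspaces, and no Gaussian binomials enter.\<close>

definition ext_lists :: "nat \<Rightarrow> ('f::field ^ 'n) list \<Rightarrow> ('f ^ 'n) set \<Rightarrow> ('f ^ 'n) list set" where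
  "ext_lists k xs S = {ys. length ys = k \<and> set ys \<subseteq> S \<and> ind_list (ys @ xs)}"

lemma ind_list_Nil [simp]: "ind_list []"
  by (simp add: ind_list_def vec.independent_empty)

lemma ind_list_Cons: "ind_list (x # xs) \<longleftrightarrow> x \<notin> vec.span (set xs) \<and> ind_list xs"
  by (auto simp: ind_list_def vec.independent_insert vec.span_base)

lemma ind_list_permute: "mset xs = mset ys \<Longrightarrow> ind_list xs \<longleftrightarrow> ind_list ys"
  unfolding ind_list_def by (metis mset_eq_imp_distinct_iff mset_eq_setD)

lemma card_span_ind_list:
  fixes xs :: "('f::{finite,field} ^ 'n) list"
  assumes "ind_list xs"
  shows "card (vec.span (set xs)) = CARD('f) ^ length xs"
  using assms
proof (induction xs)
  case (Cons x xs)
  then have x: "x \<notin> vec.span (set xs)" and IH: "card (vec.span (set xs)) = CARD('f) ^ length xs"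
    by (auto simp: ind_list_Cons)
  define f where "f = (\<lambda>(k, y). k *s x + y)"
  have "inj_on f (UNIV \<times> vec.span (set xs))"
  proof (rule inj_onI, clarify)
    fix k y k' y' assume y: "y \<in> vec.span (set xs)" "y' \<in> vec.span (set xs)" and eq: "f (k, y) = f (k', y')"
    then have d: "(k - k') *s x = y' - y" by (simp add: f_def algebra_simps vec.scale_left_diff_distrib)
    have "k = k'"
    proof (rule ccontr)
      assume "k \<noteq> k'"
      moreover have "(k - k') *s x \<in> vec.span (set xs)" unfolding d by (intro vec.span_diff y)
      ultimately have "x \<in> vec.span (set xs)"
        using vec.span_scale[of "(k - k') *s x" "set xs" "inverse (k - k')"]
        by (simp only: vector_smult_assoc left_inverse right_minus_eq not_False_eq_True vector_smult_lid)
      with x show False ..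
    qed
    with d show "k = k' \<and> y = y'" by simp
  qed
  moreover have "f ` (UNIV \<times> vec.span (set xs)) = vec.span (set (x # xs))"
  proof (intro equalityI subsetI)
    fix z assume "z \<in> f ` (UNIV \<times> vec.span (set xs))"
    then obtain k y where "z = k *s x + y" "y \<in> vec.span (set xs)" by (auto simp: f_def)
    then have "z - k *s x \<in> vec.span (set xs)" by simp
    then show "z \<in> vec.span (set (x # xs))" by (auto simp: vec.span_breakdown_eq)
  next
    fix z assume "z \<in> vec.span (set (x # xs))"
    then obtain k where "z - k *s x \<in> vec.span (set xs)" by (auto simp: vec.span_breakdown_eq)
    then show "z \<in> f ` (UNIV \<times> vec.span (set xs))"
      by (intro image_eqI[of _ _ "(k, z - k *s x)"]) (auto simp: f_def)
  qed
  ultimately show ?case using IH by (metis card_UNIV_unit card_cartesian_product card_image length_Cons power_Suc)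
qed simp

lemma subspace_basis_list:
  fixes S :: "('f::{finite,field} ^ 'n) set"
  assumes "vec.subspace S"
  obtains xs where "ind_list xs" "vec.span (set xs) = S" "length xs = vec.dim S"
proof -
  obtain B where B: "B \<subseteq> S" "vec.independent B" "S \<subseteq> vec.span B" "card B = vec.dim S"
    using vec.basis_exists[of S] by blast
  obtain xs where "set xs = B" "distinct xs" using finite_distinct_list[of B] by auto
  moreover have "vec.span B = S" using B assms by (metis vec.span_subspace)
  ultimately show ?thesis using B by (intro that[of xs]) (auto simp: ind_list_def distinct_card)
qed

lemma card_subspace:
  fixes S :: "('f::{finite,field} ^ 'n) set"
  assumes "vec.subspace S"
  shows "card S = CARD('f) ^ vec.dim S"
  using subspace_basis_list[OF assms] card_span_ind_list by metis

lemma length_ind_list_eq_dim: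
  assumes "ind_list xs" shows "vec.dim (vec.span (set xs)) = length xs"
  using assms by (simp add: ind_list_def vec.dim_span vec.dim_eq_card_independent distinct_card)

lemma card_ext_lists:
  fixes S :: "('f::{finite,field} ^ 'n) set"
  assumes S: "vec.subspace S" and xs: "ind_list xs" "set xs \<subseteq> S"
  shows "card (ext_lists k xs S) = (\<Prod>i<k. CARD('f) ^ vec.dim S - CARD('f) ^ (length xs + i))"
proof (induction k)
  case 0
  have "ext_lists 0 xs S = {[]}" using xs by (auto simp: ext_lists_def)
  then show ?case by simp
next
  case (Suc k)
  let ?F = "\<lambda>ys. S - vec.span (set (ys @ xs))"
  have eq: "ext_lists (Suc k) xs S = (\<lambda>(ys, y). y # ys) ` (SIGMA ys : ext_lists k xs S. ?F ys)"
  proof (intro equalityI subsetI)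
    fix zs assume "zs \<in> ext_lists (Suc k) xs S"
    then show "zs \<in> (\<lambda>(ys, y). y # ys) ` (SIGMA ys : ext_lists k xs S. ?F ys)"
      by (cases zs) (auto simp: ext_lists_def ind_list_Cons)
  qed (auto simp: ext_lists_def ind_list_Cons)
  have fin: "finite (ext_lists k xs S)"
    by (rule finite_subset[OF _ finite_lists_length_eq[of S k]]) (auto simp: ext_lists_def)
  have "card (?F ys) = CARD('f) ^ vec.dim S - CARD('f) ^ (length xs + k)" if "ys \<in> ext_lists k xs S" for ys
  proof -
    have "vec.span (set (ys @ xs)) \<subseteq> S"
      using that xs S by (intro vec.span_minimal) (auto simp: ext_lists_def)
    moreover have "card (vec.span (set (ys @ xs))) = CARD('f) ^ (length xs + k)"
      using card_span_ind_list[of "ys @ xs"] that by (simp add: ext_lists_def add.commute)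
    ultimately show ?thesis by (subst card_Diff_subset) (auto simp: card_subspace[OF S])
  qed
  then have "card (ext_lists (Suc k) xs S) = card (ext_lists k xs S) * (CARD('f) ^ vec.dim S - CARD('f) ^ (length xs + k))"
    unfolding eq using fin by (subst card_image) (auto simp: inj_on_def card_SigmaI)
  then show ?case by (simp add: Suc.IH)
qed

lemma finite_ext_lists [simp]: "finite (ext_lists k xs (S :: ('f::{finite,field} ^ 'n) set))"
  by (rule finite_subset[OF _ finite_lists_length_eq[of S k]]) (auto simp: ext_lists_def)

text \<open>The span of a random list contains s with probability (q^k - 1)/(q^d - 1) \<le> q^(k-d),
  where d = dim S. The lists whose span misses s are those extending \<open>[s]\<close>; the product
  formulas for their number U and for the number T of all lists differ in one factor each, so that T
  (q^d - q^k) = (q^d - 1) U.\<close>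

lemma card_mem_span_le:
  fixes S :: "('f::{finite,field} ^ 'n) set"
  assumes S: "vec.subspace S" and s: "s \<in> S" "s \<noteq> 0" and k: "k \<le> vec.dim S"
  shows "card {w\<in>ext_lists k [] S. s \<in> vec.span (set w)} * real CARD('f) ^ vec.dim S \<le>
    card (ext_lists k [] S) * real CARD('f) ^ k"
proof -
  let ?q = "CARD('f)" and ?d = "vec.dim S"
  define T where "T = card (ext_lists k [] S)"
  define U where "U = card (ext_lists k [s] S)"
  have ind: "ind_list [s]" using s by (simp add: ind_list_Cons)
  have T: "T = (\<Prod>i<k. ?q ^ ?d - ?q ^ i)" unfolding T_def by (subst card_ext_lists[OF S]) auto
  have U: "U = (\<Prod>i<k. ?q ^ ?d - ?q ^ Suc i)" unfolding U_def by (subst card_ext_lists[OF S ind]) (use s in auto)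
  have "T * (?q ^ ?d - ?q ^ k) = (\<Prod>i<Suc k. ?q ^ ?d - ?q ^ i)" by (simp add: T)
  also have "\<dots> = (?q ^ ?d - 1) * U" by (subst prod.lessThan_Suc_shift) (simp add: U)
  finally have "real (T * (?q ^ ?d - ?q ^ k)) = real ((?q ^ ?d - 1) * U)" by simp
  moreover have "?q ^ k \<le> ?q ^ ?d" using k by (intro power_increasing) auto
  ultimately have TU: "real T * (real ?q ^ ?d - real ?q ^ k) = (real ?q ^ ?d - 1) * U"
    by (simp add: of_nat_diff)
  have "{w\<in>ext_lists k [] S. s \<notin> vec.span (set w)} = ext_lists k [s] S"
  proof -
    have "ind_list (w @ [s]) \<longleftrightarrow> s \<notin> vec.span (set w) \<and> ind_list w" for w
      using ind_list_permute[of "w @ [s]" "s # w"] by (simp add: ind_list_Cons)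
    then show ?thesis by (auto simp: ext_lists_def)
  qed
  then have "{w\<in>ext_lists k [] S. s \<in> vec.span (set w)} = ext_lists k [] S - ext_lists k [s] S"
    "ext_lists k [s] S \<subseteq> ext_lists k [] S" by auto
  then have "real (card {w\<in>ext_lists k [] S. s \<in> vec.span (set w)}) = real T - real U"
    unfolding T_def U_def by (simp add: card_Diff_subset of_nat_diff card_mono)
  moreover have "(real T - real U) * real ?q ^ ?d = real T * real ?q ^ k - U"
    using TU by (simp add: algebra_simps)
  ultimately show ?thesis by (simp add: T_def)
qed

section \<open>Second moments of fibre counts\<close>

lemma real_card_Collect: "finite A \<Longrightarrow> real (card {a\<in>A. P a}) = (\<Sum>a\<in>A. of_bool (P a))"
  by (simp add: sum.If_cases of_bool_def Int_def)

text \<open>The second moment counts pairs a, b in A with a - b in the span of w, each weighted by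
  q^k. Averaged over w, a pair with distinct entries contributes at most its share of the squared
  mean, which cancels; only the diagonal remains. After division by the number of pairs (w, z) the
  variance is at most the mean.\<close>

lemma coset_fibre_variance:
  fixes S A :: "('f::{finite,field} ^ 'n) set" and q :: real
  assumes S: "vec.subspace S" and k: "k \<le> vec.dim S" and A: "A \<subseteq> (\<lambda>s. y + s) ` S"
  defines "q \<equiv> real CARD('f)"
  shows "(\<Sum>w\<in>ext_lists k [] S. \<Sum>z\<in>(\<lambda>s. y + s) ` S.
      (real (card {a\<in>A. a - z \<in> vec.span (set w)}) - card A * q ^ k / q ^ vec.dim S)^2)
    \<le> card (ext_lists k [] S) * q ^ k * card A"
proof -
  let ?W = "(\<lambda>s. y + s) ` S" and ?d = "vec.dim S" and ?T = "ext_lists k [] S"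
  define m where "m = card A * q ^ k / q ^ ?d"
  have q0: "q > 0" by (simp add: q_def)
  have q2k: "q ^ (2 * k) = q ^ k * q ^ k" by (simp only: mult_2 power_add)
  have cW: "real (card ?W) = q ^ ?d"
    by (simp add: card_image card_subspace[OF S] q_def)
  have per_w: "(\<Sum>z\<in>?W. (real (card {a\<in>A. a - z \<in> vec.span (set w)}) - m)^2) =
      q ^ k * (\<Sum>a\<in>A. \<Sum>b\<in>A. of_bool (a - b \<in> vec.span (set w))) - (card A)^2 * q ^ (2 * k) / q ^ ?d"
    if w: "w \<in> ?T" for w
  proof -
    let ?U = "vec.span (set w)"
    have U: "?U \<subseteq> S" using w S by (intro vec.span_minimal) (auto simp: ext_lists_def)
    have cU: "real (card ?U) = q ^ k"
      using card_span_ind_list[of w] w by (simp add: ext_lists_def q_def)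
    define f where "f z = (\<Sum>a\<in>A. of_bool (a - z \<in> ?U) :: real)" for z
    have f: "real (card {a\<in>A. a - z \<in> ?U}) = f z" for z unfolding f_def by (rule real_card_Collect) simp
    have fib: "(\<Sum>z\<in>?W. of_bool (a - z \<in> ?U) :: real) = q ^ k" if aA: "a \<in> A" for a
    proof -
      have "{z\<in>?W. a - z \<in> ?U} = (\<lambda>u. a - u) ` ?U"
      proof (intro equalityI subsetI)
        fix z assume "z \<in> {z\<in>?W. a - z \<in> ?U}"
        then show "z \<in> (\<lambda>u. a - u) ` ?U" by (intro image_eqI[of _ _ "a - z"]) auto
      next
        fix z assume "z \<in> (\<lambda>u. a - u) ` ?U"
        then obtain u where u: "u \<in> ?U" "z = a - u" by auto
        obtain s where s: "s \<in> S" "a = y + s" using aA A by auto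
        have "s - u \<in> S" using s u U S by (intro vec.subspace_diff) auto
        then have "z \<in> ?W" using u s by (intro image_eqI[of _ _ "s - u"]) auto
        then show "z \<in> {z\<in>?W. a - z \<in> ?U}" using u by simp
      qed
      then have "card {z\<in>?W. a - z \<in> ?U} = card ?U" by (simp add: card_image inj_on_def)
      then show ?thesis using cU by (subst real_card_Collect[symmetric]) auto
    qed
    have sum1: "(\<Sum>z\<in>?W. f z) = card A * q ^ k"
    proof -
      have "(\<Sum>z\<in>?W. f z) = (\<Sum>a\<in>A. q ^ k)"
        unfolding f_def by (subst sum.swap) (intro sum.cong refl fib)
      then show ?thesis by simp
    qed
    have "(\<Sum>z\<in>?W. f z ^ 2) = (\<Sum>z\<in>?W. \<Sum>a\<in>A. \<Sum>b\<in>A. of_bool (a - z \<in> ?U) * of_bool (a - b \<in> ?U))"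
    proof -
      \<comment> \<open>Once a lies in z + U, the point b does exactly when a - b is in U, which
        separates z from b.\<close>
      have eq: "of_bool (a - z \<in> ?U) * of_bool (b - z \<in> ?U) = (of_bool (a - z \<in> ?U) * of_bool (a - b \<in> ?U) :: real)" for a b z
      proof (cases "a - z \<in> ?U")
        case True
        have "b - z \<in> ?U \<longleftrightarrow> a - b \<in> ?U"
          using vec.span_diff[OF True, of "b - z"] vec.span_diff[OF True, of "a - b"] by (auto simp: algebra_simps)
        then show ?thesis by simp
      qed simp
      show ?thesis unfolding f_def power2_eq_square sum_product by (simp only: eq)
    qed
    also have "\<dots> = (\<Sum>a\<in>A. \<Sum>z\<in>?W. \<Sum>b\<in>A. of_bool (a - z \<in> ?U) * of_bool (a - b \<in> ?U))"
      by (rule sum.swap)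
    also have "\<dots> = (\<Sum>a\<in>A. \<Sum>b\<in>A. \<Sum>z\<in>?W. of_bool (a - z \<in> ?U) * of_bool (a - b \<in> ?U))"
      by (rule sum.cong[OF refl], rule sum.swap)
    also have "\<dots> = q ^ k * (\<Sum>a\<in>A. \<Sum>b\<in>A. of_bool (a - b \<in> ?U))"
      unfolding sum_distrib_left sum_distrib_right[symmetric]
      by (intro sum.cong refl) (simp only: fib)
    finally have sum2: "(\<Sum>z\<in>?W. f z ^ 2) = q ^ k * (\<Sum>a\<in>A. \<Sum>b\<in>A. of_bool (a - b \<in> ?U))" .
    have "(\<Sum>z\<in>?W. (f z - m)^2) = (\<Sum>z\<in>?W. f z ^ 2) - 2 * m * (\<Sum>z\<in>?W. f z) + card ?W * m^2"
      by (simp add: power2_diff sum.distrib sum_subtractf sum_distrib_left algebra_simps)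
    also have "\<dots> = q ^ k * (\<Sum>a\<in>A. \<Sum>b\<in>A. of_bool (a - b \<in> ?U)) - (card A)^2 * q ^ (2 * k) / q ^ ?d"
    proof -
      have "2 * m * (card A * q ^ k) = 2 * ((card A)^2 * q ^ (2 * k) / q ^ ?d)"
        unfolding m_def q2k power2_eq_square by simp
      moreover have "q ^ ?d * m^2 = (card A)^2 * q ^ (2 * k) / q ^ ?d"
        unfolding m_def q2k power2_eq_square using q0 by simp
      ultimately show ?thesis unfolding sum1 sum2 cW by simp
    qed
    finally show ?thesis by (simp add: f)
  qed
  have "(\<Sum>w\<in>?T. \<Sum>a\<in>A. \<Sum>b\<in>A. of_bool (a - b \<in> vec.span (set w))) =
      (\<Sum>a\<in>A. \<Sum>w\<in>?T. \<Sum>b\<in>A. of_bool (a - b \<in> vec.span (set w)) :: real)"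
    by (rule sum.swap)
  also have "\<dots> = (\<Sum>a\<in>A. \<Sum>b\<in>A. \<Sum>w\<in>?T. of_bool (a - b \<in> vec.span (set w)) :: real)"
    by (rule sum.cong[OF refl], rule sum.swap)
  also have "\<dots> \<le> (\<Sum>a\<in>A. \<Sum>b\<in>A. (if a = b then real (card ?T) else 0) + card ?T * q ^ k / q ^ ?d)"
  proof (intro sum_mono)
    fix a b assume ab: "a \<in> A" "b \<in> A"
    show "(\<Sum>w\<in>?T. of_bool (a - b \<in> vec.span (set w))) \<le> (if a = b then real (card ?T) else 0) + card ?T * q ^ k / q ^ ?d"
    proof (cases "a = b")
      case True
      then show ?thesis using q0 by (simp add: vec.span_zero)
    next
      case False
      obtain s t where st: "s \<in> S" "a = y + s" "t \<in> S" "b = y + t" using ab A by blast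
      then have "a - b \<in> S" using vec.subspace_diff[OF S, of s t] by simp
      then show ?thesis using card_mem_span_le[OF S _ _ k, of "a - b"] False q0
        by (subst real_card_Collect[symmetric]) (auto simp: q_def field_simps)
    qed
  qed
  also have "\<dots> = card A * card ?T + (card A)^2 * card ?T * q ^ k / q ^ ?d"
    by (simp add: sum.distrib sum.delta power2_eq_square distrib_left mult.assoc)
  finally have *: "(\<Sum>w\<in>?T. \<Sum>a\<in>A. \<Sum>b\<in>A. of_bool (a - b \<in> vec.span (set w))) \<le>
    card A * card ?T + (card A)^2 * card ?T * q ^ k / q ^ ?d" .
  have "(\<Sum>w\<in>?T. \<Sum>z\<in>?W. (real (card {a\<in>A. a - z \<in> vec.span (set w)}) - m)^2) =
      q ^ k * (\<Sum>w\<in>?T. \<Sum>a\<in>A. \<Sum>b\<in>A. of_bool (a - b \<in> vec.span (set w))) - card ?T * ((card A)^2 * q ^ (2 * k) / q ^ ?d)"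
    by (simp add: per_w sum_subtractf sum_distrib_left)
  also have "\<dots> \<le> q ^ k * (card A * card ?T + (card A)^2 * card ?T * q ^ k / q ^ ?d) - card ?T * ((card A)^2 * q ^ (2 * k) / q ^ ?d)"
    using * q0 by (intro diff_right_mono mult_left_mono) auto
  also have "\<dots> = card ?T * q ^ k * card A"
    unfolding q2k by (simp add: algebra_simps)
  finally show ?thesis by (simp add: m_def)
qed

lemma markov_card:
  fixes g :: "'a \<Rightarrow> real" and c :: real
  assumes "finite T" "\<And>w. w \<in> T \<Longrightarrow> 0 \<le> g w"
  shows "card {w\<in>T. c < g w} * c \<le> (\<Sum>w\<in>T. g w)"
proof -
  have "card {w\<in>T. c < g w} * c = (\<Sum>w\<in>{w\<in>T. c < g w}. c)" by simp
  also have "\<dots> \<le> (\<Sum>w\<in>{w\<in>T. c < g w}. g w)" by (intro sum_mono) auto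
  also have "\<dots> \<le> (\<Sum>w\<in>T. g w)" using assms by (intro sum_mono2) auto
  finally show ?thesis .
qed

lemma card_mult_le_sum:
  fixes h :: "'a \<Rightarrow> real" and d :: real
  assumes "finite W" "B \<subseteq> W" "\<And>z. z \<in> B \<Longrightarrow> d \<le> h z" "\<And>z. z \<in> W \<Longrightarrow> 0 \<le> h z"
  shows "card B * d \<le> (\<Sum>z\<in>W. h z)"
proof -
  have "card B * d = (\<Sum>z\<in>B. d)" by simp
  also have "\<dots> \<le> (\<Sum>z\<in>B. h z)" using assms by (intro sum_mono) auto
  also have "\<dots> \<le> (\<Sum>z\<in>W. h z)" using assms by (intro sum_mono2) auto
  finally show ?thesis .
qed

definition fibre :: "('f::{finite,field} ^ 'n) set \<Rightarrow> ('f ^ 'n) list \<Rightarrow> 'f ^ 'n \<Rightarrow> real" where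
  "fibre A w z = card {a\<in>A. a - z \<in> vec.span (set w)}"

text \<open>The sign \<open>\<sigma>\<close> selects the upper or the lower tail.\<close>

definition excess :: "real \<Rightarrow> real \<Rightarrow> real \<Rightarrow> ('f::{finite,field} ^ 'n) set \<Rightarrow> ('f ^ 'n) list \<Rightarrow> ('f ^ 'n) set" where
  "excess \<sigma> \<mu> t A w = {z. \<sigma> * (fibre A w z - \<mu>) > t}"

lemma ext_lists_nonempty:
  fixes S :: "('f::{finite,field} ^ 'n) set"
  assumes "vec.subspace S" "k \<le> vec.dim S"
  shows "0 < card (ext_lists k [] S)"
proof -
  have "card {0, 1 :: 'f} \<le> CARD('f)" by (intro card_mono) auto
  then have "1 < CARD('f)" by simp
  then have "CARD('f) ^ i < CARD('f) ^ vec.dim S" if "i < k" for i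
    using that assms by (intro power_strict_increasing) auto
  then show ?thesis using assms by (subst card_ext_lists) (auto intro!: prod_pos)
qed

text \<open>By Chebyshev the density of the excess set, averaged over w, is at most
  \<mu>/(\<tau>\<mu>/2)^2 = 4/(\<tau>^2 \<mu>) \<le> 4/(\<tau>^2 q). Markov's inequality with factor
  4/\<delta> produces the constant 16/(\<tau>^2 q \<delta>).\<close>

lemma excess_density:
  fixes A :: "('f::{finite,field} ^ 'n) set" and \<sigma> \<tau> \<mu> \<delta> q :: real and k :: nat
  assumes k: "k \<le> CARD('n)" and \<sigma>: "\<bar>\<sigma>\<bar> = 1" and pos: "0 < \<tau>" "0 < \<delta>"
    and q: "q = CARD('f)" and \<mu>: "\<mu> = card A * q ^ k / q ^ CARD('n)" "q \<le> \<mu>"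
  shows "card {w\<in>ext_lists k [] UNIV. 16 / (\<tau>\<^sup>2 * q * \<delta>) * q ^ CARD('n) < card (excess \<sigma> \<mu> (\<tau> * \<mu> / 2) A w)}
    \<le> \<delta> / 4 * card (ext_lists k [] (UNIV :: ('f ^ 'n) set))"
proof -
  have dim: "vec.dim (UNIV :: ('f ^ 'n) set) = CARD('n)" by (rule vec_dim_card)
  let ?T = "ext_lists k [] (UNIV :: ('f ^ 'n) set)" and ?N = "CARD('n)"
  let ?E = "excess \<sigma> \<mu> (\<tau> * \<mu> / 2) A"
  define B where "B = real (card {w\<in>?T. 16 / (\<tau>\<^sup>2 * q * \<delta>) * q ^ ?N < card (?E w)})"
  have q0: "0 < q" by (simp add: q)
  then have \<mu>0: "0 < \<mu>" using \<mu> by linarith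
  have "card (?E w) * (\<tau> * \<mu> / 2)^2 \<le> (\<Sum>z\<in>UNIV. (fibre A w z - \<mu>)^2)" for w
  proof (rule card_mult_le_sum)
    fix z assume "z \<in> ?E w"
    then have "\<tau> * \<mu> / 2 \<le> \<sigma> * (fibre A w z - \<mu>)" by (simp add: excess_def)
    also have "\<dots> \<le> \<bar>\<sigma> * (fibre A w z - \<mu>)\<bar>" by simp
    also have "\<dots> = \<bar>fibre A w z - \<mu>\<bar>" using \<sigma> by (simp add: abs_mult)
    finally show "(\<tau> * \<mu> / 2)^2 \<le> (fibre A w z - \<mu>)^2"
      using pos \<mu>0 power_mono[of "\<tau> * \<mu> / 2" "\<bar>fibre A w z - \<mu>\<bar>" 2] by simp
  qed auto
  then have "(\<Sum>w\<in>?T. card (?E w) * (\<tau> * \<mu> / 2)^2) \<le> (\<Sum>w\<in>?T. \<Sum>z\<in>UNIV. (fibre A w z - \<mu>)^2)"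
    by (rule sum_mono)
  also have "\<dots> \<le> card ?T * q ^ k * card A"
    using coset_fibre_variance[of UNIV k A 0, unfolded dim] k by (simp add: fibre_def \<mu>(1) q)
  also have "\<dots> = card ?T * (q ^ ?N * \<mu>)" using q0 by (simp add: \<mu>(1))
  finally have "(\<Sum>w\<in>?T. real (card (?E w))) * (\<tau> * \<mu> / 2)^2 \<le> card ?T * (q ^ ?N * \<mu>)"
    by (simp add: sum_distrib_right)
  moreover have "B * (16 / (\<tau>\<^sup>2 * q * \<delta>) * q ^ ?N) \<le>
      (\<Sum>w\<in>?T. real (card (?E w)))"
    unfolding B_def by (rule markov_card) auto
  ultimately have "B * (16 / (\<tau>\<^sup>2 * q * \<delta>) * q ^ ?N) * (\<tau> * \<mu> / 2)^2
      \<le> card ?T * (q ^ ?N * \<mu>)"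
    by (meson mult_right_mono order_trans zero_le_power2)
  also have "\<dots> = (card ?T * (q ^ ?N * \<mu>)) * 1" by simp
  also have "\<dots> \<le> (card ?T * (q ^ ?N * \<mu>)) * (\<mu> / q)"
    using \<mu>(2) \<mu>0 q0 by (intro mult_left_mono) (auto simp: field_simps)
  finally have "B * (4 / \<delta>) * (q ^ ?N * \<mu>^2 / q) \<le>
      card ?T * (q ^ ?N * \<mu>^2 / q)"
    using pos by (simp add: power2_eq_square field_simps)
  then have "B * (4 / \<delta>) \<le> card ?T"
    by (rule mult_right_le_imp_le) (use \<mu>0 q0 in simp)
  then have "B \<le> \<delta> / 4 * card ?T" using pos by (simp add: field_simps)
  then show ?thesis by (simp add: B_def)
qed

text \<open>Let m be the mean fibre over y + S and e = \<sigma> (m - \<mu>) > \<tau>\<mu>. Outside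
  the excess set a fibre differs from m by at least e/2, so Chebyshev bounds the average proportion
  of such points by 4m/e^2. In the upper tail m may be far above \<mu>, hence the deviation is
  measured by e: m \<le> \<mu> + e, and \<tau>^2 q times either summand is at most e^2, which gives
  8/(\<tau>^2 q). Markov with factor 2 doubles this.\<close>

lemma excess_flat:
  fixes S A :: "('f::{finite,field} ^ 'n) set" and \<sigma> \<tau> \<mu> q :: real and k :: nat
  assumes S: "vec.subspace S" "vec.dim S = k + 2" and \<sigma>: "\<bar>\<sigma>\<bar> = 1" and \<tau>: "0 < \<tau>" "\<tau> < 1"
    and q: "q = CARD('f)" and \<mu>: "q \<le> \<mu>"
    and bad: "\<sigma> * (card (A \<inter> (+) y ` S) - \<mu> * q\<^sup>2) > \<tau> * (\<mu> * q\<^sup>2)"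
  shows "2 * card {w\<in>ext_lists k [] S. 16 / (\<tau>\<^sup>2 * q) * q ^ (k + 2) < card ((+) y ` S - excess \<sigma> \<mu> (\<tau> * \<mu> / 2) A w)}
    \<le> card (ext_lists k [] S)"
proof -
  let ?T = "ext_lists k [] S" and ?W = "(+) y ` S"
  let ?E = "excess \<sigma> \<mu> (\<tau> * \<mu> / 2) A"
  define A' where "A' = A \<inter> ?W"
  define m where "m = card A' / q^2"
  define e where "e = \<sigma> * (m - \<mu>)"
  define B where "B = real (card {w\<in>?T. 16 / (\<tau>\<^sup>2 * q) * q ^ (k + 2) < card (?W - ?E w)})"
  have q0: "0 < q" by (simp add: q)
  then have \<mu>0: "0 < \<mu>" using \<mu> by linarith
  have cA: "card A' = m * q^2" using q0 by (simp add: m_def)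
  have "(\<tau> * \<mu>) * q^2 < e * q^2"
    using bad unfolding A'_def[symmetric] cA e_def by (simp add: algebra_simps)
  then have e: "\<tau> * \<mu> < e" using q0 by simp
  have e0: "0 < e" using e \<tau> \<mu>0 by (meson mult_pos_pos order_less_trans)
  have m_le: "m \<le> \<mu> + e"
  proof -
    have "m - \<mu> \<le> \<bar>\<sigma> * (m - \<mu>)\<bar>" using \<sigma> by (simp add: abs_mult)
    then show ?thesis using e0 by (simp add: e_def)
  qed
  have fib: "fibre A w z = card {a\<in>A'. a - z \<in> vec.span (set w)}" if "z \<in> ?W" "w \<in> ?T" for z w
  proof -
    have U: "vec.span (set w) \<subseteq> S" using that(2) S by (intro vec.span_minimal) (auto simp: ext_lists_def)
    have "a \<in> ?W" if "a - z \<in> vec.span (set w)" for a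
    proof -
      obtain s where s: "s \<in> S" "z = y + s" using \<open>z \<in> ?W\<close> by auto
      have "s + (a - z) \<in> S" using S s that U by (intro vec.subspace_add) auto
      then show ?thesis using s by (intro image_eqI[of _ _ "s + (a - z)"]) auto
    qed
    then have "{a\<in>A. a - z \<in> vec.span (set w)} = {a\<in>A'. a - z \<in> vec.span (set w)}" by (auto simp: A'_def)
    then show ?thesis by (simp add: fibre_def)
  qed
  have mean: "card A' * q ^ k / q ^ vec.dim S = m"
    using q0 by (simp add: S m_def power_add power2_eq_square)
  have "(\<Sum>w\<in>?T. card (?W - ?E w) * (e / 2)^2) \<le> (\<Sum>w\<in>?T. \<Sum>z\<in>?W. (fibre A w z - m)^2)"
  proof (intro sum_mono card_mult_le_sum)
    fix w z assume "z \<in> ?W - ?E w"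
    then have "\<sigma> * (fibre A w z - \<mu>) \<le> \<tau> * \<mu> / 2" by (simp add: excess_def)
    moreover have "\<sigma> * (m - fibre A w z) = e - \<sigma> * (fibre A w z - \<mu>)"
      by (simp add: e_def algebra_simps)
    ultimately have "e / 2 \<le> \<sigma> * (m - fibre A w z)" using e by linarith
    also have "\<dots> \<le> \<bar>\<sigma> * (m - fibre A w z)\<bar>" by simp
    also have "\<dots> = \<bar>fibre A w z - m\<bar>" using \<sigma> by (simp add: abs_mult abs_minus_commute)
    finally show "(e / 2)^2 \<le> (fibre A w z - m)^2"
      using e0 power_mono[of "e / 2" "\<bar>fibre A w z - m\<bar>" 2] by simp
  qed auto
  also have "\<dots> = (\<Sum>w\<in>?T. \<Sum>z\<in>?W. (card {a\<in>A'. a - z \<in> vec.span (set w)} - card A' * q ^ k / q ^ vec.dim S)^2)"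
    unfolding mean by (intro sum.cong refl) (simp add: fib)
  also have "\<dots> \<le> card ?T * q ^ k * card A'"
    unfolding q by (rule coset_fibre_variance) (use S in \<open>auto simp: A'_def\<close>)
  also have "\<dots> = card ?T * (q ^ (k + 2) * m)" unfolding cA by (simp add: power_add power2_eq_square)
  finally have "(\<Sum>w\<in>?T. real (card (?W - ?E w))) * (e / 2)^2 \<le> card ?T * (q ^ (k + 2) * m)"
    by (simp add: sum_distrib_right)
  moreover have "B * (16 / (\<tau>\<^sup>2 * q) * q ^ (k + 2)) \<le>
      (\<Sum>w\<in>?T. real (card (?W - ?E w)))"
    unfolding B_def by (rule markov_card) auto
  ultimately have "B * (16 / (\<tau>\<^sup>2 * q) * q ^ (k + 2)) * (e / 2)^2
      \<le> card ?T * (q ^ (k + 2) * m)"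
    by (meson mult_right_mono order_trans zero_le_power2)
  then have "q ^ (k + 2) * (B * (4 * e^2 / (\<tau>\<^sup>2 * q)))
      \<le> q ^ (k + 2) * (card ?T * m)"
    using \<tau> q0 by (simp add: power_divide field_simps)
  then have *: "B * (4 * e^2 / (\<tau>\<^sup>2 * q)) \<le> card ?T * m"
    using q0 by (subst (asm) mult_le_cancel_left_pos) auto
  have "m \<le> 2 * e^2 / (\<tau>\<^sup>2 * q)"
  proof -
    have "\<tau>\<^sup>2 * q * \<mu> \<le> e^2"
    proof -
      have "\<tau>\<^sup>2 * q * \<mu> \<le> \<tau>\<^sup>2 * \<mu> * \<mu>" using \<mu> \<mu>0 \<tau> by (intro mult_right_mono mult_left_mono) auto
      also have "\<dots> = (\<tau> * \<mu>)^2" by (simp add: power2_eq_square)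
      also have "\<dots> \<le> e^2" using e \<tau> \<mu>0 by (intro power_mono) auto
      finally show ?thesis .
    qed
    moreover have "\<tau>\<^sup>2 * q * e \<le> e^2"
    proof -
      have "\<tau>\<^sup>2 * q \<le> \<tau> * \<mu>"
        using \<tau> \<mu> q0 by (intro mult_mono) (auto simp: power2_eq_square mult_left_le)
      then have "\<tau>\<^sup>2 * q * e \<le> e * e" using e e0 by (intro mult_right_mono) auto
      then show ?thesis by (simp add: power2_eq_square)
    qed
    moreover have "m * (\<tau>\<^sup>2 * q) \<le> (\<mu> + e) * (\<tau>\<^sup>2 * q)" using m_le q0 by (intro mult_right_mono) auto
    ultimately have "m * (\<tau>\<^sup>2 * q) \<le> 2 * e^2" by (simp add: algebra_simps)
    then show ?thesis using \<tau> q0 by (simp add: field_simps)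
  qed
  then have "card ?T * m \<le> card ?T * (2 * e^2 / (\<tau>\<^sup>2 * q))" by (intro mult_left_mono) auto
  with * have "(2 * e^2 / (\<tau>\<^sup>2 * q)) * (2 * B) \<le>
      (2 * e^2 / (\<tau>\<^sup>2 * q)) * card ?T" by (simp add: mult_ac)
  moreover have "0 < 2 * e^2 / (\<tau>\<^sup>2 * q)" using e0 \<tau> q0 by simp
  ultimately have "2 * B \<le> card ?T"
    by (subst (asm) mult_le_cancel_left_pos) auto
  then show ?thesis unfolding B_def by linarith
qed

text \<open>Fibre counts are constant on cosets of the span of w, so the excess set is a union of
  such cosets. Its complement in y + S contains a copy of N times this span, and dividing by the
  size of the span bounds N.\<close>

lemma plane_in_excess:
  fixes S A :: "('f::{finite,field} ^ 'n) set"
  assumes ind: "ind_list ([u, v] @ w)" and S: "S = vec.span (set ([u, v] @ w))"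
    and card: "card ((+) y ` S - excess \<sigma> \<mu> t A w) \<le> \<gamma> * real CARD('f) ^ (length w + 2)"
  shows "(1 - \<gamma>) * real CARD('f) ^ 2 \<le> card {(a, b). y + a *s u + b *s v \<in> excess \<sigma> \<mu> t A w}"
proof -
  let ?E = "excess \<sigma> \<mu> t A w" and ?U = "vec.span (set w)" and ?q = "real CARD('f)"
  define N where "N = {(a, b). y + a *s u + b *s v \<notin> ?E}"
  define F where "F = (\<lambda>((a, b), s). y + a *s u + b *s v + s)"
  have u: "u \<notin> vec.span (insert v (set w))" and v: "v \<notin> ?U" and w: "ind_list w"
    using ind by (auto simp: ind_list_Cons)
  have shift: "z + s \<in> ?E \<longleftrightarrow> z \<in> ?E" if "s \<in> ?U" for z s
  proof -
    have "a - (z + s) \<in> ?U \<longleftrightarrow> a - z \<in> ?U" for a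
      using vec.span_diff[OF _ that, of "a - z"] vec.span_add[OF _ that, of "a - (z + s)"]
      by (auto simp: algebra_simps)
    then show ?thesis by (simp add: excess_def fibre_def)
  qed
  have "inj_on F (N \<times> ?U)"
  proof (rule inj_onI)
    fix p p' assume p: "p \<in> N \<times> ?U" "p' \<in> N \<times> ?U" "F p = F p'"
    obtain a b s a' b' s' where pp: "p = ((a, b), s)" "p' = ((a', b'), s')" by (metis prod.exhaust)
    then have s: "s \<in> ?U" "s' \<in> ?U" and eq: "F ((a, b), s) = F ((a', b'), s')" using p by auto
    then have d: "(a - a') *s u = (b' - b) *s v + (s' - s)"
      by (simp add: F_def vec.scale_left_diff_distrib algebra_simps)
    have solve: "x \<in> vec.span B" if "k *s x \<in> vec.span B" "k \<noteq> 0" for k :: 'f and x :: "'f ^ 'n" and B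
      using vec.span_scale[OF that(1), of "inverse k"] that(2) by (simp add: vector_smult_assoc)
    have "s' - s \<in> ?U" using s by (intro vec.span_diff)
    have "a = a'"
    proof (rule ccontr)
      assume "a \<noteq> a'"
      have "s' - s \<in> vec.span (insert v (set w))"
        using \<open>s' - s \<in> ?U\<close> vec.span_mono[of "set w" "insert v (set w)"] by blast
      then have "(a - a') *s u \<in> vec.span (insert v (set w))"
        unfolding d by (intro vec.span_add vec.span_scale) (auto intro: vec.span_base)
      from solve[OF this] u \<open>a \<noteq> a'\<close> show False by (metis right_minus_eq)
    qed
    then have d': "(b - b') *s v = s' - s" using d by (simp add: vec.scale_left_diff_distrib algebra_simps)
    have "b = b'"
    proof (rule ccontr)
      assume "b \<noteq> b'"
      have "(b - b') *s v \<in> ?U" unfolding d' by fact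
      from solve[OF this] v \<open>b \<noteq> b'\<close> show False by (metis right_minus_eq)
    qed
    with \<open>a = a'\<close> d' \<open>b = b'\<close> show "p = p'" by (simp add: pp)
  qed
  then have "card (N \<times> ?U) = card (F ` (N \<times> ?U))" by (simp add: card_image)
  also have "F ` (N \<times> ?U) \<subseteq> (+) y ` S - ?E"
  proof clarify
    fix a b s assume "(a, b) \<in> N" "s \<in> ?U"
    then have "F ((a, b), s) \<notin> ?E" by (simp add: F_def N_def shift)
    moreover have "s \<in> S"
      using \<open>s \<in> ?U\<close> vec.span_mono[of "set w" "set ([u, v] @ w)"] unfolding S by auto
    then have "a *s u + b *s v + s \<in> S"
      unfolding S by (intro vec.span_add vec.span_scale) (auto intro: vec.span_base)
    then have "F ((a, b), s) \<in> (+) y ` S"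
      by (intro image_eqI[of _ _ "a *s u + b *s v + s"]) (auto simp: F_def add.assoc)
    ultimately show "F ((a, b), s) \<in> (+) y ` S - ?E" by simp
  qed
  then have "card (F ` (N \<times> ?U)) \<le> card ((+) y ` S - ?E)" by (intro card_mono) auto
  finally have "card N * card ?U \<le> card ((+) y ` S - ?E)" by (simp only: card_cartesian_product)
  then have "real (card N * card ?U) \<le> \<gamma> * ?q ^ (length w + 2)"
    using card by (meson of_nat_mono order_trans)
  then have "real (card N) * ?q ^ length w \<le> (\<gamma> * ?q ^ 2) * ?q ^ length w"
    by (simp add: card_span_ind_list[OF w] power_add mult_ac power2_eq_square)
  then have N: "real (card N) \<le> \<gamma> * ?q ^ 2" by simp
  have "{(a, b). y + a *s u + b *s v \<in> ?E} = UNIV - N" by (auto simp: N_def)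
  then have "card {(a, b). y + a *s u + b *s v \<in> ?E} = CARD('f \<times> 'f) - card N"
    by (simp add: card_Diff_subset)
  then have "real CARD('f \<times> 'f) - card N \<le> card {(a, b). y + a *s u + b *s v \<in> ?E}" by linarith
  then show ?thesis using N by (simp add: algebra_simps power2_eq_square)
qed

section \<open>Double counting of flags\<close>

lemma span_eq_subspace_of_length:
  fixes S :: "('f::{finite,field} ^ 'n) set"
  assumes "vec.subspace S" "ind_list xs" "set xs \<subseteq> S" "length xs = vec.dim S"
  shows "vec.span (set xs) = S"
proof -
  have "vec.span (set xs) \<subseteq> S" using assms by (intro vec.span_minimal)
  moreover have "card (vec.span (set xs)) = card S"
    using card_span_ind_list[OF assms(2)] card_subspace[OF assms(1)] assms(4) by simp
  ultimately show ?thesis by (intro card_subset_eq) auto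
qed

lemma card_ext_two:
  fixes S :: "('f::{finite,field} ^ 'n) set"
  assumes "vec.subspace S" "w \<in> ext_lists k [] S"
  shows "card (ext_lists 2 w S) = (\<Prod>i<2. CARD('f) ^ vec.dim S - CARD('f) ^ (k + i))"
  using assms by (subst card_ext_lists) (auto simp: ext_lists_def)

text \<open>The number of pairs \<open>(w, zs)\<close> splitting an ordered basis of a subspace does not depend on
  the subspace, so a property of subspaces has the same density among flags \<open>(w, zs)\<close>.\<close>

lemma flags_with_span:
  fixes S :: "('f::{finite,field} ^ 'n) set"
  assumes "vec.subspace S" "vec.dim S = k + 2"
  shows "{(w, zs). w \<in> ext_lists k [] UNIV \<and> zs \<in> ext_lists 2 w UNIV \<and> vec.span (set (zs @ w)) = S} =
    Sigma (ext_lists k [] S) (\<lambda>w. ext_lists 2 w S)"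
proof (intro equalityI subsetI)
  fix p assume "p \<in> {(w, zs). w \<in> ext_lists k [] UNIV \<and> zs \<in> ext_lists 2 w UNIV \<and> vec.span (set (zs @ w)) = S}"
  moreover have "set (zs @ w) \<subseteq> vec.span (set (zs @ w))" for zs w :: "('f ^ 'n) list"
    by (auto intro: vec.span_base)
  ultimately show "p \<in> Sigma (ext_lists k [] S) (\<lambda>w. ext_lists 2 w S)"
    by (fastforce simp: ext_lists_def)
next
  fix p assume "p \<in> Sigma (ext_lists k [] S) (\<lambda>w. ext_lists 2 w S)"
  then obtain w zs where p: "p = (w, zs)" "w \<in> ext_lists k [] S" "zs \<in> ext_lists 2 w S" by auto
  then have "vec.span (set (zs @ w)) = S"
    using assms by (intro span_eq_subspace_of_length) (auto simp: ext_lists_def)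
  with p show "p \<in> {(w, zs). w \<in> ext_lists k [] UNIV \<and> zs \<in> ext_lists 2 w UNIV \<and> vec.span (set (zs @ w)) = S}"
    by (auto simp: ext_lists_def)
qed

text \<open>If a proportion \<delta> of the S were unbalanced, \<open>excess_flat\<close> would make
  at least \<delta>/2 of all flags (w, zs) good. Discarding the w with a dense excess set, at most a
  proportion \<delta>/4, leaves one w for which at least \<delta>/4 of the pairs zs are good. For
  this w all the planes lie almost inside the same set \<open>E w\<close>, whose density is at most
  16/(\<tau>^2 q \<delta>) < 1/4, against the Kakeya bound.\<close>

theorem random_subspace_balanced:
  fixes A :: "('f::{finite,field} ^ 'n) set" and \<sigma> \<tau> \<delta> q M :: real and r :: nat
  assumes \<sigma>: "\<bar>\<sigma>\<bar> = 1" and \<tau>: "0 < \<tau>" "\<tau> < 1" and \<delta>: "0 < \<delta>" "\<delta> < 1"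
    and q: "q = CARD('f)" "q > 64 * CARD('n) / (\<tau> * \<delta>)\<^sup>2"
    and r: "2 \<le> r" "r \<le> CARD('n)"
    and M: "M = card A * q ^ r / q ^ CARD('n)" "q ^ 3 \<le> M"
  shows "card {S. vec.subspace S \<and> vec.dim S = r \<and> (\<exists>y. \<sigma> * (card (A \<inter> (+) y ` S) - M) > \<tau> * M)}
    < \<delta> * card {S :: ('f ^ 'n) set. vec.subspace S \<and> vec.dim S = r}"
proof (rule ccontr)
  define G where "G = {S :: ('f ^ 'n) set. vec.subspace S \<and> vec.dim S = r}"
  define bad where "bad S y \<longleftrightarrow> \<sigma> * (card (A \<inter> (+) y ` S) - M) > \<tau> * M" for S y
  define Bad where "Bad = {S\<in>G. \<exists>y. bad S y}"
  assume "\<not> ?thesis"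
  then have Bad: "\<delta> * card G \<le> card Bad"
    by (simp add: Bad_def G_def bad_def conj_assoc)
  \<comment> \<open>Any unbalanced translate will do, since the Kakeya theorem lets the base point
    of a plane depend arbitrarily on its direction.\<close>
  define Y where "Y S = (SOME y. bad S y)" for S
  have Y: "bad S (Y S)" if "S \<in> Bad" for S
    using that unfolding Y_def Bad_def by (auto intro: someI)
  let ?n = "CARD('n)"
  have n0: "0 < ?n" by simp
  then have n1: "1 \<le> real ?n" by linarith
  have \<tau>\<delta>: "0 < \<tau> * \<delta>" using \<tau> \<delta> by simp
  have q\<tau>\<delta>: "64 * real ?n < q * (\<tau> * \<delta>)\<^sup>2"
    using q(2) zero_less_power[OF \<tau>\<delta>, of 2] by (simp only: pos_divide_less_eq)
  have q0: "0 < q" by (simp add: q)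
  have sq1: "(\<tau> * \<delta>)\<^sup>2 \<le> \<tau>\<^sup>2 * \<delta>" "\<tau>\<^sup>2 * \<delta> \<le> \<tau>\<^sup>2" "\<tau>\<^sup>2 * \<delta> \<le> \<delta>" "\<tau>\<^sup>2 * \<delta> \<le> 1"
  proof -
    have t2: "\<tau>\<^sup>2 \<le> 1" using \<tau> by (simp add: power_le_one)
    show "(\<tau> * \<delta>)\<^sup>2 \<le> \<tau>\<^sup>2 * \<delta>"
      using \<delta> \<tau> by (simp add: power_mult_distrib power2_eq_square[of \<delta>] mult_left_le)
    show "\<tau>\<^sup>2 * \<delta> \<le> \<tau>\<^sup>2" using \<delta> by (simp add: mult_left_le)
    show *: "\<tau>\<^sup>2 * \<delta> \<le> \<delta>" using \<delta> t2 by (simp add: mult_left_le_one_le)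
    then show "\<tau>\<^sup>2 * \<delta> \<le> 1" using \<delta> by linarith
  qed
  have q1: "64 * real ?n < q * (\<tau>\<^sup>2 * \<delta>)"
    using q\<tau>\<delta> mult_left_mono[OF sq1(1), of q] q0 by linarith
  have q2: "64 * real ?n < q * \<tau>\<^sup>2" "64 * real ?n < q * \<delta>" "64 * real ?n < q"
    using q1 mult_left_mono[OF sq1(2), of q] mult_left_mono[OF sq1(3), of q] mult_left_mono[OF sq1(4), of q] q0
    by linarith+
  define k where "k = r - 2"
  have rk: "r = k + 2" using r by (simp add: k_def)
  define \<mu> where "\<mu> = card A * q ^ k / q ^ ?n"
  have M\<mu>: "M = \<mu> * q\<^sup>2" by (simp add: M(1) \<mu>_def rk power_add power2_eq_square)
  have \<mu>q: "q \<le> \<mu>"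
  proof -
    have "q * q\<^sup>2 \<le> \<mu> * q\<^sup>2" using M(2) M\<mu> by (simp add: power2_eq_square power3_eq_cube)
    then show ?thesis using q0 by simp
  qed
  define \<gamma> where "\<gamma> = 16 / (\<tau>\<^sup>2 * q)"
  define \<epsilon> where "\<epsilon> = 16 / (\<tau>\<^sup>2 * q * \<delta>)"
  define E where "E = excess \<sigma> \<mu> (\<tau> * \<mu> / 2) A"
  define T where "T = ext_lists k [] (UNIV :: ('f ^ 'n) set)"
  define X where "X = (\<Prod>i<2. CARD('f) ^ ?n - CARD('f) ^ (k + i))"
  define t where "t = (\<Prod>i<k. CARD('f) ^ r - CARD('f) ^ i)"
  define Xr where "Xr = (\<Prod>i<2. CARD('f) ^ r - CARD('f) ^ (k + i))"
  have dimU: "vec.dim (UNIV :: ('f ^ 'n) set) = ?n" by (rule vec_dim_card)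
  have cX: "card (ext_lists 2 w UNIV) = X" if "w \<in> T" for w
    using card_ext_two[OF vec.subspace_UNIV, of w k] that by (simp add: T_def X_def dimU[simplified])
  have ct: "card (ext_lists k [] S) = t" if "S \<in> G" for S
    using that by (subst card_ext_lists) (auto simp: t_def G_def)
  have cXr: "card (ext_lists 2 w S) = Xr" if "S \<in> G" "w \<in> ext_lists k [] S" for w S
    using card_ext_two[of S w k] that by (simp add: G_def Xr_def)
  define sp where "sp p = vec.span (set (snd p @ fst p))" for p :: "('f ^ 'n) list \<times> ('f ^ 'n) list"
  define \<Omega> where "\<Omega> = Sigma T (\<lambda>w. ext_lists 2 w UNIV)"
  have fin\<Omega>: "finite \<Omega>" by (simp add: \<Omega>_def T_def)
  have fib: "{p\<in>\<Omega>. sp p = S} = Sigma (ext_lists k [] S) (\<lambda>w. ext_lists 2 w S)" if "S \<in> G" for S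
    using flags_with_span[of S k] that by (auto simp: \<Omega>_def T_def sp_def G_def rk)
  have sp_G: "sp p \<in> G" if "p \<in> \<Omega>" for p
    using that length_ind_list_eq_dim[of "snd p @ fst p"]
    by (auto simp: \<Omega>_def T_def sp_def G_def rk ext_lists_def)
  have "card \<Omega> = (\<Sum>S\<in>G. card {p\<in>\<Omega>. sp p = S})"
    using sum.group[of \<Omega> G sp "\<lambda>_. 1 :: nat"] fin\<Omega> sp_G by (simp add: image_subset_iff)
  also have "\<dots> = (\<Sum>S\<in>G. t * Xr)"
    by (intro sum.cong refl) (simp add: fib cXr ct)
  finally have c\<Omega>1: "card \<Omega> = card G * (t * Xr)" by simp
  have c\<Omega>2: "card \<Omega> = card T * X" by (simp add: \<Omega>_def T_def cX[unfolded T_def])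
  define good where "good S w \<longleftrightarrow> card ((+) (Y S) ` S - E w) \<le> \<gamma> * q ^ r" for S w
  define Q where "Q = {p\<in>\<Omega>. sp p \<in> Bad \<and> good (sp p) (fst p)}"
  have half: "t \<le> 2 * card {w\<in>ext_lists k [] S. good S w}" if S: "S \<in> Bad" for S
  proof -
    have "2 * card {w\<in>ext_lists k [] S. \<gamma> * q ^ (k + 2) < card ((+) (Y S) ` S - E w)} \<le> card (ext_lists k [] S)"
      unfolding \<gamma>_def E_def
      by (rule excess_flat) (use S Y[OF S] \<sigma> \<tau> q(1) \<mu>q in \<open>auto simp: Bad_def G_def rk bad_def M\<mu>\<close>)
    moreover have "{w\<in>ext_lists k [] S. \<gamma> * q ^ (k + 2) < card ((+) (Y S) ` S - E w)} =
        ext_lists k [] S - {w\<in>ext_lists k [] S. good S w}"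
      by (auto simp: good_def rk)
    moreover have "card (ext_lists k [] S - {w\<in>ext_lists k [] S. good S w}) =
        t - card {w\<in>ext_lists k [] S. good S w}"
      using S by (subst card_Diff_subset) (auto simp: ct Bad_def)
    ultimately show ?thesis using S ct[of S] by (auto simp: Bad_def)
  qed
  have cQ: "\<delta> / 2 * card \<Omega> \<le> card Q"
  proof -
    have "card Q = (\<Sum>S\<in>Bad. card {p\<in>Q. sp p = S})"
      using sum.group[of Q Bad sp "\<lambda>_. 1 :: nat"] fin\<Omega> by (simp add: image_subset_iff Q_def)
    also have "\<dots> = (\<Sum>S\<in>Bad. card {w\<in>ext_lists k [] S. good S w} * Xr)"
    proof (intro sum.cong refl)
      fix S assume S: "S \<in> Bad"
      then have SG: "S \<in> G" by (simp add: Bad_def)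
      have "{p\<in>Q. sp p = S} = {p\<in>{p\<in>\<Omega>. sp p = S}. good S (fst p)}" using S by (auto simp: Q_def)
      also have "\<dots> = Sigma {w\<in>ext_lists k [] S. good S w} (\<lambda>w. ext_lists 2 w S)"
        unfolding fib[OF SG] by auto
      finally show "card {p\<in>Q. sp p = S} = card {w\<in>ext_lists k [] S. good S w} * Xr"
        by (simp add: cXr[OF SG])
    qed
    finally have "2 * card Q = (\<Sum>S\<in>Bad. 2 * card {w\<in>ext_lists k [] S. good S w} * Xr)"
      by (simp add: sum_distrib_left mult.assoc)
    also have "\<dots> \<ge> (\<Sum>S\<in>Bad. t * Xr)" by (intro sum_mono mult_right_mono half) auto
    finally have "card Bad * (t * Xr) \<le> 2 * card Q" by simp
    then have "real (card Bad) * real (t * Xr) \<le> 2 * card Q"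
      by (metis of_nat_le_iff of_nat_mult of_nat_numeral)
    moreover have "\<delta> * card G * real (t * Xr) \<le> real (card Bad) * real (t * Xr)"
      using Bad by (intro mult_right_mono) auto
    ultimately show ?thesis by (simp add: c\<Omega>1)
  qed
  define Tb where "Tb = {w\<in>T. \<epsilon> * q ^ ?n < card (E w)}"
  have cTb: "card Tb \<le> \<delta> / 4 * card T"
    unfolding Tb_def \<epsilon>_def T_def E_def
    by (rule excess_density) (use r \<sigma> \<tau> \<delta> q(1) \<mu>q in \<open>auto simp: rk \<mu>_def\<close>)
  define Z where "Z w = {zs. (w, zs) \<in> Q}" for w
  have ZX: "Z w \<subseteq> ext_lists 2 w UNIV" for w by (auto simp: Z_def Q_def \<Omega>_def)
  have T0: "0 < card T"
    unfolding T_def by (rule ext_lists_nonempty) (use r in \<open>simp_all add: dimU[simplified] rk\<close>)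
  have finT: "finite T" by (simp add: T_def)
  have "Q \<subseteq> Sigma T Z" by (auto simp: Q_def Z_def \<Omega>_def)
  then have "card Q \<le> card (Sigma T Z)"
    by (intro card_mono finite_SigmaI finT) (rule finite_subset[OF ZX], simp)
  also have "\<dots> = (\<Sum>w\<in>T. card (Z w))"
    using finite_subset[OF ZX] finT by (intro card_SigmaI) auto
  also have "\<dots> = (\<Sum>w\<in>Tb. card (Z w)) + (\<Sum>w\<in>T - Tb. card (Z w))"
    using finT by (subst sum.subset_diff[of Tb T]) (auto simp: Tb_def)
  also have "(\<Sum>w\<in>Tb. card (Z w)) \<le> (\<Sum>w\<in>Tb. X)"
  proof (intro sum_mono)
    fix w assume "w \<in> Tb"
    then show "card (Z w) \<le> X" using cX[of w] card_mono[OF _ ZX[of w]] by (simp add: Tb_def)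
  qed
  finally have "card Q \<le> card Tb * X + (\<Sum>w\<in>T - Tb. card (Z w))" by simp
  then have "real (card Q) \<le> real (card Tb) * X + (\<Sum>w\<in>T - Tb. real (card (Z w)))"
    by (metis of_nat_add of_nat_le_iff of_nat_mult of_nat_sum)
  moreover have "real (card Tb) * X \<le> \<delta> / 4 * card T * X"
    using cTb by (intro mult_right_mono) auto
  moreover have "\<delta> / 2 * (real (card T) * X) \<le> card Q" using cQ by (simp add: c\<Omega>2)
  ultimately have sum_ge: "card T * (\<delta> / 4 * X) \<le> (\<Sum>w\<in>T - Tb. real (card (Z w)))"
    by (simp add: algebra_simps)
  \<comment> \<open>As q \<ge> 64, each factor of X is at least (63/64) q^n. The proportion
    \<delta>/4 of independent pairs thus becomes \<alpha> = \<delta>/8 of all pairs.\<close>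
  have X_ge: "q ^ (2 * ?n) / 2 \<le> X"
  proof -
    have kn: "k + 2 \<le> ?n" using r rk by simp
    have q64: "64 \<le> q" using q2(3) n1 by linarith
    have diff_le_real_diff: "real a - real b \<le> real (a - b)" for a b :: nat by linarith
    have le: "(63 / 64) * q ^ ?n \<le> real (CARD('f) ^ ?n - CARD('f) ^ (k + i))" if "i < 2" for i
    proof -
      have "CARD('f) ^ (k + i + 1) \<le> CARD('f) ^ ?n" using that kn by (intro power_increasing) auto
      then have "real (CARD('f) ^ (k + i + 1)) \<le> real (CARD('f) ^ ?n)" by (rule of_nat_mono)
      then have "q ^ (k + i) * q \<le> q ^ ?n" by (simp add: q(1) mult.commute)
      moreover have "q ^ (k + i) * 64 \<le> q ^ (k + i) * q" using q64 q0 by (intro mult_left_mono) auto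
      ultimately have "q ^ (k + i) * 64 \<le> q ^ ?n" by linarith
      moreover have "real (CARD('f) ^ ?n - CARD('f) ^ (k + i)) \<ge> q ^ ?n - q ^ (k + i)"
        using diff_le_real_diff[of "CARD('f) ^ ?n" "CARD('f) ^ (k + i)"] by (simp add: q(1))
      ultimately show ?thesis by simp
    qed
    have "q ^ (2 * ?n) / 2 \<le> ((63 / 64) * q ^ ?n) * ((63 / 64) * q ^ ?n)"
      using q0 by (simp add: mult_2 power_add)
    also have "\<dots> \<le> real (CARD('f) ^ ?n - CARD('f) ^ (k + 0)) * real (CARD('f) ^ ?n - CARD('f) ^ (k + 1))"
      using q0 by (intro mult_mono le) auto
    also have "\<dots> = X" by (simp add: X_def numeral_2_eq_2)
    finally show ?thesis .
  qed
  have qX: "0 < real X" using X_ge q0 by (smt (verit) half_gt_zero zero_less_power)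
  have "\<exists>w\<in>T - Tb. \<delta> / 4 * X \<le> card (Z w)"
  proof (rule ccontr)
    assume "\<not> ?thesis"
    then have small: "real (card (Z w)) < \<delta> / 4 * X" if "w \<in> T - Tb" for w using that by force
    have pos: "0 < card T * (\<delta> / 4 * X)" using T0 \<delta> qX by simp
    show False
    proof (cases "T - Tb = {}")
      case True
      then have "(\<Sum>w\<in>T - Tb. real (card (Z w))) = 0" by (simp only: sum.empty)
      then show ?thesis using sum_ge pos by linarith
    next
      case False
      then have "(\<Sum>w\<in>T - Tb. real (card (Z w))) < (\<Sum>w\<in>T - Tb. \<delta> / 4 * X)"
        using finT small by (intro sum_strict_mono) auto
      also have "\<dots> = card (T - Tb) * (\<delta> / 4 * X)" by simp
      also have "\<dots> \<le> card T * (\<delta> / 4 * X)"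
        using finT \<delta> by (intro mult_right_mono of_nat_mono card_mono) auto
      finally show ?thesis using sum_ge by linarith
    qed
  qed
  then obtain w where w: "w \<in> T - Tb" "\<delta> / 4 * X \<le> card (Z w)" by blast
  define D where "D = {(u, v). [u, v] \<in> Z w}"
  have "Z w = (\<lambda>(u, v). [u, v]) ` D"
  proof (intro equalityI subsetI)
    fix zs assume zs: "zs \<in> Z w"
    then have "length zs = 2" using ZX[of w] by (auto simp: ext_lists_def)
    then obtain u v where "zs = [u, v]" by (auto simp: numeral_2_eq_2 length_Suc_conv)
    then show "zs \<in> (\<lambda>(u, v). [u, v]) ` D" using zs by (auto simp: D_def)
  qed (auto simp: D_def)
  moreover have "inj_on (\<lambda>(u, v). [u, v]) D" by (auto simp: inj_on_def)
  ultimately have "card (Z w) = card D" by (simp add: card_image)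
  have "real CARD('f) ^ ?n / 4 \<le> card (E w)"
  proof (rule robust_kakeya_planes[where \<alpha> = "\<delta> / 8" and \<gamma> = \<gamma> and D = D])
    show "64 * ?n \<le> CARD('f)" using q2(3) by (simp add: q(1))
    show "\<gamma> \<le> 1 / (4 * real ?n)" using q2(1) q0 \<tau> n1 by (simp add: \<gamma>_def field_simps)
    have "\<delta> / 8 * q ^ (2 * ?n) \<le> \<delta> / 4 * X" using X_ge \<delta> by simp
    then show "\<delta> / 8 * real CARD('f) ^ (2 * ?n) \<le> card D"
      using w(2) \<open>card (Z w) = card D\<close> by (simp add: q(1))
    show "8 * real ?n \<le> \<delta> / 8 * real CARD('f)" using q2(2) by (simp add: q(1) mult.commute)
    fix u v assume "(u, v) \<in> D"
    then have Q: "(w, [u, v]) \<in> Q" by (simp add: D_def Z_def)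
    let ?S = "vec.span (set ([u, v] @ w))"
    have "length w = k" "ind_list ([u, v] @ w)" using Q by (auto simp: Q_def \<Omega>_def T_def ext_lists_def)
    moreover have "good ?S w" using Q by (simp add: Q_def sp_def)
    ultimately have "(1 - \<gamma>) * real CARD('f) ^ 2 \<le>
        card {(x, y). Y ?S + x *s u + y *s v \<in> excess \<sigma> \<mu> (\<tau> * \<mu> / 2) A w}"
      by (intro plane_in_excess[OF _ refl]) (auto simp: good_def E_def q(1) rk)
    then show "\<exists>a. (1 - \<gamma>) * real (CARD('f)) ^ 2 \<le> card {(x, y). a + x *s u + y *s v \<in> E w}"
      unfolding E_def by blast
  qed
  moreover have "card (E w) \<le> \<epsilon> * q ^ ?n" using w(1) by (simp add: Tb_def not_less)
  ultimately have "1 / 4 * q ^ ?n \<le> \<epsilon> * q ^ ?n" unfolding q(1) by linarith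
  then have "1 / 4 \<le> \<epsilon>" by (rule mult_right_le_imp_le) (use q0 in simp)
  moreover have "\<epsilon> < 1 / 4"
  proof -
    have "64 < q * (\<tau>\<^sup>2 * \<delta>)" using q1 n1 by linarith
    then show ?thesis using \<tau> \<delta> q0 by (simp add: \<epsilon>_def field_simps)
  qed
  ultimately show False by simp
qed

section \<open>Lattice points and volume\<close>

lemma of_int_vec_nth [simp]: "of_int_vec z $ i = of_int (z $ i)"
  by (simp add: of_int_vec_def)

lemma of_int_vec_add: "of_int_vec (y + z) = of_int_vec y + of_int_vec z"
  by (simp add: vec_eq_iff)

lemma of_int_vec_diff: "of_int_vec (y - z) = of_int_vec y - of_int_vec z"
  by (simp add: vec_eq_iff)

lemma of_int_vec_real_eq_iff [simp]: "(of_int_vec y :: real ^ 'n) = of_int_vec z \<longleftrightarrow> y = z"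
  by (simp add: vec_eq_iff)

text \<open>Half-open, so that the integer translates tile space exactly and every point has a
  unique integer part.\<close>

definition unit_cell :: "(real ^ 'n) set" where
  "unit_cell = {x. \<forall>i. 0 \<le> x $ i \<and> x $ i < 1}"

lemma box_subset_unit_cell: "box 0 (1 :: real ^ 'n) \<subseteq> unit_cell"
  by (auto simp: unit_cell_def mem_box_cart less_imp_le)

lemma unit_cell_subset_cbox: "unit_cell \<subseteq> cbox 0 (1 :: real ^ 'n)"
  by (auto simp: unit_cell_def mem_box_cart less_imp_le)

lemma unit_cell_lmeasurable [simp]: "(unit_cell :: (real ^ 'n) set) \<in> lmeasurable"
proof (rule measurable_convex)
  show "bounded (unit_cell :: (real ^ 'n) set)"
    using unit_cell_subset_cbox bounded_cbox bounded_subset by blast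
  show "convex (unit_cell :: (real ^ 'n) set)"
    by (rule convexI) (auto simp: unit_cell_def intro: convex_bound_lt)
qed

lemma measure_unit_cell [simp]: "measure lebesgue (unit_cell :: (real ^ 'n) set) = 1"
proof (rule antisym)
  have 1: "measure lebesgue (box 0 (1 :: real ^ 'n)) = 1" "measure lebesgue (cbox 0 (1 :: real ^ 'n)) = 1"
  proof -
    have "(1 :: real ^ 'n) \<bullet> b = 1" if "b \<in> Basis" for b
      using that by (auto simp: Basis_vec_def inner_axis)
    then show "measure lebesgue (box 0 (1 :: real ^ 'n)) = 1" "measure lebesgue (cbox 0 (1 :: real ^ 'n)) = 1"
      by (simp_all add: measure_lborel_box_eq measure_lborel_cbox_eq)
  qed
  show "measure lebesgue (unit_cell :: (real ^ 'n) set) \<le> 1"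
    using measure_mono_fmeasurable[of "unit_cell :: (real ^ 'n) set" "cbox 0 1" lebesgue] 1 by (simp add: fmeasurableD unit_cell_subset_cbox)
  show "1 \<le> measure lebesgue (unit_cell :: (real ^ 'n) set)"
    using measure_mono_fmeasurable[of "box 0 (1 :: real ^ 'n)" unit_cell lebesgue] 1 by (simp add: fmeasurableD box_subset_unit_cell)
qed

lemma finite_bounded_int_vecs:
  assumes "bounded X"
  shows "finite {z :: int ^ 'n. of_int_vec z \<in> (X :: (real ^ 'n) set)}"
proof -
  obtain R where R: "\<And>x. x \<in> X \<Longrightarrow> norm x \<le> R" using assms by (auto simp: bounded_iff)
  define m where "m = \<lceil>R\<rceil>"
  have "finite (vec_nth -` PiE UNIV (\<lambda>_ :: 'n. {-m..m}))"
    by (intro finite_vimageI finite_PiE) (auto simp: inj_def vec_nth_inject)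
  moreover have "{z. of_int_vec z \<in> X} \<subseteq> vec_nth -` PiE UNIV (\<lambda>_ :: 'n. {-m..m})"
  proof
    fix z :: "int ^ 'n" assume "z \<in> {z. of_int_vec z \<in> X}"
    then have "norm (of_int_vec z :: real ^ 'n) \<le> R" using R by auto
    then have "\<bar>real_of_int (z $ i)\<bar> \<le> R" for i
      using component_le_norm_cart[of "of_int_vec z :: real ^ 'n" i] by simp
    then have "\<bar>z $ i\<bar> \<le> m" for i unfolding m_def by (metis ceiling_mono ceiling_of_int of_int_abs)
    then show "z \<in> vec_nth -` PiE UNIV (\<lambda>_ :: 'n. {-m..m})" by (auto simp: abs_le_iff minus_le_iff)
  qed
  ultimately show ?thesis by (rule finite_subset[rotated])
qed

lemma unit_cell_decomposition:
  obtains z :: "int ^ 'n" where "x - of_int_vec z \<in> unit_cell"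
  by (rule that[of "\<chi> i. \<lfloor>x $ i\<rfloor>"]) (simp add: unit_cell_def, linarith)

lemma unit_cell_unique:
  assumes "x - of_int_vec y \<in> (unit_cell :: (real ^ 'n) set)" "x - of_int_vec z \<in> unit_cell"
  shows "y = z"
proof -
  have "y $ i = z $ i" for i
    using assms[unfolded unit_cell_def, simplified, THEN spec[of _ i]] by linarith
  then show ?thesis by (simp add: vec_eq_iff)
qed

text \<open>X is cut along the integer tiling and its pieces are moved into the unit cell; the moved
  pieces \<open>A z\<close> cover x once for each z with x + z in X. Boundedness leaves finitely
  many pieces.\<close>

lemma measure_eq_integral_count:
  fixes X :: "(real ^ 'n) set"
  assumes X: "X \<in> lmeasurable" "bounded X"
  defines "f \<equiv> \<lambda>x. indicator unit_cell x * real (card {z :: int ^ 'n. x + of_int_vec z \<in> X})"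
  shows "integrable lebesgue f" "measure lebesgue X = integral\<^sup>L lebesgue f"
proof -
  define A where "A z = {x \<in> unit_cell. x + of_int_vec z \<in> X}" for z :: "int ^ 'n"
  have A_eq: "A z = unit_cell \<inter> (\<lambda>x. - of_int_vec z + x) ` X" for z
    by (auto simp: A_def image_iff algebra_simps intro!: bexI)
  have A: "A z \<in> lmeasurable" for z unfolding A_eq
    by (intro fmeasurable.Int unit_cell_lmeasurable measurable_translation X)
  define Z where "Z = {z :: int ^ 'n. A z \<noteq> {}}"
  have "bounded {x - y |x y. x \<in> X \<and> y \<in> (unit_cell :: (real ^ 'n) set)}"
  proof -
    obtain a where a: "\<And>x. x \<in> X \<Longrightarrow> norm x \<le> a" using X(2) by (auto simp: bounded_iff)
    have "bounded (unit_cell :: (real ^ 'n) set)"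
      using unit_cell_subset_cbox bounded_cbox bounded_subset by blast
    then obtain b where b: "\<And>x. x \<in> (unit_cell :: (real ^ 'n) set) \<Longrightarrow> norm x \<le> b"
      by (auto simp: bounded_iff)
    have "norm (x - y) \<le> a + b" if "x \<in> X" "y \<in> unit_cell" for x y :: "real ^ 'n"
      using a[OF that(1)] b[OF that(2)] norm_triangle_ineq4[of x y] by linarith
    then show ?thesis unfolding bounded_iff by blast
  qed
  then have "finite {z. of_int_vec z \<in> {x - y |x y. x \<in> X \<and> y \<in> (unit_cell :: (real ^ 'n) set)}}"
    by (rule finite_bounded_int_vecs)
  moreover have "Z \<subseteq> {z. of_int_vec z \<in> {x - y |x y. x \<in> X \<and> y \<in> (unit_cell :: (real ^ 'n) set)}}"
  proof
    fix z assume "z \<in> Z"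
    then obtain x where "x \<in> unit_cell" "x + of_int_vec z \<in> X" by (auto simp: Z_def A_def)
    then show "z \<in> {z. of_int_vec z \<in> {x - y |x y. x \<in> X \<and> y \<in> (unit_cell :: (real ^ 'n) set)}}"
      by (intro CollectI exI[of _ "x + of_int_vec z"] exI[of _ x]) simp
  qed
  ultimately have Z: "finite Z" by (rule finite_subset[rotated])
  have f: "f x = (\<Sum>z\<in>Z. indicator (A z) x)" for x
  proof (cases "x \<in> unit_cell")
    case True
    then have "{z. x + of_int_vec z \<in> X} = {z\<in>Z. x \<in> A z}" by (auto simp: Z_def A_def)
    then show ?thesis using True Z by (simp add: f_def indicator_def sum.If_cases Int_def)
  qed (auto simp: f_def A_def)
  show "integrable lebesgue f" unfolding f
    using A by (intro Bochner_Integration.integrable_sum) (simp add: lmeasurable_iff_integrable)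
  have "X = (\<Union>z\<in>Z. (\<lambda>x. of_int_vec z + x) ` A z)"
  proof (intro equalityI subsetI)
    fix x assume "x \<in> X"
    obtain z :: "int ^ 'n" where "x - of_int_vec z \<in> unit_cell" using unit_cell_decomposition[of x] by blast
    then have "x - of_int_vec z \<in> A z" using \<open>x \<in> X\<close> by (simp add: A_def)
    then show "x \<in> (\<Union>z\<in>Z. (\<lambda>x. of_int_vec z + x) ` A z)"
      by (intro UN_I[of z]) (auto simp: Z_def intro!: image_eqI[of _ _ "x - of_int_vec z"])
  qed (auto simp: A_def add.commute)
  moreover have "measure lebesgue (\<Union>z\<in>Z. (\<lambda>x. of_int_vec z + x) ` A z) = (\<Sum>z\<in>Z. measure lebesgue ((\<lambda>x. of_int_vec z + x) ` A z))"
  proof (rule measure_negligible_finite_Union_image)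
    fix z show "(\<lambda>x. of_int_vec z + x) ` A z \<in> lmeasurable" by (intro measurable_translation A)
  next
    show "pairwise (\<lambda>y z. negligible ((\<lambda>x. of_int_vec y + x) ` A y \<inter> (\<lambda>x. of_int_vec z + x) ` A z)) Z"
    proof (rule pairwiseI)
      fix y z :: "int ^ 'n" assume "y \<noteq> z"
      have "(\<lambda>x. of_int_vec y + x) ` A y \<inter> (\<lambda>x. of_int_vec z + x) ` A z = {}"
      proof (rule ccontr)
        assume "(\<lambda>x. of_int_vec y + x) ` A y \<inter> (\<lambda>x. of_int_vec z + x) ` A z \<noteq> {}"
        then obtain x where "x - of_int_vec y \<in> unit_cell" "x - of_int_vec z \<in> unit_cell"
          by (auto simp: A_def) (metis add_diff_cancel_left')
        then show False using unit_cell_unique \<open>y \<noteq> z\<close> by blast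
      qed
      then show "negligible ((\<lambda>x. of_int_vec y + x) ` A y \<inter> (\<lambda>x. of_int_vec z + x) ` A z)" by simp
    qed
  qed (fact Z)
  ultimately have "measure lebesgue X = (\<Sum>z\<in>Z. measure lebesgue (A z))"
    by (simp add: measure_translation)
  also have "\<dots> = integral\<^sup>L lebesgue f" unfolding f
  proof (subst Bochner_Integration.integral_sum)
    fix z show "integrable lebesgue (indicat_real (A z))"
      using A[of z] by (simp add: lmeasurable_iff_integrable)
  qed simp
  finally show "measure lebesgue X = integral\<^sup>L lebesgue f" .
qed

lemma measure_le_if_counts_le:
  fixes X :: "(real ^ 'n) set"
  assumes X: "X \<in> lmeasurable" "bounded X" and B: "\<And>x. real (card {z :: int ^ 'n. x + of_int_vec z \<in> X}) \<le> B"
  shows "measure lebesgue X \<le> B"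
proof -
  have "measure lebesgue X \<le> integral\<^sup>L lebesgue (\<lambda>x. indicator (unit_cell :: (real ^ 'n) set) x * B)"
    unfolding measure_eq_integral_count(2)[OF X]
    by (intro integral_mono measure_eq_integral_count(1)[OF X] integrable_mult_left)
       (use B unit_cell_lmeasurable in \<open>auto simp: lmeasurable_iff_integrable split: split_indicator\<close>)
  then show ?thesis by simp
qed

lemma measure_ge_if_counts_ge:
  fixes X :: "(real ^ 'n) set"
  assumes X: "X \<in> lmeasurable" "bounded X" and B: "\<And>x. B \<le> real (card {z :: int ^ 'n. x + of_int_vec z \<in> X})"
  shows "B \<le> measure lebesgue X"
proof -
  have "integral\<^sup>L lebesgue (\<lambda>x. indicator (unit_cell :: (real ^ 'n) set) x * B) \<le> measure lebesgue X"
    unfolding measure_eq_integral_count(2)[OF X]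
    by (intro integral_mono measure_eq_integral_count(1)[OF X] integrable_mult_left)
       (use B unit_cell_lmeasurable in \<open>auto simp: lmeasurable_iff_integrable split: split_indicator\<close>)
  then show ?thesis by simp
qed

section \<open>Linear change of variables for volumes and counts\<close>

lemma invertible_mult_eq_iff:
  fixes h :: "real ^ 'n ^ 'n"
  assumes "invertible h" shows "h *v x = h *v y \<longleftrightarrow> x = y"
proof -
  obtain h' where "h' ** h = mat 1" using assms by (auto simp: invertible_def)
  then have "h' *v (h *v x) = x" for x by (simp add: matrix_vector_mul_assoc)
  then show ?thesis by metis
qed

text \<open>The library proves this only for index types of class \<^class>\<open>wellorder\<close>.\<close>

lemma linear_image_lmeasurable_measure:
  fixes f :: "real ^ 'n \<Rightarrow> real ^ 'n"
  assumes "linear f"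
  shows "\<forall>S\<in>lmeasurable. f ` S \<in> lmeasurable \<and> measure lebesgue (f ` S) = \<bar>det (matrix f)\<bar> * measure lebesgue S"
  using assms
proof (rule induct_linear_elementary)
  fix f g :: "real ^ 'n \<Rightarrow> real ^ 'n"
  assume "linear f" "linear g"
    and "\<forall>S\<in>lmeasurable. f ` S \<in> lmeasurable \<and> measure lebesgue (f ` S) = \<bar>det (matrix f)\<bar> * measure lebesgue S"
    and "\<forall>S\<in>lmeasurable. g ` S \<in> lmeasurable \<and> measure lebesgue (g ` S) = \<bar>det (matrix g)\<bar> * measure lebesgue S"
  then show "\<forall>S\<in>lmeasurable. (f \<circ> g) ` S \<in> lmeasurable \<and>
      measure lebesgue ((f \<circ> g) ` S) = \<bar>det (matrix (f \<circ> g))\<bar> * measure lebesgue S"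
    unfolding image_comp[symmetric] by (auto simp: matrix_compose det_mul abs_mult)
next
  fix f :: "real ^ 'n \<Rightarrow> real ^ 'n" and i
  assume f: "linear f" and 0: "\<And>x. f x $ i = 0"
  \<comment> \<open>A map into a coordinate hyperplane is singular, so both sides are 0.\<close>
  have "f x \<noteq> axis i 1" for x using 0[of x] by (metis axis_nth zero_neq_one)
  then have "\<not> surj f" by (metis surjD)
  then have "\<not> inj f" using f linear_injective_imp_surjective by blast
  then show "\<forall>S\<in>lmeasurable. f ` S \<in> lmeasurable \<and> measure lebesgue (f ` S) = \<bar>det (matrix f)\<bar> * measure lebesgue S"
    using negligible_linear_singular_image[OF f] det_nz_iff_inj[OF f]
    by (auto simp: negligible_imp_measurable negligible_imp_measure0)
next
  fix c :: "'n \<Rightarrow> real"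
  have "matrix (\<lambda>x :: real ^ 'n. \<chi> i. c i * x $ i) = (\<chi> i j. if i = j then c i else 0)"
    by (auto simp: matrix_def axis_def vec_eq_iff)
  then have "det (matrix (\<lambda>x :: real ^ 'n. \<chi> i. c i * x $ i)) = prod c UNIV" by (simp add: det_diagonal)
  then show "\<forall>S\<in>lmeasurable. (\<lambda>x :: real ^ 'n. \<chi> i. c i * x $ i) ` S \<in> lmeasurable \<and>
      measure lebesgue ((\<lambda>x :: real ^ 'n. \<chi> i. c i * x $ i) ` S) = \<bar>det (matrix (\<lambda>x :: real ^ 'n. \<chi> i. c i * x $ i))\<bar> * measure lebesgue S"
    by (simp add: measurable_stretch measure_stretch)
next
  fix m n :: 'n assume "m \<noteq> n"
  define \<pi> where "\<pi> = Transposition.transpose m n"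
  define h where "h = (\<lambda>x :: real ^ 'n. \<chi> i. x $ \<pi> i)"
  have h: "linear h" by (rule linearI) (simp_all add: h_def vec_eq_iff)
  have hh: "h (h x) = x" for x by (simp add: h_def \<pi>_def vec_eq_iff)
  \<comment> \<open>A swap of coordinates is an involution, so its determinant is 1 or -1.\<close>
  have "matrix h ** matrix h = mat 1"
    using matrix_compose[OF h h] hh by (simp add: o_def matrix_id_mat_1[unfolded id_def])
  then have "det (matrix h) * det (matrix h) = 1" by (metis det_I det_mul)
  then have det: "\<bar>det (matrix h)\<bar> = 1" by (metis abs_square_eq_1 power2_eq_square)
  have "measure lebesgue (h ` cbox a b) = 1 * measure lebesgue (cbox a b)" for a b
  proof -
    have eq: "h ` cbox a b = cbox (h a) (h b)"
    proof (intro equalityI subsetI)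
      fix x assume x: "x \<in> cbox (h a) (h b)"
      have "h x \<in> cbox a b"
        unfolding mem_box_cart
      proof
        fix i
        have "h a $ \<pi> i \<le> x $ \<pi> i \<and> x $ \<pi> i \<le> h b $ \<pi> i" using x by (simp add: mem_box_cart)
        then show "a $ i \<le> h x $ i \<and> h x $ i \<le> b $ i" by (simp add: h_def \<pi>_def)
      qed
      then show "x \<in> h ` cbox a b" using hh by (metis image_eqI)
    qed (auto simp: mem_box_cart h_def)
    have "(\<Prod>i\<in>UNIV. b $ \<pi> i - a $ \<pi> i) = (\<Prod>i\<in>UNIV. b $ i - a $ i)"
      unfolding \<pi>_def by (rule prod.reindex_bij_betw[of _ UNIV UNIV "\<lambda>i. b $ i - a $ i"]) simp
    moreover have "cbox (h a) (h b) = {} \<longleftrightarrow> cbox a b = {}" by (metis eq image_is_empty)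
    ultimately show ?thesis unfolding eq by (simp add: content_cbox_if_cart h_def)
  qed
  note box = this
  have "\<forall>S\<in>lmeasurable. h ` S \<in> lmeasurable \<and> measure lebesgue (h ` S) = \<bar>det (matrix h)\<bar> * measure lebesgue S"
  proof
    fix S :: "(real ^ 'n) set" assume "S \<in> lmeasurable"
    from measure_linear_sufficient[OF h this box]
    show "h ` S \<in> lmeasurable \<and> measure lebesgue (h ` S) = \<bar>det (matrix h)\<bar> * measure lebesgue S"
      by (metis det abs_one)
  qed
  then show "\<forall>S\<in>lmeasurable. (\<lambda>x :: real ^ 'n. \<chi> i. x $ Transposition.transpose m n i) ` S \<in> lmeasurable \<and>
      measure lebesgue ((\<lambda>x :: real ^ 'n. \<chi> i. x $ Transposition.transpose m n i) ` S) =
      \<bar>det (matrix (\<lambda>x :: real ^ 'n. \<chi> i. x $ Transposition.transpose m n i))\<bar> * measure lebesgue S"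
    by (simp only: h_def \<pi>_def)
next
  fix m n :: 'n assume mn: "m \<noteq> n"
  define h where "h = (\<lambda>x :: real ^ 'n. \<chi> i. if i = m then x $ m + x $ n else x $ i)"
  have h: "linear h" by (rule linearI) (simp_all add: h_def vec_eq_iff algebra_simps)
  have "matrix h = (\<chi> k. if k = m then row m (mat 1) + 1 *s row n (mat 1) else row k (mat 1))"
    by (auto simp: matrix_def h_def axis_def row_def mat_def vec_eq_iff)
  then have det: "det (matrix h) = 1" using det_row_operation[OF mn, of "mat 1 :: real ^ 'n ^ 'n" 1] by simp
  have "measure lebesgue (h ` cbox a b) = 1 * measure lebesgue (cbox a b)" for a b
  proof (cases "cbox a b = {}")
    case False
    \<comment> \<open>\<open>measure_shear_interval\<close> asks for a nonnegative lower corner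
      coordinate, so the box is moved to the origin.\<close>
    have cb: "cbox a b = (+) a ` cbox 0 (b - a)" using cbox_translation[of a 0 "b - a"] by simp
    then have ne: "cbox 0 (b - a) \<noteq> {}" using False by auto
    have "h ` cbox a b = (+) (h a) ` h ` cbox 0 (b - a)"
      unfolding cb image_image by (simp add: linear_add[OF h])
    then have "measure lebesgue (h ` cbox a b) = measure lebesgue (h ` cbox 0 (b - a))"
      by (simp add: measure_translation)
    also have "\<dots> = measure lebesgue (cbox 0 (b - a))"
      unfolding h_def by (rule measure_shear_interval[OF mn ne]) simp
    also have "\<dots> = measure lebesgue (cbox a b)" unfolding cb by (rule measure_translation[symmetric])
    finally show ?thesis by simp
  qed simp
  note box = this
  have "\<forall>S\<in>lmeasurable. h ` S \<in> lmeasurable \<and> measure lebesgue (h ` S) = \<bar>det (matrix h)\<bar> * measure lebesgue S"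
  proof
    fix S :: "(real ^ 'n) set" assume "S \<in> lmeasurable"
    from measure_linear_sufficient[OF h this box]
    show "h ` S \<in> lmeasurable \<and> measure lebesgue (h ` S) = \<bar>det (matrix h)\<bar> * measure lebesgue S"
      by (metis det abs_one)
  qed
  then show "\<forall>S\<in>lmeasurable. (\<lambda>x :: real ^ 'n. \<chi> i. if i = m then x $ m + x $ n else x $ i) ` S \<in> lmeasurable \<and>
      measure lebesgue ((\<lambda>x :: real ^ 'n. \<chi> i. if i = m then x $ m + x $ n else x $ i) ` S) =
      \<bar>det (matrix (\<lambda>x :: real ^ 'n. \<chi> i. if i = m then x $ m + x $ n else x $ i))\<bar> * measure lebesgue S"
    by (simp only: h_def)
qed

lemma linear_preimage_props:
  fixes h :: "real ^ 'n ^ 'n"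
  assumes h: "invertible h" and X: "X \<in> lmeasurable" "bounded X"
  defines "Y \<equiv> {y. h *v y \<in> X}"
  shows "Y \<in> lmeasurable" "bounded Y" "measure lebesgue X = \<bar>det h\<bar> * measure lebesgue Y"
proof -
  obtain h' where h': "h ** h' = mat 1" "h' ** h = mat 1" using h by (auto simp: invertible_def)
  have inv: "h *v (h' *v x) = x" "h' *v (h *v x) = x" for x
    using h' by (simp_all add: matrix_vector_mul_assoc)
  have Y: "Y = (*v) h' ` X"
  proof (intro equalityI subsetI)
    fix y assume "y \<in> Y"
    then show "y \<in> (*v) h' ` X" by (intro image_eqI[of _ _ "h *v y"]) (simp_all add: Y_def inv)
  qed (auto simp: Y_def inv)
  show "Y \<in> lmeasurable" unfolding Y using X linear_image_lmeasurable_measure[of "(*v) h'"] by simp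
  show "bounded Y" unfolding Y using X by (intro bounded_linear_image linear_linear[THEN iffD1]) auto
  have "X = (*v) h ` Y" unfolding Y image_image by (simp add: inv)
  then show "measure lebesgue X = \<bar>det h\<bar> * measure lebesgue Y"
    using linear_image_lmeasurable_measure[of "(*v) h"] \<open>Y \<in> lmeasurable\<close> by simp
qed

section \<open>Points of a lattice in dilates of a convex set\<close>

definition pts :: "real ^ 'n ^ 'n \<Rightarrow> (real ^ 'n) set \<Rightarrow> real ^ 'n \<Rightarrow> (int ^ 'n) set" where
  "pts h X x = {z. h *v of_int_vec z - x \<in> X}"

lemma finite_pts:
  assumes "invertible h" "bounded X" shows "finite (pts h X x)"
proof -
  have "bounded {y. h *v y \<in> (\<lambda>k. x + k) ` X}"
  proof -
    obtain h' where h': "h' ** h = mat 1" using assms by (auto simp: invertible_def)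
    have inv: "h' *v (h *v x) = x" for x using h' by (simp add: matrix_vector_mul_assoc)
    have "bounded ((*v) h' ` (\<lambda>k. x + k) ` X)"
      using assms by (intro bounded_linear_image linear_linear[THEN iffD1] bounded_translation) auto
    moreover have "{y. h *v y \<in> (\<lambda>k. x + k) ` X} \<subseteq> (*v) h' ` (\<lambda>k. x + k) ` X"
      using inv by (metis (mono_tags, lifting) image_eqI mem_Collect_eq subsetI)
    ultimately show ?thesis by (rule bounded_subset)
  qed
  then have "finite {z. of_int_vec z \<in> {y. h *v y \<in> (\<lambda>k. x + k) ` X}}" by (rule finite_bounded_int_vecs)
  moreover have "pts h X x \<subseteq> {z. of_int_vec z \<in> {y. h *v y \<in> (\<lambda>k. x + k) ` X}}"
    by (auto simp: pts_def intro!: image_eqI[of _ _ "h *v _ - x"])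
  ultimately show ?thesis by (rule finite_subset[rotated])
qed

lemma pts_neg_mult: "pts h X (- (h *v y)) = {z. y + of_int_vec z \<in> {y. h *v y \<in> X}}"
  by (auto simp: pts_def matrix_vector_right_distrib add.commute)

lemma measure_le_if_pts_le:
  fixes h :: "real ^ 'n ^ 'n"
  assumes h: "invertible h" and X: "X \<in> lmeasurable" "bounded X" and B: "\<And>x. real (card (pts h X x)) \<le> B"
  shows "measure lebesgue X \<le> B * \<bar>det h\<bar>"
proof -
  have "measure lebesgue {y. h *v y \<in> X} \<le> B"
    by (rule measure_le_if_counts_le[OF linear_preimage_props(1,2)[OF h X]]) (rule B[of "- (h *v _)", unfolded pts_neg_mult])
  then have "\<bar>det h\<bar> * measure lebesgue {y. h *v y \<in> X} \<le> \<bar>det h\<bar> * B" by (intro mult_left_mono) auto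
  then show ?thesis using linear_preimage_props(3)[OF h X] by (simp add: mult.commute)
qed

lemma measure_ge_if_pts_ge:
  fixes h :: "real ^ 'n ^ 'n"
  assumes h: "invertible h" and X: "X \<in> lmeasurable" "bounded X" and B: "\<And>x. B \<le> real (card (pts h X x))"
  shows "B * \<bar>det h\<bar> \<le> measure lebesgue X"
proof -
  have "B \<le> measure lebesgue {y. h *v y \<in> X}"
    by (rule measure_ge_if_counts_ge[OF linear_preimage_props(1,2)[OF h X]]) (rule B[of "- (h *v _)", unfolded pts_neg_mult])
  then have "\<bar>det h\<bar> * B \<le> \<bar>det h\<bar> * measure lebesgue {y. h *v y \<in> X}" by (intro mult_left_mono) auto
  then show ?thesis using linear_preimage_props(3)[OF h X] by (simp add: mult.commute)
qed

lemma card_pts_shift: "card (pts h X (h *v of_int_vec y)) = card (pts h X 0)"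
proof -
  have "pts h X (h *v of_int_vec y) = (\<lambda>z. z + y) ` pts h X 0"
  proof (intro equalityI subsetI)
    fix z assume "z \<in> pts h X (h *v of_int_vec y)"
    then show "z \<in> (\<lambda>z. z + y) ` pts h X 0"
      by (intro image_eqI[of _ _ "z - y"]) (auto simp: pts_def of_int_vec_diff matrix_vector_mult_diff_distrib)
  qed (auto simp: pts_def of_int_vec_add matrix_vector_right_distrib)
  then show ?thesis by (simp add: card_image)
qed

text \<open>The Minkowski inclusion aK + bK \<subseteq> (a + b)K: the sum is (a + b) times a convex
  combination with weights a/(a + b) and b/(a + b).\<close>

lemma scaled_add_mem:
  fixes K :: "'a::real_vector set"
  assumes "convex K" "x \<in> (*\<^sub>R) a ` K" "k \<in> K" "0 < a" "0 \<le> b"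
  shows "x + b *\<^sub>R k \<in> (*\<^sub>R) (a + b) ` K"
proof -
  obtain k' where k': "k' \<in> K" "x = a *\<^sub>R k'" using assms by auto
  have "(a / (a + b)) *\<^sub>R k' + (b / (a + b)) *\<^sub>R k \<in> K"
    using assms k' by (intro convexD) (auto simp: add_divide_distrib[symmetric])
  then show ?thesis
    using assms k' by (intro image_eqI[of _ _ "(a / (a + b)) *\<^sub>R k' + (b / (a + b)) *\<^sub>R k"]) (auto simp: scaleR_add_right)
qed

lemma measure_scaled:
  fixes K :: "(real ^ 'n) set"
  assumes "0 < a"
  shows "measure lebesgue ((*\<^sub>R) a ` K) = a ^ CARD('n) * measure lebesgue K"
  using measure_lebesgue_affine[of a "0 :: real ^ 'n" K] assms by simp

lemma scaled_lmeasurable_bounded: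
  fixes K :: "(real ^ 'n) set"
  assumes "bounded K" "convex K"
  shows "(*\<^sub>R) a ` K \<in> lmeasurable" "bounded ((*\<^sub>R) a ` K)"
  using assms by (auto intro!: measurable_convex convex_scaling bounded_scaling)

section \<open>The covolume of the lifted lattice\<close>

text \<open>A reduced echelon basis without an ordering of the coordinates. A basis of S is
  completed to one of the whole space by coordinate vectors e_i with i in I; J is the complement of
  I, and b j is the S-component of e_j along the span of these e_i. The last property says that S
  meets this span trivially, which follows by dimensions.\<close>

lemma subspace_pivots:
  fixes S :: "('f::field ^ 'n) set"
  assumes S: "vec.subspace S"
  obtains J :: "'n set" and b :: "'n \<Rightarrow> 'f ^ 'n" where
    "card J = vec.dim S" "\<And>j. j \<in> J \<Longrightarrow> b j \<in> S"
    "\<And>i j. i \<in> J \<Longrightarrow> j \<in> J \<Longrightarrow> b j $ i = (if i = j then 1 else 0)"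
    "\<And>x. x \<in> S \<Longrightarrow> (\<And>j. j \<in> J \<Longrightarrow> x $ j = 0) \<Longrightarrow> x = 0"
proof -
  obtain Bs where Bs: "Bs \<subseteq> S" "vec.independent Bs" "S \<subseteq> vec.span Bs" "card Bs = vec.dim S"
    using vec.basis_exists[of S] by blast
  have spBs: "vec.span Bs = S" using Bs S by (metis vec.span_subspace)
  define ax where "ax = (\<lambda>i :: 'n. axis i (1 :: 'f))"
  obtain B where B: "Bs \<subseteq> B" "B \<subseteq> Bs \<union> range ax" "vec.independent B" "Bs \<union> range ax \<subseteq> vec.span B"
    using vec.maximal_independent_subset_extend[of Bs "Bs \<union> range ax"] Bs(2) by blast
  have expand: "x = (\<Sum>i\<in>UNIV. x $ i *s ax i)" for x :: "'f ^ 'n"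
    by (simp add: ax_def basis_expansion)
  have spB: "vec.span B = UNIV"
  proof (intro equalityI subsetI)
    fix x :: "'f ^ 'n"
    have "(\<Sum>i\<in>UNIV. x $ i *s ax i) \<in> vec.span B"
      using B(4) by (intro vec.span_sum vec.span_scale) auto
    then show "x \<in> vec.span B" using expand[of x] by simp
  qed simp
  have finB: "finite B" using B(3) by (rule vec.finiteI_independent)
  have cB: "card B = CARD('n)"
    using vec.dim_eq_card[OF _ B(3), of UNIV] spB by (simp add: vec_dim_card del: vec.dim_UNIV)
  define C where "C = B - Bs"
  define I where "I = {i. ax i \<in> C}"
  have inj: "inj ax" by (auto simp: inj_def ax_def axis_eq_axis)
  have CI: "C = ax ` I" using B(2) by (auto simp: C_def I_def)
  have "card C = CARD('n) - vec.dim S"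
    unfolding C_def using B(1) finB cB Bs(4) by (simp add: card_Diff_subset finite_subset)
  then have cI: "card I = CARD('n) - vec.dim S"
    unfolding CI using inj by (simp add: card_image inj_on_def)
  have le: "vec.dim S \<le> CARD('n)" using cB Bs(4) card_mono[OF finB B(1)] by simp
  define J where "J = - I"
  have cJ: "card J = vec.dim S" unfolding J_def using cI le by (simp add: Compl_eq_Diff_UNIV card_Diff_subset)
  have spC: "vec.span C \<subseteq> {x. \<forall>j\<in>J. x $ j = 0}"
    by (rule vec.span_minimal) (auto simp: CI J_def ax_def axis_def vec.subspace_def)
  have in_spC: "x \<in> vec.span C" if "\<And>j. j \<in> J \<Longrightarrow> x $ j = 0" for x
  proof -
    have "(\<Sum>i\<in>UNIV. x $ i *s ax i) \<in> vec.span C"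
    proof (intro vec.span_sum)
      fix i show "x $ i *s ax i \<in> vec.span C"
      proof (cases "i \<in> I")
        case True
        then show ?thesis by (intro vec.span_scale vec.span_base) (simp add: CI)
      qed (simp add: that J_def vec.span_zero)
    qed
    then show ?thesis using expand[of x] by simp
  qed
  have "\<exists>s c. s \<in> S \<and> c \<in> vec.span C \<and> ax j = s + c" for j
  proof -
    have "ax j \<in> vec.span (Bs \<union> C)" using spB B(1) by (auto simp: C_def Un_absorb1)
    then show ?thesis unfolding vec.span_Un spBs by blast
  qed
  then obtain b c where bc: "\<And>j. b j \<in> S" "\<And>j. c j \<in> vec.span C" "\<And>j. ax j = b j + c j" by metis
  show ?thesis
  proof (rule that[of J b])
    fix i j assume "i \<in> J" "j \<in> J"
    then have "c j $ i = 0" using bc(2)[of j] spC by auto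
    moreover have "ax j $ i = b j $ i + c j $ i" by (simp add: bc(3))
    ultimately show "b j $ i = (if i = j then 1 else 0)" by (simp add: ax_def axis_def)
  next
    fix x assume x: "x \<in> S" "\<And>j. j \<in> J \<Longrightarrow> x $ j = 0"
    have "vec.dim {x + y |x y. x \<in> S \<and> y \<in> vec.span C} + vec.dim (S \<inter> vec.span C) = vec.dim S + vec.dim (vec.span C)"
      by (rule vec.dim_sums_Int[OF S vec.subspace_span])
    moreover have "{x + y |x y. x \<in> S \<and> y \<in> vec.span C} = vec.span (Bs \<union> C)"
      unfolding vec.span_Un spBs by auto
    moreover have "Bs \<union> C = B" using B(1) by (auto simp: C_def)
    moreover have "vec.dim (vec.span C) = CARD('n) - vec.dim S"
      using \<open>card C = CARD('n) - vec.dim S\<close> vec.independent_mono[OF B(3), of C]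
      by (simp add: C_def vec.dim_eq_card_independent)
    moreover have "vec.dim (vec.span B) = CARD('n)" by (simp add: spB vec_dim_card del: vec.dim_UNIV)
    ultimately have "vec.dim (S \<inter> vec.span C) = 0" using le by simp
    then have "S \<inter> vec.span C \<subseteq> {0}" by (simp add: vec.dim_eq_0)
    then show "x = 0" using x in_spC by blast
  qed (use cJ bc in auto)
qed

lemma of_int_mod_ring_eq_0_iff:
  "(of_int x :: 'p::prime_card mod_ring) = 0 \<longleftrightarrow> int CARD('p) dvd x"
  by (simp add: of_int_eq_0_iff_char_dvd)

lemma of_int_vec_mult: "of_int_vec (U *v z) = of_int_mat U *v (of_int_vec z :: real ^ 'n)"
  by (simp add: vec_eq_iff matrix_vector_mult_def of_int_mat_def)

text \<open>The columns of U are integer lifts of the pivot vectors b j for j in J, and p times the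
  coordinate vectors for the other j. The factorisation (1 + N) D into a unimodular and a diagonal
  matrix gives the determinant.\<close>

lemma preimage_lattice_basis:
  fixes S :: "(('p::prime_card mod_ring) ^ 'n) set"
  assumes S: "vec.subspace S"
  obtains U :: "int ^ 'n ^ 'n" where "range ((*v) U) = of_int_vec -` S"
    "\<bar>det U\<bar> = int CARD('p) ^ (CARD('n) - vec.dim S)"
proof -
  let ?p = "int CARD('p)"
  obtain J :: "'n set" and b :: "'n \<Rightarrow> 'p mod_ring ^ 'n" where J: "card J = vec.dim S"
    and b: "\<And>j. j \<in> J \<Longrightarrow> b j \<in> S" "\<And>i j. i \<in> J \<Longrightarrow> j \<in> J \<Longrightarrow> b j $ i = (if i = j then 1 else 0)"
    and zero: "\<And>x. x \<in> S \<Longrightarrow> (\<And>j. j \<in> J \<Longrightarrow> x $ j = 0) \<Longrightarrow> x = 0"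
    using subspace_pivots[OF S] by metis
  define \<beta> where "\<beta> i j = to_int_mod_ring (b j $ i)" for i j
  have \<beta>: "of_int (\<beta> i j) = b j $ i" for i j by (simp add: \<beta>_def of_int_of_int_mod_ring)
  define N :: "int ^ 'n ^ 'n" where "N = (\<chi> i j. if i \<notin> J \<and> j \<in> J then \<beta> i j else 0)"
  define D :: "int ^ 'n ^ 'n" where "D = (\<chi> i j. if i = j then (if j \<in> J then 1 else ?p) else 0)"
  define U where "U = (mat 1 + N) ** D"
  \<comment> \<open>N reads only coordinates in J and writes only coordinates outside J. Hence 1 - N
    is inverse to 1 + N.\<close>
  have NN: "N ** N = 0"
    by (auto simp: N_def matrix_matrix_mult_def vec_eq_iff intro!: sum.neutral)
  have add: "(A + B) ** M = A ** M + B ** M" for A B M :: "int ^ 'n ^ 'n"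
    by (simp add: vec_eq_iff matrix_matrix_mult_def distrib_right sum.distrib)
  have diff: "A ** (B - M) = A ** B - A ** M" for A B M :: "int ^ 'n ^ 'n"
    by (simp add: vec_eq_iff matrix_matrix_mult_def right_diff_distrib sum_subtractf)
  have "(mat 1 + N) ** (mat 1 - N) = mat 1 + N - (N + N ** N)"
    by (simp add: add diff)
  then have "det (mat 1 + N) * det (mat 1 - N) = 1" by (metis NN add.right_neutral add_diff_cancel_right' det_I det_mul)
  then have "\<bar>det (mat 1 + N)\<bar> = 1" by (metis abs_mult_self_eq abs_zmult_eq_1 abs_1)
  moreover have "det D = ?p ^ (CARD('n) - vec.dim S)"
  proof -
    have "det D = (\<Prod>j\<in>UNIV. if j \<in> J then 1 else ?p)" by (simp add: D_def det_diagonal)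
    also have "\<dots> = ?p ^ card (- J)" by (simp add: prod.If_cases)
    finally show ?thesis by (simp add: Compl_eq_Diff_UNIV card_Diff_subset J)
  qed
  ultimately have det: "\<bar>det U\<bar> = ?p ^ (CARD('n) - vec.dim S)" by (simp add: U_def det_mul abs_mult)
  have U: "(U *v z) $ i = (if i \<in> J then z $ i else (\<Sum>j\<in>J. \<beta> i j * z $ j) + ?p * z $ i)" for z i
  proof -
    have D: "D *v z = (\<chi> j. if j \<in> J then z $ j else ?p * z $ j)"
    proof -
      have "(if i = j then if j \<in> J then 1 else ?p else 0) * z $ j =
          (if i = j then if j \<in> J then z $ j else ?p * z $ j else 0)" for i j by simp
      then show ?thesis by (simp add: D_def vec_eq_iff matrix_vector_mult_def)
    qed
    have "(U *v z) $ i = (D *v z) $ i + (N *v (D *v z)) $ i"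
      by (simp add: U_def matrix_vector_mul_assoc[symmetric] matrix_vector_mult_add_rdistrib)
    also have "(N *v (D *v z)) $ i = (if i \<in> J then 0 else (\<Sum>j\<in>J. \<beta> i j * z $ j))"
    proof (cases "i \<in> J")
      case False
      have "(N *v (D *v z)) $ i = (\<Sum>j\<in>UNIV. if j \<in> J then \<beta> i j * z $ j else 0)"
        unfolding matrix_vector_mult_def[of N] vec_lambda_beta
        by (intro sum.cong) (use False in \<open>auto simp: N_def D\<close>)
      then show ?thesis using False by (simp add: sum.If_cases)
    qed (simp add: N_def matrix_vector_mult_def)
    finally show ?thesis by (simp add: D)
  qed
  define comb where "comb z = (\<Sum>j\<in>J. of_int (z $ j) *s b j)" for z :: "int ^ 'n"
  have comb_S: "comb z \<in> S" for z
    unfolding comb_def by (intro vec.subspace_sum[OF S] vec.subspace_scale[OF S] b)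
  have comb_J: "comb z $ i = of_int (z $ i)" if "i \<in> J" for i z
  proof -
    have "comb z $ i = (\<Sum>j\<in>J. of_int (z $ j) * (if i = j then 1 else 0))"
      unfolding comb_def using that by (simp add: b(2))
    also have "\<dots> = of_int (z $ i)"
      using that by (subst sum.remove[of _ i]) (auto intro!: sum.neutral split: if_splits)
    finally show ?thesis .
  qed
  have comb_I: "comb z $ i = of_int (\<Sum>j\<in>J. \<beta> i j * z $ j)" for i z
    by (simp add: comb_def \<beta> mult.commute)
  have "range ((*v) U) = of_int_vec -` S"
  proof (intro equalityI subsetI)
    fix y assume "y \<in> range ((*v) U)"
    then obtain z where y: "y = U *v z" by auto
    have "of_int_vec y = comb z"
      unfolding y vec_eq_iff of_int_vec_nth U
      using comb_J comb_I by (auto simp: of_int_mod_ring_eq_0_iff)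
    then show "y \<in> of_int_vec -` S" using comb_S by simp
  next
    fix y assume "y \<in> of_int_vec -` S"
    then have yS: "of_int_vec y \<in> S" by simp
    have "of_int_vec y - comb y = 0"
      by (rule zero) (use vec.subspace_diff[OF S yS comb_S] comb_J in auto)
    then have "of_int (y $ i - (\<Sum>j\<in>J. \<beta> i j * y $ j)) = (0 :: 'p mod_ring)" for i
      using comb_I[of y i] by (simp add: vec_eq_iff)
    then have dvd: "?p dvd y $ i - (\<Sum>j\<in>J. \<beta> i j * y $ j)" for i
      by (simp only: of_int_mod_ring_eq_0_iff)
    define z where "z = (\<chi> i. if i \<in> J then y $ i else (y $ i - (\<Sum>j\<in>J. \<beta> i j * y $ j)) div ?p)"
    have "(\<Sum>j\<in>J. \<beta> i j * z $ j) = (\<Sum>j\<in>J. \<beta> i j * y $ j)" for i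
      by (intro sum.cong) (auto simp: z_def)
    then have "U *v z = y"
      unfolding vec_eq_iff U using dvd by (auto simp: z_def)
    then show "y \<in> range ((*v) U)" by auto
  qed
  with det show ?thesis by (rule that[rotated])
qed

lemma covol_lattice_lift:
  fixes S :: "(('p::prime_card mod_ring) ^ 'n) set" and g :: "real ^ 'n ^ 'n"
  assumes S: "vec.subspace S" and g: "invertible g"
  shows "covol (lattice_lift g S) = \<bar>det g\<bar> / real CARD('p) ^ vec.dim S"
proof -
  let ?p = "real CARD('p)"
  obtain U :: "int ^ 'n ^ 'n" where U: "range ((*v) U) = of_int_vec -` S"
    "\<bar>det U\<bar> = int CARD('p) ^ (CARD('n) - vec.dim S)"
    using preimage_lattice_basis[OF S] by metis
  define h where "h = (1 / ?p) *\<^sub>R (g ** of_int_mat U)"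
  have p: "?p > 0" by simp
  have le: "vec.dim S \<le> CARD('n)" by (rule dim_subset_UNIV_cart_gen)
  have "h = (\<chi> i. (1 / ?p) *s (g ** of_int_mat U) $ i)"
    by (simp add: h_def vec_eq_iff)
  then have "det h = (1 / ?p) ^ CARD('n) * det (g ** of_int_mat U)"
    by (simp add: det_rows_mul[of "\<lambda>_. 1 / ?p" "\<lambda>i. (g ** of_int_mat U) $ i"])
  then have det: "\<bar>det h\<bar> = (1 / ?p) ^ CARD('n) * (\<bar>det g\<bar> * ?p ^ (CARD('n) - vec.dim S))"
    using U(2) by (simp add: det_mul det_of_int_mat abs_mult flip: of_int_abs)
  also have "\<dots> = \<bar>det g\<bar> / ?p ^ vec.dim S"
    using p le by (simp add: power_diff power_one_over field_simps)
  finally have det': "\<bar>det h\<bar> = \<bar>det g\<bar> / ?p ^ vec.dim S" .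
  have "invertible h" using det' g p by (auto simp: invertible_det_nz)
  have "lattice_lift g S = (\<lambda>z. (1 / ?p) *\<^sub>R (g *v of_int_vec z)) ` range ((*v) U)"
    by (simp add: lattice_lift_def U)
  also have "\<dots> = lattice_of h"
    by (simp add: image_image lattice_of_def h_def of_int_vec_mult matrix_vector_mul_assoc scaleR_matrix_vector_assoc[symmetric])
  finally have "lattice_lift g S = lattice_of h" .
  then show ?thesis using covol_lattice_of[OF \<open>invertible h\<close>] det' by simp
qed

section \<open>Lattice counts through reduction modulo p\<close>

lemma lattice_count_lift:
  fixes S :: "(('p::prime_card mod_ring) ^ 'n) set" and g :: "real ^ 'n ^ 'n"
  assumes g: "invertible g"
  defines "h \<equiv> (1 / real CARD('p)) *\<^sub>R g"
  shows "lattice_count (lattice_lift g S) K x = card {z \<in> pts h K x. of_int_vec z \<in> S}"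
proof -
  have h: "(1 / real CARD('p)) *\<^sub>R (g *v v) = h *v v" for v
    by (simp add: h_def scaleR_matrix_vector_assoc)
  have inj: "inj (\<lambda>z. h *v (of_int_vec z :: real ^ 'n))"
    by (rule injI) (simp add: h[symmetric] invertible_mult_eq_iff[OF g])
  have "lattice_lift g S \<inter> (\<lambda>k. k + x) ` K = (\<lambda>z. h *v of_int_vec z) ` {z \<in> pts h K x. of_int_vec z \<in> S}"
    by (auto simp: lattice_lift_def h pts_def image_iff algebra_simps intro!: bexI[of _ "h *v of_int_vec _ - x"])
  then show ?thesis
    unfolding lattice_count_def using inj by (simp add: card_image inj_on_def)
qed

text \<open>For a centre in the lattice, subtracting y moves all points into the fixed set
  \<open>pts h X 0\<close>. One set of residues thus serves all lattice centres, and the centre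
  survives only as a translate of S.\<close>

lemma card_pts_mod:
  fixes S :: "(('p::prime_card mod_ring) ^ 'n) set" and h :: "real ^ 'n ^ 'n"
  assumes inj: "inj_on (of_int_vec :: _ \<Rightarrow> 'p mod_ring ^ 'n) (pts h X 0)"
  shows "card {z \<in> pts h X (h *v of_int_vec y). of_int_vec z \<in> S} =
    card (of_int_vec ` pts h X 0 \<inter> (+) (- of_int_vec y) ` S)"
proof -
  let ?P = "{z \<in> pts h X (h *v of_int_vec y). of_int_vec z \<in> S}"
  have mem: "z - y \<in> pts h X 0 \<longleftrightarrow> z \<in> pts h X (h *v of_int_vec y)" for z
    by (simp add: pts_def of_int_vec_diff matrix_vector_mult_diff_distrib)
  have inj': "inj_on (\<lambda>z. of_int_vec (z - y) :: 'p mod_ring ^ 'n) ?P"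
  proof (rule inj_onI)
    fix z z' assume "z \<in> ?P" "z' \<in> ?P" "of_int_vec (z - y) = (of_int_vec (z' - y) :: 'p mod_ring ^ 'n)"
    then have "z - y = z' - y" by (intro inj_onD[OF inj]) (auto simp: mem)
    then show "z = z'" by simp
  qed
  have im: "(\<lambda>z. of_int_vec (z - y) :: 'p mod_ring ^ 'n) ` ?P = of_int_vec ` pts h X 0 \<inter> (+) (- of_int_vec y) ` S"
  proof (intro equalityI subsetI)
    fix v assume "v \<in> (\<lambda>z. of_int_vec (z - y) :: 'p mod_ring ^ 'n) ` ?P"
    then obtain z where z: "z \<in> ?P" "v = of_int_vec (z - y)" by auto
    then have "v \<in> of_int_vec ` pts h X 0" using mem by blast
    moreover have "v = - of_int_vec y + of_int_vec z" using z by (simp add: of_int_vec_diff)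
    then have "v \<in> (+) (- of_int_vec y) ` S" using z by blast
    ultimately show "v \<in> of_int_vec ` pts h X 0 \<inter> (+) (- of_int_vec y) ` S" ..
  next
    fix v assume "v \<in> of_int_vec ` pts h X 0 \<inter> (+) (- of_int_vec y) ` S"
    then obtain z s where z: "z \<in> pts h X 0" "v = of_int_vec z" "s \<in> S" "v = - of_int_vec y + s" by auto
    have "of_int_vec (z + y) = v + of_int_vec y" using z(2) by (simp add: of_int_vec_add)
    also have "\<dots> = s" using z(4) by simp
    finally have "z + y \<in> ?P" using z mem[of "z + y"] by simp
    moreover have "v = of_int_vec (z + y - y)" using z(2) by simp
    ultimately show "v \<in> (\<lambda>z. of_int_vec (z - y) :: 'p mod_ring ^ 'n) ` ?P" by blast
  qed
  show ?thesis unfolding im[symmetric] by (rule card_image[OF inj', symmetric])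
qed

text \<open>If z and z' are congruent mod p, then l = h z - h z' is a point of the lattice of g.
  With h z = a k and h z' = a k', the point l + b k' equals b k'' for the convex combination k'' =
  (a/b) k + (1 - a/b) k'. So bK and l + bK meet, and the packing forces l = 0.\<close>

lemma packing_imp_inj_on_pts:
  fixes g :: "real ^ 'n ^ 'n"
  assumes g: "invertible g" and K: "convex K" and pack: "is_packing (lattice_of g) ((*\<^sub>R) b ` K)"
    and a: "0 < a" "a \<le> b"
  defines "h \<equiv> (1 / real CARD('p::prime_card)) *\<^sub>R g"
  shows "inj_on (of_int_vec :: _ \<Rightarrow> 'p mod_ring ^ 'n) (pts h ((*\<^sub>R) a ` K) 0)"
proof (rule inj_onI)
  fix z z' assume z: "z \<in> pts h ((*\<^sub>R) a ` K) 0" "z' \<in> pts h ((*\<^sub>R) a ` K) 0"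
    and eq: "of_int_vec z = (of_int_vec z' :: 'p mod_ring ^ 'n)"
  let ?p = "int CARD('p)"
  have "?p dvd z $ i - z' $ i" for i
    using eq by (simp add: vec_eq_iff flip: of_int_mod_ring_eq_0_iff[where 'p = 'p])
  then obtain y where y: "\<And>i. z $ i - z' $ i = ?p * y i" unfolding dvd_def by metis
  define l where "l = g *v of_int_vec (\<chi> i. y i)"
  have zy: "of_int_vec z - of_int_vec z' = real CARD('p) *\<^sub>R (of_int_vec (\<chi> i. y i) :: real ^ 'n)"
  proof -
    have "real_of_int (z $ i) - real_of_int (z' $ i) = real CARD('p) * real_of_int (y i)" for i
      using y[of i] by (metis of_int_diff of_int_mult of_int_of_nat_eq)
    then show ?thesis by (simp add: vec_eq_iff)
  qed
  have l: "h *v of_int_vec z - h *v of_int_vec z' = l"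
    unfolding matrix_vector_mult_diff_distrib[symmetric] zy
    by (simp add: h_def l_def scaleR_matrix_vector_assoc[symmetric] matrix_vector_mult_scaleR)
  obtain k k' where k: "k \<in> K" "k' \<in> K" "h *v of_int_vec z = a *\<^sub>R k" "h *v of_int_vec z' = a *\<^sub>R k'"
    using z by (auto simp: pts_def)
  define k'' where "k'' = (a / b) *\<^sub>R k + (1 - a / b) *\<^sub>R k'"
  have k'': "k'' \<in> K"
    unfolding k''_def using K k a by (intro convexD) auto
  have bk'': "b *\<^sub>R k'' = a *\<^sub>R k + b *\<^sub>R k' - a *\<^sub>R k'"
    using a by (simp add: k''_def scaleR_add_right scaleR_diff_left right_diff_distrib scaleR_diff_right)
  have "0 + b *\<^sub>R k'' = l + b *\<^sub>R k'"
    unfolding bk'' l[symmetric] k by simp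
  then have "(\<lambda>k. 0 + k) ` (*\<^sub>R) b ` K \<inter> (\<lambda>k. l + k) ` (*\<^sub>R) b ` K \<noteq> {}"
    using k'' k by blast
  moreover have "0 \<in> lattice_of g"
    unfolding lattice_of_def by (intro range_eqI[of _ _ 0]) (simp add: vec_eq_iff matrix_vector_mult_def)
  moreover have "l \<in> lattice_of g" by (simp add: lattice_of_def l_def)
  ultimately have "l = 0" using pack unfolding is_packing_def disjoint_family_on_def by metis
  then have "real CARD('p) *\<^sub>R (h *v of_int_vec z) = real CARD('p) *\<^sub>R (h *v of_int_vec z')" using l by simp
  then have "g *v of_int_vec z = g *v of_int_vec z'"
    by (simp add: h_def scaleR_matrix_vector_assoc[symmetric])
  then show "z = z'" by (simp add: invertible_mult_eq_iff[OF g])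
qed

lemma covering_refine:
  fixes g :: "real ^ 'n ^ 'n" and p c :: real
  assumes cov: "is_covering (lattice_of g) ((*\<^sub>R) c ` K)" and p: "0 < p"
  defines "h \<equiv> (1 / p) *\<^sub>R g"
  obtains y k where "k \<in> K" "x = h *v of_int_vec y + (c / p) *\<^sub>R k"
proof -
  have "p *\<^sub>R x \<in> {l + k | l k. l \<in> lattice_of g \<and> k \<in> (*\<^sub>R) c ` K}"
    using cov by (simp add: is_covering_def)
  then obtain y k where "k \<in> K" and px: "p *\<^sub>R x = g *v of_int_vec y + c *\<^sub>R k"
    by (auto simp: lattice_of_def)
  have "x = (1 / p) *\<^sub>R (p *\<^sub>R x)" using p by simp
  also have "\<dots> = h *v of_int_vec y + (c / p) *\<^sub>R k"
    unfolding px by (simp add: h_def scaleR_add_right scaleR_matrix_vector_assoc)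
  finally show ?thesis using \<open>k \<in> K\<close> that by blast
qed

text \<open>Arbitrary centres are exchanged for lattice centres at the price of enlarging the dilate
  by u; the offset u k is absorbed by convexity.\<close>

lemma pts_subset_lattice_centre:
  fixes K :: "(real ^ 'n) set"
  assumes K: "convex K" and cov: "\<And>x. \<exists>y k. k \<in> K \<and> x = h *v of_int_vec y + u *\<^sub>R k"
    and a: "0 < a" "0 \<le> u"
  shows "\<exists>y. pts h ((*\<^sub>R) a ` K) x \<subseteq> pts h ((*\<^sub>R) (a + u) ` K) (h *v of_int_vec y)"
    and "\<exists>y. pts h ((*\<^sub>R) a ` K) (h *v of_int_vec y) \<subseteq> pts h ((*\<^sub>R) (a + u) ` K) x"
proof -
  obtain y k where yk: "k \<in> K" "x = h *v of_int_vec y + u *\<^sub>R k" using cov by blast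
  show "\<exists>y. pts h ((*\<^sub>R) a ` K) x \<subseteq> pts h ((*\<^sub>R) (a + u) ` K) (h *v of_int_vec y)"
  proof (intro exI[of _ y] subsetI)
    fix z assume "z \<in> pts h ((*\<^sub>R) a ` K) x"
    then have "(h *v of_int_vec z - x) + u *\<^sub>R k \<in> (*\<^sub>R) (a + u) ` K"
      unfolding pts_def by (intro scaled_add_mem K yk a) simp
    then show "z \<in> pts h ((*\<^sub>R) (a + u) ` K) (h *v of_int_vec y)"
      by (simp add: pts_def yk(2) algebra_simps)
  qed
  \<comment> \<open>Decomposing -x puts u k on the side where it is added; with x it would have to
    be subtracted, and K need not be symmetric.\<close>
  obtain y k where yk: "k \<in> K" "- x = h *v of_int_vec y + u *\<^sub>R k" using cov by blast
  have "x = - (- x)" by simp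
  then have x: "x = - (h *v of_int_vec y) - u *\<^sub>R k" unfolding yk(2) by simp
  have neg: "h *v of_int_vec (- y) = - (h *v of_int_vec y)"
    using matrix_vector_mult_diff_distrib[of h 0 "of_int_vec y"] by (simp add: of_int_vec_def vec_eq_iff matrix_vector_mult_def sum_negf)
  show "\<exists>y. pts h ((*\<^sub>R) a ` K) (h *v of_int_vec y) \<subseteq> pts h ((*\<^sub>R) (a + u) ` K) x"
  proof (intro exI[of _ "- y"] subsetI)
    fix z assume "z \<in> pts h ((*\<^sub>R) a ` K) (h *v of_int_vec (- y))"
    then have "(h *v of_int_vec z + h *v of_int_vec y) + u *\<^sub>R k \<in> (*\<^sub>R) (a + u) ` K"
      unfolding pts_def neg by (intro scaled_add_mem K yk a) simp
    then show "z \<in> pts h ((*\<^sub>R) (a + u) ` K) x"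
      by (simp add: pts_def x algebra_simps)
  qed
qed

section \<open>From balanced subspaces to the discrepancy of L(S)\<close>

lemma measure_pos_if_interior:
  fixes K :: "(real ^ 'n) set"
  assumes "bounded K" "convex K" "interior K \<noteq> {}"
  shows "0 < measure lebesgue K"
proof (rule ccontr)
  assume "\<not> ?thesis"
  then have "negligible K"
    using measurable_convex[OF assms(2,1)] by (simp add: negligible_iff_measure not_less measure_le_0_iff)
  then have "negligible (interior K)" by (rule negligible_subset) (rule interior_subset)
  then show False using open_not_negligible[OF open_interior assms(3)] by simp
qed

lemma one_plus_power_le:
  fixes x :: real
  assumes "0 \<le> x" "real n * x \<le> 1"
  shows "(1 + x) ^ n \<le> 1 + 2 * (real n * x)"
proof -
  have "(1 + x) ^ n \<le> exp x ^ n" using assms by (intro power_mono exp_ge_add_one_self) auto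
  also have "\<dots> = exp (real n * x)" by (simp add: exp_of_nat_mult)
  also have "\<dots> \<le> 1 + real n * x + (real n * x)\<^sup>2" using assms by (intro exp_bound) auto
  also have "(real n * x)\<^sup>2 \<le> real n * x" using assms by (simp add: power2_eq_square mult_left_le)
  finally show ?thesis by (simp add: mult.commute)
qed

theorem theorem3p4:
  fixes \<delta> \<tau> c :: real
    and p r :: nat
    and g :: "real ^ 'n ^ 'n"
    and L K :: "(real ^ 'n) set"
  assumes "CARD('n) \<ge> 5"
    and "0 < \<delta>" "\<delta> < 1" "0 < \<tau>" "\<tau> < 1"
    and "p = CARD('p::prime_card)"
    and "real p > 64 * real CARD('n) / (\<tau> * \<delta>)\<^sup>2"
    and "invertible g" "L = lattice_of g"
    and "bounded K" "convex K" "interior K \<noteq> {}"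
    and "1 < c" "c < real p / (2 * real CARD('n))"
    and "is_packing L ((*\<^sub>R) (1 + c / real p) ` K)"
    and "is_covering L ((*\<^sub>R) c ` K)"
    and "4 \<le> r" "r \<le> CARD('n)"
    and "real r > 3 + log (real p) (covol L / measure lebesgue K)
           + 3 * c * (real CARD('n) / (real p * ln (real p)))"
  shows "measure_pmf.prob (pmf_of_set (Gr r :: (('p mod_ring) ^ 'n) set set))
           {S. eta K (lattice_lift g S) \<ge> \<tau> + 8 * c * (real CARD('n) / real p)} < 2 * \<delta>"
proof -
  let ?n = "CARD('n)"
  note p = \<open>p = CARD('p)\<close>
  note g = \<open>invertible g\<close> and K = \<open>bounded K\<close> \<open>convex K\<close>
  define q where "q = real p"
  have "prime p" unfolding p by (rule prime_card)
  then have q1: "1 < q" unfolding q_def using prime_gt_1_nat[of p] by simp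
  then have q0: "0 < q" by simp
  define u where "u = c / q"
  define h where "h = (1 / q) *\<^sub>R g"
  define vol where "vol = measure lebesgue K"
  have n5: "5 \<le> real ?n" using assms(1) by simp
  have u0: "0 < u" using \<open>1 < c\<close> q0 by (simp add: u_def)
  have un: "u * ?n < 1 / 2"
    using assms(14) q0 n5 by (simp add: u_def q_def field_simps)
  have "u * 5 \<le> u * ?n" using n5 u0 by (intro mult_left_mono) auto
  then have u10: "u < 1 / 10" using un by linarith
  have vol: "0 < vol" unfolding vol_def by (rule measure_pos_if_interior) (fact assms)+
  have det0: "0 < \<bar>det g\<bar>" using g by (simp add: invertible_det_nz)
  have "h = (\<chi> i. (1 / q) *s g $ i)" by (simp add: h_def vec_eq_iff)
  then have "det h = (1 / q) ^ ?n * det g"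
    by (simp add: det_rows_mul[of "\<lambda>_. 1 / q" "\<lambda>i. g $ i"])
  then have deth: "\<bar>det h\<bar> = \<bar>det g\<bar> / q ^ ?n" using q0 by (simp add: abs_mult power_one_over)
  have h: "invertible h" using deth det0 q0 by (auto simp: invertible_det_nz)
  \<comment> \<open>This is vol(K)/covol(L(S)), the count that \<open>eta\<close> takes as
    reference.\<close>
  define W where "W = vol / (\<bar>det g\<bar> / q ^ r)"
  have W0: "0 < W" using vol det0 q0 by (simp add: W_def)
  have W_gt: "q ^ 3 * exp (3 * u * ?n) < W"
  proof -
    have lnq: "0 < ln q" using q1 by simp
    have "real r * ln q > (3 + log q (\<bar>det g\<bar> / vol) + 3 * c * (?n / (q * ln q))) * ln q"
      using assms(19) lnq unfolding q_def vol_def assms(9) covol_lattice_of[OF g] by (intro mult_strict_right_mono) auto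
    also have "(3 + log q (\<bar>det g\<bar> / vol) + 3 * c * (?n / (q * ln q))) * ln q =
        3 * ln q + ln (\<bar>det g\<bar> / vol) + 3 * u * ?n"
      using lnq q0 by (simp add: log_def u_def field_simps)
    finally have "exp (3 * ln q + ln (\<bar>det g\<bar> / vol) + 3 * u * ?n) < exp (real r * ln q)" by simp
    then have "q ^ 3 * (\<bar>det g\<bar> / vol) * exp (3 * u * ?n) < q ^ r"
      using q0 det0 vol by (simp add: exp_add exp_of_nat_mult exp_of_nat_mult[of 3, simplified])
    then show ?thesis using vol det0 q0 by (simp add: W_def field_simps)
  qed
  \<comment> \<open>Here (1 - 2u)(1 + 3u) = 1 + u (1 - 6u) \<ge> 1 because u < 1/10. The term with
    3c in the lower bound for r supplies the factor exp(3un) that pays for shrinking K.\<close>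
  have low: "(1 - 2 * u) ^ ?n * exp (3 * u * ?n) \<ge> 1"
  proof -
    have "1 \<le> 1 + u * (1 - 6 * u)" using u0 u10 by simp
    also have "\<dots> = (1 - 2 * u) * (1 + 3 * u)" by (simp add: algebra_simps)
    also have "\<dots> \<le> (1 - 2 * u) * exp (3 * u)"
      using u10 exp_ge_add_one_self[of "3 * u"] by (intro mult_left_mono) auto
    finally have "1 \<le> ((1 - 2 * u) * exp (3 * u)) ^ ?n" by (rule one_le_power)
    then show ?thesis by (simp add: power_mult_distrib exp_of_nat_mult[symmetric] mult_ac)
  qed
  have W_low: "q ^ 3 \<le> (1 - 2 * u) ^ ?n * W"
  proof -
    have "q ^ 3 * 1 \<le> q ^ 3 * ((1 - 2 * u) ^ ?n * exp (3 * u * ?n))"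
      using low q0 by (intro mult_left_mono) auto
    also have "\<dots> = (1 - 2 * u) ^ ?n * (q ^ 3 * exp (3 * u * ?n))" by simp
    also have "\<dots> \<le> (1 - 2 * u) ^ ?n * W" using W_gt u10 by (intro mult_left_mono) auto
    finally show ?thesis by simp
  qed
  define Ks where "Ks a = (*\<^sub>R) a ` K" for a
  have Ks: "Ks a \<in> lmeasurable" "bounded (Ks a)" for a
    unfolding Ks_def by (rule scaled_lmeasurable_bounded[OF K])+
  have mKs: "measure lebesgue (Ks a) = a ^ ?n * vol" if "0 < a" for a
    unfolding Ks_def vol_def using that by (rule measure_scaled)
  have Ks1: "Ks 1 = K" by (simp add: Ks_def)
  have finp: "finite (pts h (Ks a) x)" for a x by (rule finite_pts[OF h Ks(2)])
  have cov: "\<exists>y k. k \<in> K \<and> x = h *v of_int_vec y + u *\<^sub>R k" for x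
    using covering_refine[OF assms(16)[unfolded assms(9)] q0, of x] unfolding h_def u_def by metis
  have up: "\<exists>y. pts h (Ks a) x \<subseteq> pts h (Ks (a + u)) (h *v of_int_vec y)"
    and down: "\<exists>y. pts h (Ks a) (h *v of_int_vec y) \<subseteq> pts h (Ks (a + u)) x" if "0 < a" for a x
    unfolding Ks_def using pts_subset_lattice_centre[OF K(2) cov that] u0 by auto
  define N where "N a = card (pts h (Ks a) 0)" for a
  have card_up: "card (pts h (Ks a) x) \<le> N (a + u)" if "0 < a" for a x
    using up[OF that, of x] card_mono[OF finp] card_pts_shift unfolding N_def by metis
  have card_down: "N a \<le> card (pts h (Ks (a + u)) x)" if "0 < a" for a x
    using down[OF that, of x] card_mono[OF finp] card_pts_shift unfolding N_def by metis
  \<comment> \<open>Averaging over all centres turns counts into volumes. N counts at lattice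
    centres only, so each comparison costs another u.\<close>
  have N_ge: "a ^ ?n * vol \<le> N (a + u) * \<bar>det h\<bar>" if "0 < a" for a
    using measure_le_if_pts_le[OF h Ks, of a "N (a + u)"] card_up[OF that] mKs[OF that] by simp
  have N_le: "N a * \<bar>det h\<bar> \<le> (a + u) ^ ?n * vol" if "0 < a" for a
    using measure_ge_if_pts_ge[OF h Ks, of "N a" "a + u"] card_down[OF that] mKs[of "a + u"] that u0 by simp
  define A where "A a = (of_int_vec ` pts h (Ks a) 0 :: ('p mod_ring ^ 'n) set)" for a
  have injA: "inj_on (of_int_vec :: _ \<Rightarrow> 'p mod_ring ^ 'n) (pts h (Ks a) 0)" if "0 < a" "a \<le> 1 + u" for a
    using packing_imp_inj_on_pts[OF g K(2) assms(15)[unfolded assms(9)], of a, where 'p = 'p] that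
    unfolding h_def Ks_def u_def q_def p by simp
  have cA: "card (A a) = N a" if "0 < a" "a \<le> 1 + u" for a
    unfolding A_def N_def using injA[OF that] by (rule card_image)
  define M where "M a = card (A a) * q ^ r / q ^ ?n" for a
  have M_eq: "M a * (vol / W) = N a * \<bar>det h\<bar>" if "0 < a" "a \<le> 1 + u" for a
    using q0 vol det0 by (simp add: M_def cA[OF that] W_def deth field_simps)
  have M_ge: "a ^ ?n * W \<le> M (a + u)" if "0 < a" "a \<le> 1" for a
  proof -
    have "a ^ ?n * vol \<le> M (a + u) * (vol / W)" using N_ge[of a] M_eq[of "a + u"] that u0 by simp
    then show ?thesis using vol W0 by (simp add: field_simps)
  qed
  have M_le: "M (1 + u) \<le> (1 + 2 * u) ^ ?n * W"
  proof -
    have "M (1 + u) * (vol / W) \<le> (1 + 2 * u) ^ ?n * vol" using N_le[of "1 + u"] M_eq[of "1 + u"] u0 by (simp add: algebra_simps)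
    then show ?thesis using vol W0 by (simp add: field_simps)
  qed
  \<comment> \<open>One u is spent on squeezing K between dilates and one on comparing counts with
    volume, hence 1 - 2u here and 1 + 2u in \<open>M_le\<close>.\<close>
  have M_minus: "(1 - 2 * u) ^ ?n * W \<le> M (1 - u)" using M_ge[of "1 - 2 * u"] u0 u10 by simp
  have M_plus: "W \<le> M (1 + u)" using M_ge[of 1] by simp
  have q3_plus: "q ^ 3 \<le> M (1 + u)"
  proof -
    have "(1 - 2 * u) ^ ?n * W \<le> 1 * W" using u0 u10 W0 by (intro mult_right_mono power_le_one) auto
    then show ?thesis using W_low M_plus by simp
  qed
  have q3_minus: "q ^ 3 \<le> M (1 - u)" using W_low M_minus by linarith
  define G where "G = {S :: ('p mod_ring ^ 'n) set. vec.subspace S \<and> vec.dim S = r}"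
  \<comment> \<open>Only two events matter, too many points in the outer dilate and too few in the
    inner one. Each has probability below \<delta>, whence the factor 2.\<close>
  define Bad where "Bad \<sigma> a = {S. vec.subspace S \<and> vec.dim S = r \<and>
      (\<exists>y. \<sigma> * (card (A a \<inter> (+) y ` S) - M a) > \<tau> * M a)}" for \<sigma> :: real and a
  have bad: "card (Bad \<sigma> a) < \<delta> * card G" if "\<bar>\<sigma>\<bar> = 1" "q ^ 3 \<le> M a" for \<sigma> a
    unfolding Bad_def G_def
    by (rule random_subspace_balanced[where q = q]) (use assms that in \<open>simp_all add: q_def M_def\<close>)
  \<comment> \<open>B is (1 + \<tau>)(1 + 4un) - 1, the upper error; the lower error is smaller.
    Since \<tau> < 1, it stays strictly below the threshold.\<close>
  define B where "B = \<tau> + 4 * (u * ?n) * (1 + \<tau>)"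
  have B_less: "B < \<tau> + 8 * c * (?n / q)"
  proof -
    have "(u * ?n) * (1 + \<tau>) < (u * ?n) * 2" using u0 n5 assms(5) by (intro mult_strict_left_mono) auto
    then show ?thesis by (simp add: B_def u_def)
  qed
  have eta_le: "eta K (lattice_lift g S) \<le> B" if S: "S \<in> G" "S \<notin> Bad 1 (1 + u)" "S \<notin> Bad (-1) (1 - u)" for S
    unfolding eta_def
  proof (rule cSUP_least)
    fix x
    have Sr: "vec.subspace S" "vec.dim S = r" using S(1) by (auto simp: G_def)
    have Weq: "measure lebesgue K / covol (lattice_lift g S) = W"
      using covol_lattice_lift[OF Sr(1) g] by (simp add: Sr(2) W_def vol_def q_def p)
    define cnt where "cnt = lattice_count (lattice_lift g S) K x"
    have cnt: "cnt = card {z \<in> pts h K x. of_int_vec z \<in> S}"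
      unfolding cnt_def h_def q_def p by (rule lattice_count_lift[OF g])
    have finS: "finite {z \<in> pts h (Ks a) x. of_int_vec z \<in> S}" for a x using finp by simp
    obtain y where y: "pts h (Ks 1) x \<subseteq> pts h (Ks (1 + u)) (h *v of_int_vec y)" using up[of 1 x] by auto
    have "card {z \<in> pts h (Ks (1 + u)) (h *v of_int_vec y). of_int_vec z \<in> S} =
        card (A (1 + u) \<inter> (+) (- of_int_vec y) ` S)"
      unfolding A_def by (rule card_pts_mod[OF injA]) (use u0 in auto)
    moreover have "cnt \<le> card {z \<in> pts h (Ks (1 + u)) (h *v of_int_vec y). of_int_vec z \<in> S}"
      unfolding cnt by (intro card_mono finS) (use y in \<open>auto simp: Ks1\<close>)
    ultimately have "real cnt \<le> card (A (1 + u) \<inter> (+) (- of_int_vec y) ` S)" by simp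
    also have "\<dots> \<le> M (1 + u) + \<tau> * M (1 + u)"
    proof -
      have "\<not> 1 * (card (A (1 + u) \<inter> (+) (- of_int_vec y) ` S) - M (1 + u)) > \<tau> * M (1 + u)"
        using S Sr unfolding Bad_def by blast
      then show ?thesis
        by (simp only: not_less mult_1 mult_minus1 minus_diff_eq diff_le_eq add.commute)
    qed
    also have "\<dots> = (1 + \<tau>) * M (1 + u)" by (simp add: algebra_simps)
    also have "\<dots> \<le> (1 + \<tau>) * ((1 + 4 * (u * ?n)) * W)"
    proof -
      have "(1 + 2 * u) ^ ?n * W \<le> (1 + 4 * (u * ?n)) * W"
        using one_plus_power_le[of "2 * u" ?n] u0 un W0 by (intro mult_right_mono) (auto simp: mult_ac)
      then show ?thesis using M_le assms(4) by (intro mult_left_mono) auto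
    qed
    also have "\<dots> = (1 + B) * W" by (simp add: B_def algebra_simps)
    finally have upper: "cnt \<le> (1 + B) * W" .
    obtain y where y: "pts h (Ks (1 - u)) (h *v of_int_vec y) \<subseteq> pts h (Ks 1) x" using down[of "1 - u" x] u10 by auto
    have "(1 - B) * W \<le> (1 - \<tau>) * ((1 - 2 * (u * ?n)) * W)"
    proof -
      have "0 \<le> u * ?n * (2 + 6 * \<tau>)" using u0 assms(4) by simp
      then have "1 - B \<le> (1 - \<tau>) * (1 - 2 * (u * ?n))" by (simp add: B_def algebra_simps)
      then show ?thesis using W0 mult_right_mono[of "1 - B" _ W] by (simp add: mult.assoc)
    qed
    also have "\<dots> \<le> (1 - \<tau>) * M (1 - u)"
    proof -
      have "1 - 2 * (u * ?n) \<le> (1 - 2 * u) ^ ?n"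
        using Bernoulli_inequality[of "- (2 * u)" ?n] u10 by (simp add: mult_ac)
      then have "(1 - 2 * (u * ?n)) * W \<le> (1 - 2 * u) ^ ?n * W" using W0 by (intro mult_right_mono) auto
      then show ?thesis using M_minus assms(5) by (intro mult_left_mono) auto
    qed
    also have "\<dots> = M (1 - u) - \<tau> * M (1 - u)" by (simp add: algebra_simps)
    also have "\<dots> \<le> card (A (1 - u) \<inter> (+) (- of_int_vec y) ` S)"
    proof -
      have "\<not> - 1 * (card (A (1 - u) \<inter> (+) (- of_int_vec y) ` S) - M (1 - u)) > \<tau> * M (1 - u)"
        using S Sr unfolding Bad_def by blast
      then show ?thesis
        by (simp only: not_less mult_1 mult_minus1 minus_diff_eq diff_le_eq add.commute)
    qed
    also have "\<dots> \<le> real cnt"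
    proof -
      have "card {z \<in> pts h (Ks (1 - u)) (h *v of_int_vec y). of_int_vec z \<in> S} =
          card (A (1 - u) \<inter> (+) (- of_int_vec y) ` S)"
        unfolding A_def by (rule card_pts_mod[OF injA]) (use u0 u10 in auto)
      moreover have "card {z \<in> pts h (Ks (1 - u)) (h *v of_int_vec y). of_int_vec z \<in> S} \<le> cnt"
        unfolding cnt by (intro card_mono finS[of 1, unfolded Ks1]) (use y in \<open>auto simp: Ks1\<close>)
      ultimately show ?thesis by simp
    qed
    finally have lower: "(1 - B) * W \<le> cnt" .
    have "\<bar>real cnt / W - 1\<bar> \<le> B"
      using upper lower W0 by (simp add: abs_le_iff field_simps)
    then show "\<bar>real (lattice_count (lattice_lift g S) K x) / (measure lebesgue K / covol (lattice_lift g S)) - 1\<bar> \<le> B"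
      by (simp add: Weq cnt_def)
  qed simp
  have GrG: "(Gr r :: ('p mod_ring ^ 'n) set set) = G" by (simp add: Gr_def G_def)
  have finG: "finite G" by simp
  have b1: "card (Bad 1 (1 + u)) < \<delta> * card G" by (rule bad) (use q3_plus in auto)
  have b2: "card (Bad (-1) (1 - u)) < \<delta> * card G" by (rule bad) (use q3_minus in auto)
  \<comment> \<open>The strict bound \<open>b1\<close> already excludes that G is empty.\<close>
  have G0: "0 < real (card G)"
  proof -
    have "0 < \<delta> * card G" using b1 of_nat_0_le_iff le_less_trans by blast
    then show ?thesis using assms(2) by (simp add: zero_less_mult_iff)
  qed
  then have Gne: "G \<noteq> {}" by auto
  let ?X = "{S. eta K (lattice_lift g S) \<ge> \<tau> + 8 * c * (real ?n / real p)}"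
  have "G \<inter> ?X \<subseteq> Bad 1 (1 + u) \<union> Bad (-1) (1 - u)"
    using eta_le B_less unfolding q_def by force
  then have "card (G \<inter> ?X) \<le> card (Bad 1 (1 + u) \<union> Bad (-1) (1 - u))" by (intro card_mono) auto
  also have "\<dots> \<le> card (Bad 1 (1 + u)) + card (Bad (-1) (1 - u))" by (rule card_Un_le)
  finally have "real (card (G \<inter> ?X)) < 2 * \<delta> * card G" using b1 b2 by linarith
  then have "card (G \<inter> ?X) / card G < 2 * \<delta>" using G0 by (simp add: field_simps)
  then show ?thesis unfolding GrG measure_pmf_of_set[OF Gne finG] .
qed

end
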